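(* Let $0 \le \varepsilon_1 < \varepsilon_2 \le 1$, $\delta \in (0,1)$ and $k \in \mathbb{N}$. There is an algorithm which, given query access to the time evolution operator of an $n$-qubit Hamiltonian $H$ (with $\|H\|_\infty \le 1$) that is promised to be either (1) within normalized Frobenius distance $\varepsilon_1$ of some $k$-local Hamiltonian or (2) at normalized Frobenius distance at least $\varepsilon_2$ from every $k$-local Hamiltonian, decides which of (1) or (2) holds with probability at least $1-\delta$. The algorithm uses $O\!\left(\sqrt{\frac{\varepsilon_2}{(\varepsilon_2-\varepsilon_1)^{7}}}\log(1/\delta)\right)$ non-adaptive queries to the time evolution operator with $O\!\left(\sqrt{\frac{\varepsilon_2}{(\varepsilon_2-\varepsilon_1)^{5}}}\log(1/\delta)\right)$ total evolution time.
   Context: An $n$-qubit Hamiltonian is a $2^n\times 2^n$ Hermitian matrix $H$; throughout $\|H\|_\infty\le 1$ (spectral norm). The $n$-qubit Paulis are $\{I,X,Y,Z\}^{\otimes n}$; the weight $|P|$ of a Pauli $P$ is the number of non-identity tensor factors. Every Hamiltonian has a unique expansion $H=\sum_P \alpha_P P$ with real $\alpha_P$; $H$ is $k$-local if $\alpha_P=0$ whenever $|P|>k$. The normalized Frobenius norm is $\|A\|_2=\sqrt{\mathrm{tr}(A^\dagger A)/2^n}$, and the distance of $H$ to $k$-local is $\min\{\|H-K\|_2: K \text{ $k$-local}\}$. Query access: the algorithm may apply, for any chosen time $t_j\ge 0$, the unitary $e^{-iHt_j}=\sum_{m\ge0}(-iHt_j)^m/m!$ to a register of its choice (possibly alongside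 ancillas); its total evolution time is $\sum_j t_j$ over all queries and the number of queries is the number of such applications. Non-adaptive means the queries are fixed in advance, independent of measurement outcomes. *)

theory Defs
  imports Complex_Main "Jordan_Normal_Form.Matrix"
begin

definition adj :: "complex mat \<Rightarrow> complex mat" where
  "adj A = mat (dim_col A) (dim_row A) (\<lambda>(i,j). cnj (A $$ (j,i)))"

definition is_hermitian :: "nat \<Rightarrow> complex mat \<Rightarrow> bool" where
  "is_hermitian d A \<longleftrightarrow> A \<in> carrier_mat d d \<and> adj A = A"

definition is_unitary :: "nat \<Rightarrow> complex mat \<Rightarrow> bool" where
  "is_unitary d U \<longleftrightarrow> U \<in> carrier_mat d d \<and> adj U * U = 1\<^sub>m d"

definition vnorm :: "complex vec \<Rightarrow> real" where
  "vnorm v = sqrt (\<Sum>i<dim_vec v. (cmod (v $ i))\<^sup>2)"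

definition spec_norm :: "complex mat \<Rightarrow> real" where
  "spec_norm A = Sup {vnorm (A *\<^sub>v v) | v. v \<in> carrier_vec (dim_col A) \<and> vnorm v \<le> 1}"

definition kron :: "complex mat \<Rightarrow> complex mat \<Rightarrow> complex mat" where
  "kron A B = mat (dim_row A * dim_row B) (dim_col A * dim_col B)
     (\<lambda>(i,j). A $$ (i div dim_row B, j div dim_col B) * B $$ (i mod dim_row B, j mod dim_col B))"

definition mexp :: "complex mat \<Rightarrow> complex mat" where
  "mexp A = mat (dim_row A) (dim_col A) (\<lambda>(i,j). \<Sum>m. (A ^\<^sub>m m) $$ (i,j) / of_nat (fact m))"

definition time_evol :: "complex mat \<Rightarrow> real \<Rightarrow> complex mat" where
  "time_evol H t = mexp ((- \<i> * of_real t) \<cdot>\<^sub>m H)"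

definition pauli1 :: "nat \<Rightarrow> complex mat" where
  "pauli1 c = (if c = 1 then mat_of_rows_list 2 [[0,1],[1,0]]
     else if c = 2 then mat_of_rows_list 2 [[0,-\<i>],[\<i>,0]]
     else if c = 3 then mat_of_rows_list 2 [[1,0],[0,-1]]
     else 1\<^sub>m 2)"

definition pauli_strings :: "nat \<Rightarrow> nat list set" where
  "pauli_strings n = {p. length p = n \<and> set p \<subseteq> {0..<4}}"

definition pauli_mat :: "nat list \<Rightarrow> complex mat" where
  "pauli_mat p = foldr (\<lambda>c M. kron (pauli1 c) M) p (1\<^sub>m 1)"

definition pauli_weight :: "nat list \<Rightarrow> nat" where
  "pauli_weight p = length (filter (\<lambda>c. c \<noteq> 0) p)"

definition k_local :: "nat \<Rightarrow> nat \<Rightarrow> complex mat \<Rightarrow> bool" where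
  "k_local n k K \<longleftrightarrow> is_hermitian (2^n) K \<and>
     (\<exists>\<alpha> :: nat list \<Rightarrow> real.
        (\<forall>i<2^n. \<forall>j<2^n. K $$ (i,j) = (\<Sum>p\<in>pauli_strings n. of_real (\<alpha> p) * pauli_mat p $$ (i,j)))
      \<and> (\<forall>p\<in>pauli_strings n. pauli_weight p > k \<longrightarrow> \<alpha> p = 0))"

definition nfrob :: "nat \<Rightarrow> complex mat \<Rightarrow> real" where
  "nfrob n A = sqrt ((\<Sum>i<2^n. \<Sum>j<2^n. (cmod (A $$ (i,j)))\<^sup>2) / 2^n)"

definition dist_k_local :: "nat \<Rightarrow> nat \<Rightarrow> complex mat \<Rightarrow> real" where
  "dist_k_local n k H = Inf ((\<lambda>K. nfrob n (H - K)) ` {K. k_local n k K})"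

definition hamiltonian :: "nat \<Rightarrow> complex mat \<Rightarrow> bool" where
  "hamiltonian n H \<longleftrightarrow> is_hermitian (2^n) H \<and> spec_norm H \<le> 1"

text \<open>
  A non-adaptive algorithm for n-qubit Hamiltonians: a number a of ancilla qubits,
  a fixed list of evolution times ts = [t_1,...,t_m] (all nonnegative), unitaries
  V_0,...,V_m on n+a qubits, and an accepting set S of computational-basis outcomes.
  Starting from the all-zero basis state, it applies V_0, then for each j the query
  e^{-iHt_j} on the n system qubits (tensored with the identity on the ancillas)
  followed by V_j, and finally measures in the computational basis, accepting iff
  the outcome lies in S.  Qubit permutations, intermediate measurements and classical
  randomness are absorbed into the V_j and the ancillas (deferred measurement).
\<close>
record qalg =
  anc :: nat
  times :: "real list"
  unis :: "complex mat list"
  acc :: "nat set"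

definition valid_qalg :: "nat \<Rightarrow> qalg \<Rightarrow> bool" where
  "valid_qalg n A \<longleftrightarrow>
     length (unis A) = Suc (length (times A)) \<and>
     (\<forall>t\<in>set (times A). t \<ge> 0) \<and>
     (\<forall>V\<in>set (unis A). is_unitary (2^(n + anc A)) V) \<and>
     acc A \<subseteq> {..<2^(n + anc A)}"

definition num_queries :: "qalg \<Rightarrow> nat" where
  "num_queries A = length (times A)"

definition total_time :: "qalg \<Rightarrow> real" where
  "total_time A = sum_list (times A)"

definition final_state :: "nat \<Rightarrow> qalg \<Rightarrow> complex mat \<Rightarrow> complex vec" where
  "final_state n A H =
     fold (\<lambda>(t, V) \<psi>. V *\<^sub>v (kron (time_evol H t) (1\<^sub>m (2^anc A)) *\<^sub>v \<psi>))
       (zip (times A) (tl (unis A)))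
       (hd (unis A) *\<^sub>v unit_vec (2^(n + anc A)) 0)"

definition accept_prob :: "nat \<Rightarrow> qalg \<Rightarrow> complex mat \<Rightarrow> real" where
  "accept_prob n A H = (\<Sum>x\<in>acc A. (cmod (final_state n A H $ x))\<^sup>2)"

end

theory Submission
  imports Defs "Jordan_Normal_Form.Determinant" "HOL-Analysis.L2_Norm"
begin

text \<open>
  Apply the evolution to one half of a maximally entangled state, so that the state is the
  identity in Pauli coordinates. Between two short evolutions of length \<open>\<tau>\<close>, reflect the
  coordinates of the non-identity Paulis of weight at most \<open>k\<close>. Up to an error of order \<open>t \<tau>\<close>
  in total time \<open>t\<close>, the reflections decouple these coordinates, and the state evolves under a
  Hamiltonian that only couples the identity to itself and to the Paulis of weight above \<open>k\<close>.
  The amplitude in the latter is then \<open>t \<eta> (1 + O(t\<^sup>2))\<close>, where \<open>\<eta>\<close> is the distance to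
  \<open>k\<close>-local: the second-order term of the evolution is real-orthogonal to the first-order term.
  Hence \<open>t\<close> may be of order \<open>sqrt (\<Delta> / \<epsilon>2)\<close> and \<open>\<tau>\<close> of order \<open>\<Delta>\<close>, where
  \<open>\<Delta> = \<epsilon>2 - \<epsilon>1\<close>, and a Chernoff bound over \<open>O(ln (1 / \<delta>) / (t \<Delta>)\<^sup>2)\<close> independent runs
  separates the two cases. If \<open>\<delta> \<ge> 1 / 2\<close> then a fair coin suffices.
\<close>

section \<open>Norms and kernels on finite index sets\<close>

text \<open>Bare evolution would not do: a product of two Paulis of weight at most \<open>k\<close>
  can have weight up to \<open>2 * k\<close>, so the second-order term puts an amplitude of order
  \<open>t^2\<close> on high weights even if the distance \<eta> is zero. Once the low weights are
  decoupled, every path from the identity into the high weights enters through a high-weight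
  coefficient of \<open>H\<close>, so all errors of the decoupled dynamics carry a factor \<eta>.
  What is left is a relative error of order \<open>t^2\<close>, harmless if
  \<open>t^2 * \<epsilon>2\<close> is a small multiple of \<Delta>; this fixes \<open>t\<close>. A
  high-weight outcome has probability about \<open>(t * \<eta>)^2\<close>, and the square roots of
  these probabilities differ by about \<open>t * \<Delta>\<close> between the two cases. Since the
  variance of the count is at most its mean, the number of runs does not depend on \<eta>. A run has
  \<open>t / \<tau>\<close> queries and time \<open>t\<close>, so the totals are of order
  \<open>1 / (t * \<Delta>^3)\<close> and \<open>1 / (t * \<Delta>^2)\<close>, times
  \<open>ln (1 / \<delta>)\<close>; inserting \<open>t\<close> gives the two square roots of the
  theorem.\<close>

definition nrm :: "nat set \<Rightarrow> (nat \<Rightarrow> complex) \<Rightarrow> real" where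
  "nrm I f = L2_set (\<lambda>i. cmod (f i)) I"

lemma nrm_nonneg [simp]: "0 \<le> nrm I f"
  by (simp add: nrm_def)

lemma nrm_cong: "(\<And>i. i \<in> I \<Longrightarrow> f i = g i) \<Longrightarrow> nrm I f = nrm I g"
  unfolding nrm_def by (rule L2_set_cong) auto

lemma nrm_power2: "(nrm I f)\<^sup>2 = (\<Sum>i\<in>I. (cmod (f i))\<^sup>2)"
  by (simp add: nrm_def L2_set_def sum_nonneg)

lemma nrm_add: "nrm I (\<lambda>i. f i + g i) \<le> nrm I f + nrm I g"
proof -
  have "nrm I (\<lambda>i. f i + g i) \<le> L2_set (\<lambda>i. cmod (f i) + cmod (g i)) I"
    unfolding nrm_def by (intro L2_set_mono) (auto simp: norm_triangle_ineq)
  also have "\<dots> \<le> nrm I f + nrm I g"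
    unfolding nrm_def by (rule L2_set_triangle_ineq)
  finally show ?thesis .
qed

lemma nrm_scale: "nrm I (\<lambda>i. c * f i) = cmod c * nrm I f"
  by (simp add: nrm_def norm_mult L2_set_right_distrib)

lemma nrm_diff: "nrm I (\<lambda>i. f i - g i) \<le> nrm I f + nrm I g"
  using nrm_add[of I f "\<lambda>i. (-1) * g i"] nrm_scale[of I "-1" g] by simp

lemma nrm_lincomb_le:
  assumes "nrm I f \<le> a" "nrm I g \<le> b" "0 \<le> a" "0 \<le> b" "cmod c \<le> c'"
  shows "nrm I (\<lambda>i. f i - c * g i) \<le> a + c' * b"
proof -
  have "cmod c * nrm I g \<le> c' * b"
    using assms by (intro mult_mono) (auto intro: order_trans[OF norm_ge_zero])
  then show ?thesis
    using nrm_diff[of I f "\<lambda>i. c * g i"] assms by (simp add: nrm_scale)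
qed

lemma nrm_subset: "finite J \<Longrightarrow> I \<subseteq> J \<Longrightarrow> nrm I f \<le> nrm J f"
  unfolding nrm_def L2_set_def by (intro real_sqrt_le_mono sum_mono2) auto

lemma nrm_unimodular:
  "(\<And>i. i \<in> I \<Longrightarrow> cmod (\<sigma> i) = 1) \<Longrightarrow> nrm I (\<lambda>i. \<sigma> i * f i) = nrm I f"
  unfolding nrm_def by (intro L2_set_cong) (auto simp: norm_mult)

lemma cmod_le_nrm: "finite I \<Longrightarrow> i \<in> I \<Longrightarrow> cmod (f i) \<le> nrm I f"
  unfolding nrm_def by (rule member_le_L2_set)

lemma nrm_restrict:
  assumes "finite J" "I \<subseteq> J"
  shows "nrm J (\<lambda>i. if i \<in> I then f i else 0) = nrm I f"
  unfolding nrm_def L2_set_def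
  using assms by (intro arg_cong[of _ _ sqrt]) (auto intro!: sum.mono_neutral_cong_right)

definition ap :: "nat \<Rightarrow> (nat \<Rightarrow> nat \<Rightarrow> complex) \<Rightarrow> (nat \<Rightarrow> complex) \<Rightarrow> nat \<Rightarrow> complex" where
  "ap d K f i = (\<Sum>j<d. K i j * f j)"

lemma ap_add: "ap d K (\<lambda>j. f j + g j) i = ap d K f i + ap d K g i"
  by (simp add: ap_def algebra_simps sum.distrib)

lemma ap_diff: "ap d K (\<lambda>j. f j - g j) i = ap d K f i - ap d K g i"
  by (simp add: ap_def algebra_simps sum_subtractf)

lemma ap_scale: "ap d K (\<lambda>j. c * f j) i = c * ap d K f i"
  by (simp add: ap_def sum_distrib_left algebra_simps)

lemma ap_cong: "(\<And>j. j < d \<Longrightarrow> f j = g j) \<Longrightarrow> ap d K f i = ap d K g i"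
  by (simp add: ap_def)

definition e0 :: "nat \<Rightarrow> complex" where "e0 i = (if i = 0 then 1 else 0)"

lemma nrm_e0: "0 < d \<Longrightarrow> nrm {..<d} e0 = 1"
proof -
  assume "0 < d"
  then have "(\<Sum>i<d. (cmod (e0 i))\<^sup>2) = (\<Sum>i<d. if i = 0 then 1 else 0)"
    by (intro sum.cong) (auto simp: e0_def)
  also have "\<dots> = 1" using \<open>0 < d\<close> by (simp add: sum.delta)
  finally show ?thesis by (simp add: nrm_def L2_set_def)
qed

lemma ap_e0: "0 < d \<Longrightarrow> ap d K e0 i = K i 0"
  by (simp add: ap_def e0_def if_distrib cong: if_cong)

section \<open>Interleaving the evolution with a reflection\<close>

text \<open>In the application, index 0 is the identity Pauli, \<open>Hi\<close> holds the Paulis of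
  weight above \<open>k\<close>, \<open>G\<close> is left multiplication by the Hamiltonian in Pauli
  coordinates and \<open>U\<close> its evolution for time \<tau>. Apart from Hermiticity,
  \<open>G\<close> and \<open>U\<close> enter only through norm estimates, so no constant depends on
  \<open>d\<close>.\<close>

locale zeno =
  fixes d :: nat and Hi :: "nat set" and G U :: "nat \<Rightarrow> nat \<Rightarrow> complex" and \<tau> :: real
  assumes d: "0 < d" and Hi: "Hi \<subseteq> {..<d}" "0 \<notin> Hi" and \<tau>: "0 \<le> \<tau>" "\<tau> \<le> 1"
    and herm: "\<And>i j. i < d \<Longrightarrow> j < d \<Longrightarrow> G j i = cnj (G i j)"
    and contr: "\<And>f. nrm {..<d} (ap d G f) \<le> nrm {..<d} f"
    and isom: "\<And>f. nrm {..<d} (ap d U f) = nrm {..<d} f"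
    and taylor: "\<And>f. nrm {..<d} (\<lambda>i. ap d U f i - (f i - \<i> * \<tau> * ap d G f i)) \<le> \<tau>\<^sup>2 * nrm {..<d} f"
begin

section \<open>Averaging the Hamiltonian over the reflection\<close>

text \<open>Conjugation by these signs negates exactly the entries of \<open>G\<close> that couple
  the identity and \<open>Hi\<close> to the remaining coordinates, so these entries cancel in the
  average \<open>A\<close>.\<close>

definition \<sigma> :: "nat \<Rightarrow> complex" where "\<sigma> i = (if i = 0 \<or> i \<in> Hi then 1 else -1)"

lemma sigma_simps [simp]: "\<sigma> i * \<sigma> i = 1" "\<sigma> i * (\<sigma> i * x) = x" "cmod (\<sigma> i) = 1" "\<sigma> 0 = 1"
  by (auto simp: \<sigma>_def)

abbreviation n2 where "n2 \<equiv> nrm {..<d}"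

lemma n2_sigma [simp]: "n2 (\<lambda>i. \<sigma> i * f i) = n2 f"
  by (rule nrm_unimodular) simp

text \<open>The part of \<open>G\<close> that commutes with the reflection \<open>\<sigma>\<close>.\<close>

definition A :: "(nat \<Rightarrow> complex) \<Rightarrow> nat \<Rightarrow> complex" where
  "A f i = (ap d G f i + \<sigma> i * ap d G (\<lambda>j. \<sigma> j * f j) i) / 2"

lemma A_diff: "A (\<lambda>i. f i - g i) i = A f i - A g i"
  by (simp add: A_def ap_diff algebra_simps diff_divide_distrib)

lemma n2_A: "n2 (A f) \<le> n2 f"
proof -
  let ?b = "\<lambda>i. \<sigma> i * ap d G (\<lambda>j. \<sigma> j * f j) i"
  have "n2 (A f) = n2 (\<lambda>i. (1/2) * (ap d G f i + ?b i))"
    by (rule nrm_cong) (simp add: A_def)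
  also have "\<dots> \<le> (1/2) * (n2 (ap d G f) + n2 ?b)"
    unfolding nrm_scale using nrm_add[of "{..<d}" "ap d G f" ?b] by simp
  also have "\<dots> \<le> (1/2) * (n2 f + n2 f)"
    using contr[of f] contr[of "\<lambda>j. \<sigma> j * f j"] by simp
  finally show ?thesis by simp
qed

definition s :: real where "s = 2 * \<tau>"

lemma s_nonneg: "0 \<le> s" using \<tau> by (simp add: s_def)

definition step :: "(nat \<Rightarrow> complex) \<Rightarrow> nat \<Rightarrow> complex" where
  "step f i = \<sigma> i * ap d U f i"

lemma n2_step [simp]: "n2 (step f) = n2 f"
  unfolding step_def by (simp add: isom)

text \<open>With \<open>U = 1 - i \<tau> G + r\<close>, the product
  \<sigma>\<open>U\<close>\<sigma>\<open>U\<close> has first-order part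
  \<open>- i \<tau> (G + \<sigma> G \<sigma>)\<close>, which is \<open>- i s A\<close>. Four error
  terms remain: two remainders \<open>r\<close>, the product of the two first-order parts, and a
  first-order part times \<open>r\<close>. Each is at most \<open>\<tau>^2\<close>, the last one
  because \<tau> is at most 1, and \<open>4 * \<tau>^2 = s^2\<close>.\<close>

lemma two_step:
  "n2 (\<lambda>i. step (step f) i - (f i - \<i> * s * A f i)) \<le> s\<^sup>2 * n2 f"
proof -
  define r where "r g i = ap d U g i - (g i - \<i> * \<tau> * ap d G g i)" for g i
  have r: "n2 (r g) \<le> \<tau>\<^sup>2 * n2 g" for g unfolding r_def by (rule taylor)
  have U: "ap d U g i = g i - \<i> * \<tau> * ap d G g i + r g i" for g i by (simp add: r_def)
  define S where "S f = (\<lambda>i. \<sigma> i * f i)" for f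
  have n2S: "n2 (S f) = n2 f" for f by (simp add: S_def)
  have aux: "ap d G (step f) i = ap d G (S f) i - \<i> * \<tau> * ap d G (S (ap d G f)) i
      + ap d G (S (r f)) i" for i
  proof -
    have "step f = (\<lambda>i. S f i - (\<i> * \<tau>) * S (ap d G f) i + S (r f) i)"
      by (rule ext) (simp add: step_def U S_def algebra_simps)
    then show ?thesis by (simp only: ap_add ap_diff ap_scale)
  qed
  have eq: "step (step f) i - (f i - \<i> * s * A f i) =
      (r f i + S (r (step f)) i) + ((- (\<tau>\<^sup>2)) * S (ap d G (S (ap d G f))) i
        + (- \<i> * \<tau>) * S (ap d G (S (r f))) i)" for i
  proof -
    have "step (step f) i = \<sigma> i * (step f i - \<i> * \<tau> * ap d G (step f) i + r (step f) i)"
      by (subst step_def) (simp only: U)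
    also have "\<dots> = \<sigma> i * step f i - \<i> * \<tau> * (\<sigma> i * ap d G (step f) i) + S (r (step f)) i"
      by (simp add: S_def algebra_simps)
    also have "\<sigma> i * step f i = f i - \<i> * \<tau> * ap d G f i + r f i"
      by (simp add: step_def U)
    finally have st: "step (step f) i = f i - \<i> * \<tau> * ap d G f i + r f i
       - \<i> * \<tau> * (\<sigma> i * ap d G (step f) i) + S (r (step f)) i" .
    have Ai: "A f i = (ap d G f i + \<sigma> i * ap d G (S f) i) / 2" by (simp add: A_def S_def)
    have Si: "S g i = \<sigma> i * g i" for g by (simp add: S_def)
    show ?thesis
      unfolding st aux Ai Si s_def by (simp add: field_simps power2_eq_square)
  qed
  have 1: "n2 (\<lambda>i. step (step f) i - (f i - \<i> * s * A f i)) \<le>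
      (n2 (r f) + n2 (r (step f))) + (\<tau>\<^sup>2 * n2 (S (ap d G (S (ap d G f)))) + \<tau> * n2 (S (ap d G (S (r f)))))"
    unfolding eq
    apply (rule order_trans[OF nrm_add])
    apply (intro add_mono)
     apply (rule order_trans[OF nrm_add])
     apply (simp add: n2S)
    apply (rule order_trans[OF nrm_add])
    unfolding nrm_scale using \<tau> apply (simp add: norm_mult norm_power)
    done
  have a: "n2 (S (ap d G (S (ap d G f)))) \<le> n2 f"
    unfolding n2S by (rule order_trans[OF contr]) (simp add: n2S contr)
  have b: "n2 (S (ap d G (S (r f)))) \<le> \<tau>\<^sup>2 * n2 f"
    unfolding n2S by (rule order_trans[OF contr]) (simp add: n2S r)
  note 1
  also have "(n2 (r f) + n2 (r (step f))) + (\<tau>\<^sup>2 * n2 (S (ap d G (S (ap d G f)))) + \<tau> * n2 (S (ap d G (S (r f)))))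
      \<le> (n2 (r f) + n2 (r (step f))) + (\<tau>\<^sup>2 * n2 f + \<tau> * (\<tau>\<^sup>2 * n2 f))"
    using a b \<tau> by (intro add_mono mult_left_mono) auto
  also have "(n2 (r f) + n2 (r (step f))) + (\<tau>\<^sup>2 * n2 f + \<tau> * (\<tau>\<^sup>2 * n2 f))
      \<le> (\<tau>\<^sup>2 * n2 f + \<tau>\<^sup>2 * n2 f) + (\<tau>\<^sup>2 * n2 f + 1 * (\<tau>\<^sup>2 * n2 f))"
    using r[of f] r[of "step f"] \<tau> by (intro add_mono mult_right_mono) auto
  also have "\<dots> = s\<^sup>2 * n2 f" by (simp add: s_def power2_eq_square)
  finally show ?thesis .
qed

section \<open>Euler iterates of the averaged evolution\<close>

text \<open>Euler's method for the evolution under \<open>A\<close>, started at the identity.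
  Comparing with these polynomials instead of an exponential of \<open>A\<close> turns every later
  estimate into an induction on \<open>j\<close>.\<close>

primrec z :: "nat \<Rightarrow> nat \<Rightarrow> complex" where
  "z 0 = e0"
| "z (Suc j) = (\<lambda>i. z j i - \<i> * s * A (z j) i)"

text \<open>Euler steps are not isometric. Up to time 1/2 the bound itself stays below 2, so one
  more step adds at most \<open>2 * s\<close>.\<close>

lemma z_bound: "j * s \<le> 1/2 \<Longrightarrow> n2 (z j) \<le> 1 + 2 * (j * s)"
proof (induction j)
  case 0 then show ?case by (simp add: nrm_e0 d)
next
  case (Suc j)
  have js: "j * s \<le> 1/2" using Suc.prems s_nonneg by (simp add: algebra_simps)
  have "n2 (z (Suc j)) \<le> (1 + 2 * (j * s)) + s * (1 + 2 * (j * s))"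
    unfolding z.simps
    using Suc.IH[OF js] s_nonneg n2_A[of "z j"]
    by (intro nrm_lincomb_le) (auto simp: norm_mult)
  also have "s * (1 + 2 * (j * s)) \<le> s * 2" using js s_nonneg by (intro mult_left_mono) auto
  finally show ?case by (simp add: algebra_simps)
qed

lemma z_bound2: "j * s \<le> 1/2 \<Longrightarrow> n2 (z j) \<le> 2"
  using z_bound[of j] by simp

text \<open>Each pair of steps adds the local error \<open>s^2\<close> of \<open>two_step\<close>
  and amplifies the old error by at most \<open>1 + s\<close>. Up to time 1/2 the amplification
  costs at most another \<open>s^2\<close>, whence the factor 2.\<close>

lemma step_z: "j * s \<le> 1/2 \<Longrightarrow> n2 (\<lambda>i. (step ^^ (2 * j)) e0 i - z j i) \<le> 2 * j * s\<^sup>2"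
proof (induction j)
  case 0 then show ?case by (simp add: nrm_def L2_set_0')
next
  case (Suc j)
  have js: "j * s \<le> 1/2" using Suc.prems s_nonneg by (simp add: algebra_simps)
  define f where "f = (step ^^ (2 * j)) e0"
  have nf: "n2 f = 1"
  proof -
    have "n2 ((step ^^ k) e0) = 1" for k by (induction k) (auto simp: nrm_e0 d)
    then show ?thesis by (simp add: f_def)
  qed
  have Sf: "(step ^^ (2 * Suc j)) e0 = step (step f)" by (simp add: f_def)
  let ?e = "\<lambda>i. f i - z j i"
  have "n2 (\<lambda>i. step (step f) i - z (Suc j) i) =
     n2 (\<lambda>i. (step (step f) i - (f i - \<i> * s * A f i)) + (?e i - (\<i> * s) * A ?e i))"
    by (rule nrm_cong) (simp add: A_diff algebra_simps)
  also have "\<dots> \<le> s\<^sup>2 + (2 * j * s\<^sup>2 + s * (2 * j * s\<^sup>2))"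
    apply (rule order_trans[OF nrm_add])
    apply (rule add_mono)
    using two_step[of f] apply (simp add: nf)
    using Suc.IH[OF js] s_nonneg n2_A[of ?e] unfolding f_def[symmetric]
    by (intro nrm_lincomb_le) (auto simp: norm_mult)
  also have "s * (2 * j * s\<^sup>2) = 2 * (j * s) * s\<^sup>2" by simp
  also have "\<dots> \<le> 1 * s\<^sup>2" using js by (intro mult_right_mono) auto
  finally show ?case unfolding Sf by (simp add: algebra_simps)
qed

text \<open>On a vector supported on the coordinates with sign +1, \<open>A\<close> is
  \<open>G\<close> followed by the projection to these coordinates. The iterates therefore never
  leave their span, and the projected form of \<open>A\<close> is available at every
  \<open>j\<close>.\<close>

lemma z_low: "i < d \<Longrightarrow> \<not> (i = 0 \<or> i \<in> Hi) \<Longrightarrow> z j i = 0"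
  and A_z: "i < d \<Longrightarrow> A (z j) i = (if i = 0 \<or> i \<in> Hi then ap d G (z j) i else 0)"
proof -
  have Az: "A (z j) i = (if i = 0 \<or> i \<in> Hi then ap d G (z j) i else 0)"
    if "\<And>i. i < d \<Longrightarrow> \<not> (i = 0 \<or> i \<in> Hi) \<Longrightarrow> z j i = 0" for i j
  proof -
    have "ap d G (\<lambda>k. \<sigma> k * z j k) i = ap d G (z j) i"
      using that by (intro ap_cong) (auto simp: \<sigma>_def)
    then show ?thesis by (simp add: A_def \<sigma>_def)
  qed
  have low: "i < d \<Longrightarrow> \<not> (i = 0 \<or> i \<in> Hi) \<Longrightarrow> z j i = 0" for i j
  proof (induction j arbitrary: i)
    case 0 then show ?case by (simp add: e0_def)
  next
    case (Suc j)
    have "A (z j) i = 0" using Az[of j i] Suc by simp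
    then show ?case using Suc by simp
  qed
  show "i < d \<Longrightarrow> \<not> (i = 0 \<or> i \<in> Hi) \<Longrightarrow> z j i = 0" by (rule low)
  show "i < d \<Longrightarrow> A (z j) i = (if i = 0 \<or> i \<in> Hi then ap d G (z j) i else 0)"
    by (rule Az) (rule low)
qed

section \<open>First-order estimates in the block of the identity and the high weights\<close>

text \<open>On \<open>Hi\<close> these entries turn out to be the high-weight Pauli coefficients of
  the Hamiltonian (\<open>rot_column\<close>), so that \<eta> is its distance to
  \<open>k\<close>-local.\<close>

definition h :: "nat \<Rightarrow> complex" where "h i = G i 0"
definition \<eta> :: real where "\<eta> = nrm Hi h"
definition B :: "(nat \<Rightarrow> complex) \<Rightarrow> nat \<Rightarrow> complex" where "B f i = (\<Sum>k\<in>Hi. G i k * f k)"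

lemma finHi: "finite Hi" using Hi(1) finite_subset by blast

lemma B_add: "B (\<lambda>i. f i + g i) i = B f i + B g i"
  by (simp add: B_def algebra_simps sum.distrib)
lemma B_scale: "B (\<lambda>i. c * f i) i = c * B f i"
  by (simp add: B_def algebra_simps sum_distrib_left)

text \<open>\<open>B\<close> is a compression of \<open>G\<close>: extend by zero, apply the
  contraction \<open>G\<close>, restrict to \<open>Hi\<close>.\<close>

lemma nrm_B: "nrm Hi (B f) \<le> nrm Hi f"
proof -
  let ?f = "\<lambda>i. if i \<in> Hi then f i else 0"
  have "B f i = ap d G ?f i" for i
    unfolding B_def ap_def using Hi finHi
    by (intro sum.mono_neutral_cong_left) auto
  then have "nrm Hi (B f) \<le> n2 (ap d G ?f)"
    using Hi by (simp add: nrm_subset cong: nrm_cong)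
  also have "\<dots> \<le> n2 ?f" by (rule contr)
  also have "\<dots> = nrm Hi f" using Hi by (intro nrm_restrict) auto
  finally show ?thesis .
qed

lemma eta_nonneg: "0 \<le> \<eta>" by (simp add: \<eta>_def)

lemma ap_G_z: "ap d G (z j) i = h i * z j 0 + B (z j) i"
proof -
  have "ap d G (z j) i = (\<Sum>k\<in>insert 0 Hi. G i k * z j k)"
    unfolding ap_def using d Hi z_low[of _ j] by (intro sum.mono_neutral_right) auto
  then show ?thesis using finHi Hi by (simp add: h_def B_def)
qed

lemma z_Hi: "i \<in> Hi \<Longrightarrow> z (Suc j) i = z j i - \<i> * s * (h i * z j 0 + B (z j) i)"
  using A_z[of i j] Hi by (auto simp: ap_G_z)

lemma z_0: "z (Suc j) 0 = z j 0 - \<i> * s * ap d G (z j) 0"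
  using A_z[of 0 j] d by auto

lemma z_e0: "j * s \<le> 1/2 \<Longrightarrow> n2 (\<lambda>i. z j i - e0 i) \<le> 2 * (j * s)"
proof (induction j)
  case 0 then show ?case by (simp add: nrm_def L2_set_0')
next
  case (Suc j)
  have js: "j * s \<le> 1/2" using Suc.prems s_nonneg by (simp add: algebra_simps)
  have "n2 (\<lambda>i. z (Suc j) i - e0 i) = n2 (\<lambda>i. (z j i - e0 i) - (\<i> * s) * A (z j) i)"
    by (rule nrm_cong) simp
  also have "\<dots> \<le> 2 * (j * s) + s * 2"
    using Suc.IH[OF js] s_nonneg n2_A[of "z j"] z_bound2[OF js]
    by (intro nrm_lincomb_le) (auto simp: norm_mult)
  finally show ?case by (simp add: algebra_simps)
qed

lemma a_first: "j * s \<le> 1/2 \<Longrightarrow> cmod (z j 0 - 1) \<le> 2 * (j * s)"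
  using cmod_le_nrm[of "{..<d}" 0 "\<lambda>i. z j i - e0 i"] d z_e0[of j] by (simp add: e0_def)

lemma a_bound: "j * s \<le> 1/2 \<Longrightarrow> cmod (z j 0) \<le> 2"
  using cmod_le_nrm[of "{..<d}" 0 "z j"] d z_bound2[of j] by simp

text \<open>Replacing \<open>z j\<close> by \<open>e0\<close> in \<open>z_0\<close> yields the
  linear term. The error of this replacement is at most \<open>s * 2 * (j * s)\<close> per step by
  \<open>z_e0\<close>, and these terms sum to less than \<open>(j * s)^2\<close>.\<close>

lemma a_second: "j * s \<le> 1/2 \<Longrightarrow> cmod (z j 0 - 1 + \<i> * (j * s) * G 0 0) \<le> (j * s)\<^sup>2"
proof (induction j)
  case 0 then show ?case by (simp add: e0_def)
next
  case (Suc j)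
  have js: "j * s \<le> 1/2" using Suc.prems s_nonneg by (simp add: algebra_simps)
  have ap: "ap d G (z j) 0 = G 0 0 + ap d G (\<lambda>i. z j i - e0 i) 0"
    by (simp add: ap_diff ap_e0 d)
  have eq: "z (Suc j) 0 - 1 + \<i> * (Suc j * s) * G 0 0 =
     (z j 0 - 1 + \<i> * (j * s) * G 0 0) + (- (\<i> * s) * ap d G (\<lambda>i. z j i - e0 i) 0)"
    unfolding z_0 ap by (simp add: algebra_simps)
  have "cmod (ap d G (\<lambda>i. z j i - e0 i) 0) \<le> n2 (ap d G (\<lambda>i. z j i - e0 i))"
    using d by (intro cmod_le_nrm) auto
  also have "\<dots> \<le> 2 * (j * s)" using contr[of "\<lambda>i. z j i - e0 i"] z_e0[OF js] by linarith
  finally have "cmod (- (\<i> * s) * ap d G (\<lambda>i. z j i - e0 i) 0) \<le> s * (2 * (j * s))"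
    using s_nonneg by (simp add: norm_mult mult_left_mono)
  then have "cmod (z (Suc j) 0 - 1 + \<i> * (Suc j * s) * G 0 0) \<le> (j * s)\<^sup>2 + s * (2 * (j * s))"
    unfolding eq using norm_triangle_mono[OF Suc.IH[OF js]] by blast
  also have "\<dots> \<le> (Suc j * s)\<^sup>2" by (simp add: power2_eq_square algebra_simps)
  finally show ?case .
qed

text \<open>The part in \<open>Hi\<close> starts at zero and is fed only by \<open>h\<close>, while
  \<open>B\<close> merely moves it around inside \<open>Hi\<close>. This is where the factor \<eta>
  arises that makes the later errors relative instead of additive.\<close>

lemma y_bound: "j * s \<le> 1/2 \<Longrightarrow> nrm Hi (z j) \<le> 4 * (j * s) * \<eta>"
proof (induction j)
  case 0
  have "nrm Hi e0 = 0" using Hi unfolding nrm_def by (intro L2_set_0') (auto simp: e0_def intro!: gr0I)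
  then show ?case by simp
next
  case (Suc j)
  have js: "j * s \<le> 1/2" using Suc.prems s_nonneg by (simp add: algebra_simps)
  have "nrm Hi (\<lambda>i. z j 0 * h i + B (z j) i) \<le> 2 * \<eta> + 4 * (j * s) * \<eta>"
    apply (rule order_trans[OF nrm_add])
    unfolding nrm_scale
    using a_bound[OF js] Suc.IH[OF js] nrm_B[of "z j"] eta_nonneg unfolding \<eta>_def
    by (intro add_mono mult_right_mono) auto
  also have "\<dots> \<le> 2 * \<eta> + 4 * (1/2) * \<eta>"
    using js eta_nonneg by (intro add_mono mult_right_mono) auto
  finally have u: "nrm Hi (\<lambda>i. z j 0 * h i + B (z j) i) \<le> 4 * \<eta>" by simp
  have "nrm Hi (z (Suc j)) = nrm Hi (\<lambda>i. z j i - (\<i> * s) * (z j 0 * h i + B (z j) i))"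
    by (rule nrm_cong) (simp only: z_Hi mult.commute)
  also have "\<dots> \<le> 4 * (j * s) * \<eta> + s * (4 * \<eta>)"
    using Suc.IH[OF js] s_nonneg u eta_nonneg
    by (intro nrm_lincomb_le) (auto simp: norm_mult)
  finally show ?case by (simp add: algebra_simps)
qed

text \<open>In \<open>z_Hi\<close>, replacing \<open>z j 0\<close> by 1 costs
  \<open>2 * (j * s) * \<eta>\<close> and dropping \<open>B\<close> costs
  \<open>4 * (j * s) * \<eta>\<close>. The factor 3 comes from summing \<open>6 * j\<close>.\<close>

lemma y_second: "j * s \<le> 1/2 \<Longrightarrow> nrm Hi (\<lambda>i. z j i + \<i> * (j * s) * h i) \<le> 3 * (j * s)\<^sup>2 * \<eta>"
proof (induction j)
  case 0
  have "nrm Hi e0 = 0" using Hi unfolding nrm_def by (intro L2_set_0') (auto simp: e0_def intro!: gr0I)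
  then show ?case by simp
next
  case (Suc j)
  have js: "j * s \<le> 1/2" using Suc.prems s_nonneg by (simp add: algebra_simps)
  have u: "nrm Hi (\<lambda>i. (z j 0 - 1) * h i + B (z j) i) \<le> 2 * (j * s) * \<eta> + 4 * (j * s) * \<eta>"
    apply (rule order_trans[OF nrm_add])
    unfolding nrm_scale
    using a_first[OF js] y_bound[OF js] nrm_B[of "z j"] eta_nonneg unfolding \<eta>_def
    by (intro add_mono mult_right_mono) auto
  have "nrm Hi (\<lambda>i. z (Suc j) i + \<i> * (Suc j * s) * h i) =
     nrm Hi (\<lambda>i. (z j i + \<i> * (j * s) * h i) - (\<i> * s) * ((z j 0 - 1) * h i + B (z j) i))"
    by (rule nrm_cong) (simp only: z_Hi, simp add: algebra_simps)
  also have "\<dots> \<le> 3 * (j * s)\<^sup>2 * \<eta> + s * (2 * (j * s) * \<eta> + 4 * (j * s) * \<eta>)"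
    using Suc.IH[OF js] s_nonneg u eta_nonneg
    by (intro nrm_lincomb_le) (auto simp: norm_mult)
  also have "\<dots> = (3 * (j * s)\<^sup>2 + 6 * (j * s) * s) * \<eta>" by (simp add: algebra_simps)
  also have "\<dots> \<le> 3 * (Suc j * s)\<^sup>2 * \<eta>"
    using eta_nonneg by (intro mult_right_mono) (auto simp: power2_eq_square algebra_simps)
  finally show ?case .
qed

section \<open>Second-order expansion of the high-weight amplitude\<close>

text \<open>The \<open>Hi\<close> part of the square of the decoupled Hamiltonian applied to
  \<open>e0\<close>.\<close>

definition w :: "nat \<Rightarrow> complex" where "w i = G 0 0 * h i + B h i"

text \<open>The binomial expansion of \<open>(1 - i s A)^j\<close> applied to \<open>e0\<close>,
  restricted to \<open>Hi\<close> and cut after second order. The coefficient is \<open>j\<close>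
  choose 2 and not \<open>j^2 / 2\<close>, so it fits the Euler iterates exactly to this
  order.\<close>

definition T :: "nat \<Rightarrow> nat \<Rightarrow> complex" where
  "T j i = - \<i> * (j * s) * h i - (s\<^sup>2 * (j * (real j - 1) / 2)) * w i"

text \<open>This is the recurrence \<open>z_Hi\<close> with the first-order approximations inserted
  for \<open>z j 0\<close> and for the argument of \<open>B\<close>. Subtracting it from
  \<open>z_Hi\<close> leaves only the errors of \<open>a_second\<close> and
  \<open>y_second\<close>.\<close>

lemma T_Suc:
  "T (Suc j) i = T j i - \<i> * s * ((1 - \<i> * (j * s) * G 0 0) * h i - \<i> * (j * s) * B h i)"
proof -
  have c: "complex_of_real (s\<^sup>2 * (Suc j * (real (Suc j) - 1) / 2)) =
      complex_of_real (s\<^sup>2 * (j * (real j - 1) / 2)) + of_real s * (j * of_real s)"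
    by (simp add: field_simps power2_eq_square)
  show ?thesis unfolding T_def c w_def
    by (simp add: algebra_simps)
qed

text \<open>The new error per step is \<open>s\<close> times \<open>(j * s)^2 * \<eta>\<close> from
  \<open>a_second\<close> plus \<open>3 * (j * s)^2 * \<eta>\<close> from \<open>y_second\<close>;
  summing \<open>4 * j^2\<close> gives less than \<open>4 * j^3\<close>.\<close>

lemma y_third: "j * s \<le> 1/2 \<Longrightarrow> nrm Hi (\<lambda>i. z j i - T j i) \<le> 4 * (j * s) ^ 3 * \<eta>"
proof (induction j)
  case 0
  have "nrm Hi (\<lambda>i. e0 i - T 0 i) = 0" using Hi unfolding nrm_def
    by (intro L2_set_0') (auto simp: e0_def T_def intro!: gr0I)
  then show ?case by simp
next
  case (Suc j)
  have js: "j * s \<le> 1/2" using Suc.prems s_nonneg by (simp add: algebra_simps)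
  let ?f = "\<lambda>i. z j i + \<i> * (j * s) * h i"
  let ?c = "z j 0 - 1 + \<i> * (j * s) * G 0 0"
  have u: "nrm Hi (\<lambda>i. ?c * h i + B ?f i) \<le> (j * s)\<^sup>2 * \<eta> + 3 * (j * s)\<^sup>2 * \<eta>"
    apply (rule order_trans[OF nrm_add])
    unfolding nrm_scale
    using a_second[OF js] y_second[OF js] nrm_B[of ?f] eta_nonneg unfolding \<eta>_def
    by (intro add_mono mult_right_mono) auto
  have "nrm Hi (\<lambda>i. z (Suc j) i - T (Suc j) i) =
     nrm Hi (\<lambda>i. (z j i - T j i) - (\<i> * s) * (?c * h i + B ?f i))"
    apply (rule nrm_cong)
    apply (simp only: z_Hi B_add B_scale T_Suc)
    apply (simp add: algebra_simps)
    done
  also have "\<dots> \<le> 4 * (j * s) ^ 3 * \<eta> + s * ((j * s)\<^sup>2 * \<eta> + 3 * (j * s)\<^sup>2 * \<eta>)"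
    using Suc.IH[OF js] s_nonneg u eta_nonneg
    by (intro nrm_lincomb_le) (auto simp: norm_mult)
  also have "\<dots> = (4 * (j * s) ^ 3 + 4 * (j * s)\<^sup>2 * s) * \<eta>" by (simp add: algebra_simps)
  also have "\<dots> \<le> 4 * (Suc j * s) ^ 3 * \<eta>"
    using eta_nonneg s_nonneg
    by (intro mult_right_mono) (auto simp: power2_eq_square power3_eq_cube algebra_simps)
  finally show ?case .
qed

lemma nrm_w: "nrm Hi w \<le> 2 * \<eta>"
proof -
  have "cmod (ap d G e0 0) \<le> n2 (ap d G e0)" using d by (intro cmod_le_nrm) auto
  then have "cmod (G 0 0) \<le> 1" using contr[of e0] nrm_e0[OF d] by (simp add: ap_e0 d)
  then have "cmod (G 0 0) * nrm Hi h \<le> 1 * \<eta>" unfolding \<eta>_def by (intro mult_right_mono) auto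
  then show ?thesis
    using nrm_add[of Hi "\<lambda>i. G 0 0 * h i" "B h"] nrm_B[of h]
    unfolding w_def nrm_scale \<eta>_def by simp
qed

text \<open>Hermiticity of \<open>G\<close> makes the second-order term of \<open>T\<close> real-orthogonal to the first-order one.\<close>

lemma cross_real: "Im (\<Sum>i\<in>Hi. cnj (h i) * w i) = 0"
proof -
  let ?S = "\<Sum>i\<in>Hi. cnj (h i) * w i"
  have S: "?S = (\<Sum>i\<in>Hi. G 0 0 * (cnj (h i) * h i)) + (\<Sum>i\<in>Hi. \<Sum>k\<in>Hi. cnj (h i) * G i k * h k)"
    by (simp add: w_def B_def sum.distrib algebra_simps sum_distrib_left)
  have G0: "cnj (G 0 0) = G 0 0" using herm[of 0 0] d by simp
  have "cnj (\<Sum>i\<in>Hi. \<Sum>k\<in>Hi. cnj (h i) * G i k * h k) = (\<Sum>i\<in>Hi. \<Sum>k\<in>Hi. h i * G k i * cnj (h k))"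
    unfolding cnj_sum
  proof (intro sum.cong refl)
    fix i k assume "i \<in> Hi" "k \<in> Hi"
    then have "G k i = cnj (G i k)" using Hi by (intro herm) auto
    then show "cnj (cnj (h i) * G i k * h k) = h i * G k i * cnj (h k)" by simp
  qed
  also have "\<dots> = (\<Sum>k\<in>Hi. \<Sum>i\<in>Hi. h i * G k i * cnj (h k))" by (rule sum.swap)
  finally have "cnj ?S = ?S" unfolding S
    by (simp add: G0 algebra_simps)
  then show ?thesis by (metis Reals_cnj_iff complex_is_Real_iff)
qed

text \<open>By \<open>cross_real\<close> the squared norm is a sum of squares,
  \<open>(t * \<eta>)^2\<close> plus the second-order contribution. The latter is at most
  \<open>(t * \<eta>) * (t^3 * \<eta>)\<close>, so it moves the norm by order
  \<open>t^3 * \<eta>\<close> and not by order \<open>t^2 * \<eta>\<close>.\<close>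

lemma nrm_T:
  assumes "j * s \<le> 1/2"
  shows "j * s * \<eta> \<le> nrm Hi (T j)" "nrm Hi (T j) \<le> j * s * \<eta> + (j * s) ^ 3 * \<eta>"
proof -
  define t where "t = j * s"
  define c where "c = s\<^sup>2 * (j * (real j - 1) / 2)"
  have t: "0 \<le> t" using s_nonneg by (simp add: t_def)
  \<comment> \<open>The case split is needed because \<open>real j - 1\<close> is negative at
    \<open>j = 0\<close>, where the whole product vanishes.\<close>
  have c: "0 \<le> c" by (cases j) (auto simp: c_def)
  have ct: "c \<le> t\<^sup>2 / 2" unfolding c_def t_def
    by (cases j) (auto simp: power2_eq_square algebra_simps)
  have pt: "(cmod (T j i))\<^sup>2 = t\<^sup>2 * (cmod (h i))\<^sup>2 + c\<^sup>2 * (cmod (w i))\<^sup>2 + 2 * c * t * Im (cnj (h i) * w i)" for i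
  proof -
    have Ti: "T j i = - \<i> * t * h i - c * w i" by (simp add: T_def t_def c_def)
    show ?thesis unfolding Ti cmod_power2
      by (simp add: power2_eq_square algebra_simps)
  qed
  have "(nrm Hi (T j))\<^sup>2 = t\<^sup>2 * \<eta>\<^sup>2 + c\<^sup>2 * (nrm Hi w)\<^sup>2 + 2 * c * t * Im (\<Sum>i\<in>Hi. cnj (h i) * w i)"
    unfolding nrm_power2 \<eta>_def pt by (simp add: sum.distrib sum_subtractf sum_distrib_left algebra_simps)
  then have eq: "(nrm Hi (T j))\<^sup>2 = (t * \<eta>)\<^sup>2 + c\<^sup>2 * (nrm Hi w)\<^sup>2"
    by (simp only: cross_real power_mult_distrib)
  show "j * s * \<eta> \<le> nrm Hi (T j)"
    unfolding t_def[symmetric] by (rule power2_le_imp_le) (auto simp: eq)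
  have "c\<^sup>2 * (nrm Hi w)\<^sup>2 \<le> (t\<^sup>2 / 2)\<^sup>2 * (2 * \<eta>)\<^sup>2"
    using c ct nrm_w by (intro mult_mono power_mono) auto
  also have "\<dots> = (t * \<eta>) * (t ^ 3 * \<eta>)" by (simp add: power2_eq_square power3_eq_cube)
  also have "(t * \<eta>)\<^sup>2 + \<dots> \<le> (t * \<eta> + t ^ 3 * \<eta>)\<^sup>2"
    using t eta_nonneg by (simp add: power2_eq_square algebra_simps)
  finally have "(nrm Hi (T j))\<^sup>2 \<le> (t * \<eta> + t ^ 3 * \<eta>)\<^sup>2" by (simp add: eq)
  then show "nrm Hi (T j) \<le> j * s * \<eta> + (j * s) ^ 3 * \<eta>"
    unfolding t_def[symmetric] using t eta_nonneg by (rule_tac power2_le_imp_le) auto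
qed

text \<open>The term \<open>2 * t * s\<close> is the decoupling error of \<open>step_z\<close>. The
  five \<open>t^3 * \<eta>\<close> are four from \<open>y_third\<close> and one from
  \<open>nrm_T\<close>.\<close>

theorem amplitude:
  fixes j :: nat
  assumes "t = j * s" "t \<le> 1/2"
  shows "\<bar>nrm Hi ((step ^^ (2 * j)) e0) - t * \<eta>\<bar> \<le> 5 * t ^ 3 * \<eta> + 2 * t * s"
proof -
  let ?p = "(step ^^ (2 * j)) e0"
  have js: "j * s \<le> 1/2" using assms by simp
  have "nrm Hi (\<lambda>i. ?p i - z j i) \<le> n2 (\<lambda>i. ?p i - z j i)"
    using Hi by (intro nrm_subset) auto
  with step_z[OF js] have 1: "nrm Hi (\<lambda>i. ?p i - z j i) \<le> 2 * t * s"
    by (simp add: assms power2_eq_square algebra_simps)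
  have tri: "nrm Hi f \<le> nrm Hi (\<lambda>i. f i - g i) + nrm Hi g" for f g
    using nrm_add[of Hi "\<lambda>i. f i - g i" g] by simp
  have tri': "nrm Hi g \<le> nrm Hi (\<lambda>i. f i - g i) + nrm Hi f" for f g
    using nrm_diff[of Hi f "\<lambda>i. f i - g i"] by simp
  show ?thesis
    using 1 y_third[OF js] nrm_T[OF js] tri[of ?p "z j"] tri'[of "z j" ?p]
      tri[of "z j" "T j"] tri'[of "T j" "z j"]
    unfolding assms(1)[symmetric] by linarith
qed

end

section \<open>Unitaries and Kronecker products\<close>

text \<open>The index convention behind every Kronecker product here: quotient for the left factor,
  remainder for the right one.\<close>

lemma sum_div_mod:
  fixes f :: "nat \<Rightarrow> nat \<Rightarrow> 'a::comm_monoid_add"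
  shows "(\<Sum>i<p*q. f (i div q) (i mod q)) = (\<Sum>x<p. \<Sum>y<q. f x y)"
proof -
  have "(\<Sum>x<p. \<Sum>y<q. f x y) = (\<Sum>(x,y)\<in>{..<p} \<times> {..<q}. f x y)"
    by (rule sum.cartesian_product)
  also have "\<dots> = (\<Sum>i<p*q. f (i div q) (i mod q))"
  proof (rule sum.reindex_bij_witness[where i = "\<lambda>i. (i div q, i mod q)" and j = "\<lambda>(x,y). x * q + y"])
    fix a assume "a \<in> {..<p} \<times> {..<q}"
    then obtain x y where a: "a = (x, y)" "x < p" "y < q" by auto
    have "x * q + y < Suc x * q" using a by simp
    also have "\<dots> \<le> p * q" using a by (intro mult_le_mono1) auto
    finally show "(case a of (x, y) \<Rightarrow> x * q + y) \<in> {..<p * q}" by (simp add: a)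
  next
    fix b assume b: "b \<in> {..<p * q}"
    then have "0 < q" by (cases q) auto
    then show "(b div q, b mod q) \<in> {..<p} \<times> {..<q}"
      using b by (auto simp: less_mult_imp_div_less)
  qed auto
  finally show ?thesis ..
qed

lemma div_mod_less:
  fixes p q i :: nat
  assumes "i < p * q"
  shows "i div q < p" "i mod q < q"
  using assms less_mult_imp_div_less[of i p q] by (cases q; auto)+

lemma mult_entry:
  "i < dim_row A \<Longrightarrow> j < dim_col B \<Longrightarrow> dim_col A = dim_row B \<Longrightarrow>
    (A * B) $$ (i,j) = (\<Sum>k<dim_row B. A $$ (i,k) * B $$ (k,j))"
  by (simp add: scalar_prod_def atLeast0LessThan)

lemma mult_vec_entry:
  "i < dim_row A \<Longrightarrow> dim_col A = dim_vec v \<Longrightarrow>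
    (A *\<^sub>v v) $ i = (\<Sum>k<dim_vec v. A $$ (i,k) * v $ k)"
  by (simp add: scalar_prod_def atLeast0LessThan)

lemma adj_dim [simp]: "dim_row (adj A) = dim_col A" "dim_col (adj A) = dim_row A"
  by (simp_all add: adj_def)

lemma adj_carrier [simp]: "A \<in> carrier_mat p q \<Longrightarrow> adj A \<in> carrier_mat q p"
  by auto

lemma adj_index [simp]: "i < dim_col A \<Longrightarrow> j < dim_row A \<Longrightarrow> adj A $$ (i,j) = cnj (A $$ (j,i))"
  by (simp add: adj_def)

lemma adj_adj [simp]: "adj (adj A) = A"
  by (rule eq_matI) auto

lemma adj_mult: "A \<in> carrier_mat p q \<Longrightarrow> B \<in> carrier_mat q r \<Longrightarrow> adj (A * B) = adj B * adj A"
  by (rule eq_matI) (auto simp: mult_entry mult.commute simp del: index_mult_mat(1))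

lemma adj_one [simp]: "adj (1\<^sub>m p) = 1\<^sub>m p"
  by (rule eq_matI) auto

lemma is_unitary_carrier: "is_unitary d U \<Longrightarrow> U \<in> carrier_mat d d"
  by (simp add: is_unitary_def)

lemma is_unitary_one [simp]: "is_unitary d (1\<^sub>m d)"
  by (simp add: is_unitary_def)

lemma is_unitary_mult:
  assumes "is_unitary d U" "is_unitary d V"
  shows "is_unitary d (U * V)"
proof -
  have U: "U \<in> carrier_mat d d" "adj U * U = 1\<^sub>m d" and V: "V \<in> carrier_mat d d" "adj V * V = 1\<^sub>m d"
    using assms by (auto simp: is_unitary_def)
  have "adj (U * V) * (U * V) = adj V * (adj U * (U * V))"
    using U V by (simp add: adj_mult[OF U(1) V(1)] assoc_mult_mat[of "adj V" d d "adj U" d "U * V" d])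
  also have "adj U * (U * V) = (adj U * U) * V"
    using U(1) V(1) by (intro assoc_mult_mat[symmetric]) auto
  finally show ?thesis using U V by (simp add: is_unitary_def)
qed

lemma is_unitary_right:
  assumes "is_unitary d U"
  shows "U * adj U = 1\<^sub>m d"
  using assms unfolding is_unitary_def by (metis adj_carrier mat_mult_left_right_inverse)

lemma is_unitary_adj: "is_unitary d U \<Longrightarrow> is_unitary d (adj U)"
  using is_unitary_right[of d U] by (simp add: is_unitary_def)

lemma vnorm_nrm: "vnorm v = nrm {..<dim_vec v} (\<lambda>i. v $ i)"
  by (simp add: vnorm_def nrm_def L2_set_def)

lemma vnorm_unitary:
  assumes U: "is_unitary d U" and v: "v \<in> carrier_vec d"
  shows "vnorm (U *\<^sub>v v) = vnorm v"
proof -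
  have Uc: "U \<in> carrier_mat d d" and UU: "adj U * U = 1\<^sub>m d" using U by (auto simp: is_unitary_def)
  have ent: "(\<Sum>i<d. cnj (U $$ (i,j)) * U $$ (i,k)) = (if j = k then 1 else 0)" if "j < d" "k < d" for j k
  proof -
    have "(adj U * U) $$ (j,k) = (\<Sum>i<d. cnj (U $$ (i,j)) * U $$ (i,k))"
      using that Uc by (simp add: mult_entry del: index_mult_mat(1))
    then show ?thesis using that by (simp add: UU)
  qed
  have "complex_of_real ((vnorm (U *\<^sub>v v))\<^sup>2) = (\<Sum>i<d. cnj ((U *\<^sub>v v) $ i) * (U *\<^sub>v v) $ i)"
    using Uc by (simp add: vnorm_nrm nrm_power2 complex_norm_square mult.commute del: of_real_power)
  also have "\<dots> = (\<Sum>i<d. \<Sum>j<d. \<Sum>k<d. (cnj (v $ j) * v $ k) * (cnj (U $$ (i,j)) * U $$ (i,k)))"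
    using Uc v by (intro sum.cong refl)
      (simp add: mult_vec_entry sum_distrib_left sum_distrib_right algebra_simps del: index_mult_mat_vec)
  also have "\<dots> = (\<Sum>j<d. \<Sum>k<d. \<Sum>i<d. (cnj (v $ j) * v $ k) * (cnj (U $$ (i,j)) * U $$ (i,k)))"
    by (subst sum.swap, rule sum.cong[OF refl], subst sum.swap, rule refl)
  also have "\<dots> = (\<Sum>j<d. \<Sum>k<d. (cnj (v $ j) * v $ k) * (if j = k then 1 else 0))"
    by (intro sum.cong refl) (simp add: ent flip: sum_distrib_left)
  also have "\<dots> = (\<Sum>j<d. cnj (v $ j) * v $ j)"
    by (simp add: if_distrib cong: if_cong)
  also have "\<dots> = complex_of_real ((vnorm v)\<^sup>2)"
    using v by (simp add: vnorm_nrm nrm_power2 complex_norm_square mult.commute del: of_real_power)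
  finally have "(vnorm (U *\<^sub>v v))\<^sup>2 = (vnorm v)\<^sup>2" using of_real_eq_iff by blast
  then show ?thesis by (rule power2_eq_imp_eq) (auto simp: vnorm_nrm)
qed

lemma kron_dim [simp]:
  "dim_row (kron A B) = dim_row A * dim_row B" "dim_col (kron A B) = dim_col A * dim_col B"
  by (simp_all add: kron_def)

lemma kron_carrier [simp]:
  "A \<in> carrier_mat p q \<Longrightarrow> B \<in> carrier_mat r s \<Longrightarrow> kron A B \<in> carrier_mat (p * r) (q * s)"
  by (intro carrier_matI) auto

lemma kron_index [simp]:
  "i < dim_row A * dim_row B \<Longrightarrow> j < dim_col A * dim_col B \<Longrightarrow>
   kron A B $$ (i,j) = A $$ (i div dim_row B, j div dim_col B) * B $$ (i mod dim_row B, j mod dim_col B)"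
  by (simp add: kron_def)

lemma kron_mult:
  assumes "A \<in> carrier_mat p q" "C \<in> carrier_mat q r" "B \<in> carrier_mat p' q'" "D \<in> carrier_mat q' r'"
  shows "kron A B * kron C D = kron (A * C) (B * D)"
proof (rule eq_matI)
  show "dim_row (kron A B * kron C D) = dim_row (kron (A * C) (B * D))"
    "dim_col (kron A B * kron C D) = dim_col (kron (A * C) (B * D))" using assms by auto
  fix i j assume "i < dim_row (kron (A * C) (B * D))" "j < dim_col (kron (A * C) (B * D))"
  then have i: "i < p * p'" and j: "j < r * r'" using assms by auto
  note i' = div_mod_less[OF i] and j' = div_mod_less[OF j]
  have "(kron A B * kron C D) $$ (i,j) = (\<Sum>k<q*q'. kron A B $$ (i,k) * kron C D $$ (k,j))"
    using assms i j by (subst mult_entry) auto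
  also have "\<dots> = (\<Sum>k<q*q'. (A $$ (i div p', k div q') * C $$ (k div q', j div r')) *
      (B $$ (i mod p', k mod q') * D $$ (k mod q', j mod r')))"
    using assms i j by (intro sum.cong refl) auto
  also have "\<dots> = (\<Sum>x<q. \<Sum>y<q'. (A $$ (i div p', x) * C $$ (x, j div r')) *
      (B $$ (i mod p', y) * D $$ (y, j mod r')))"
    by (rule sum_div_mod[of "\<lambda>x y. (A $$ (i div p', x) * C $$ (x, j div r')) *
      (B $$ (i mod p', y) * D $$ (y, j mod r'))"])
  also have "\<dots> = kron (A * C) (B * D) $$ (i,j)"
    using assms i j i' j' by (simp add: mult_entry sum_product del: index_mult_mat(1))
  finally show "(kron A B * kron C D) $$ (i,j) = kron (A * C) (B * D) $$ (i,j)" .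
qed

lemma kron_adj: "adj (kron A B) = kron (adj A) (adj B)"
proof (rule eq_matI)
  fix i j assume "i < dim_row (kron (adj A) (adj B))" "j < dim_col (kron (adj A) (adj B))"
  then have i: "i < dim_col A * dim_col B" and j: "j < dim_row A * dim_row B" by auto
  then show "adj (kron A B) $$ (i, j) = kron (adj A) (adj B) $$ (i, j)"
    using div_mod_less[OF i] div_mod_less[OF j] by simp
qed auto

lemma div_mod_eq_iff: "i div q = j div q \<and> i mod q = j mod q \<longleftrightarrow> i = (j::nat)"
  by (metis div_mult_mod_eq)

lemma kron_one [simp]: "kron (1\<^sub>m p) (1\<^sub>m q) = 1\<^sub>m (p * q)"
proof (rule eq_matI)
  fix i j assume "i < dim_row (1\<^sub>m (p * q) :: complex mat)" "j < dim_col (1\<^sub>m (p * q) :: complex mat)"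
  then have i: "i < p * q" and j: "j < p * q" by auto
  then show "kron (1\<^sub>m p) (1\<^sub>m q) $$ (i, j) = 1\<^sub>m (p * q) $$ (i, j)"
    using div_mod_less[OF i] div_mod_less[OF j] div_mod_eq_iff[of i q j] by auto
qed auto

lemma is_unitary_kron:
  assumes "is_unitary p U" "is_unitary q V"
  shows "is_unitary (p * q) (kron U V)"
  using assms unfolding is_unitary_def
  by (auto simp: kron_adj kron_mult[of "adj U" p p U p "adj V" q q V q])

text \<open>Needed when further ancillas are attached: a query on the larger register is the old
  query tensored with the identity.\<close>

lemma kron_kron_one:
  "kron U (1\<^sub>m (p * q)) = kron (kron U (1\<^sub>m p)) (1\<^sub>m q)"
proof (rule eq_matI)
  fix i j assume "i < dim_row (kron (kron U (1\<^sub>m p)) (1\<^sub>m q))" "j < dim_col (kron (kron U (1\<^sub>m p)) (1\<^sub>m q))"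
  then have i: "i < dim_row U * p * q" "i < dim_row U * (p * q)"
    and j: "j < dim_col U * p * q" "j < dim_col U * (p * q)" by (auto simp: mult.assoc)
  note ii = div_mod_less[OF i(1)] div_mod_less[OF i(2)] div_mod_less[OF div_mod_less(1)[OF i(1)]]
  note jj = div_mod_less[OF j(1)] div_mod_less[OF j(2)] div_mod_less[OF div_mod_less(1)[OF j(1)]]
  have m: "k mod (p * q) = (k div q mod p) * q + k mod q" for k
    by (metis mod_mult2_eq mult.commute)
  have d: "k div (p * q) = k div q div p" for k
    by (metis div_mult2_eq mult.commute)
  have q: "0 < q" using i by (cases q) auto
  have e: "i mod (p * q) = j mod (p * q) \<longleftrightarrow> i div q mod p = j div q mod p \<and> i mod q = j mod q"
  proof
    assume "i mod (p * q) = j mod (p * q)"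
    then have eq: "(i div q mod p) * q + i mod q = (j div q mod p) * q + j mod q" by (simp add: m)
    have "i mod q = j mod q" using arg_cong[OF eq, of "\<lambda>x. x mod q"] by simp
    then show "i div q mod p = j div q mod p \<and> i mod q = j mod q" using eq q by simp
  qed (simp add: m)
  show "kron U (1\<^sub>m (p * q)) $$ (i, j) = kron (kron U (1\<^sub>m p)) (1\<^sub>m q) $$ (i, j)"
    using i j ii jj by (simp add: e d)
qed auto

section \<open>Tensor products of vectors and the exchange of two registers\<close>

definition kronv :: "complex vec \<Rightarrow> complex vec \<Rightarrow> complex vec" where
  "kronv v w = vec (dim_vec v * dim_vec w) (\<lambda>i. v $ (i div dim_vec w) * w $ (i mod dim_vec w))"

lemma kronv_dim [simp]: "dim_vec (kronv v w) = dim_vec v * dim_vec w"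
  by (simp add: kronv_def)

lemma kronv_carrier [simp]:
  "v \<in> carrier_vec p \<Longrightarrow> w \<in> carrier_vec q \<Longrightarrow> kronv v w \<in> carrier_vec (p * q)"
  by (intro carrier_vecI) auto

lemma kronv_index [simp]:
  "i < dim_vec v * dim_vec w \<Longrightarrow> kronv v w $ i = v $ (i div dim_vec w) * w $ (i mod dim_vec w)"
  by (simp add: kronv_def)

lemma kron_mult_kronv:
  assumes "A \<in> carrier_mat p q" "v \<in> carrier_vec q" "B \<in> carrier_mat p' q'" "w \<in> carrier_vec q'"
  shows "kron A B *\<^sub>v kronv v w = kronv (A *\<^sub>v v) (B *\<^sub>v w)"
proof (rule eq_vecI)
  show "dim_vec (kron A B *\<^sub>v kronv v w) = dim_vec (kronv (A *\<^sub>v v) (B *\<^sub>v w))" using assms by auto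
  fix i assume "i < dim_vec (kronv (A *\<^sub>v v) (B *\<^sub>v w))"
  then have i: "i < p * p'" using assms by auto
  note i' = div_mod_less[OF i]
  have "(kron A B *\<^sub>v kronv v w) $ i = (\<Sum>k<q*q'. kron A B $$ (i,k) * kronv v w $ k)"
    using assms i by (subst mult_vec_entry) auto
  also have "\<dots> = (\<Sum>k<q*q'. (A $$ (i div p', k div q') * v $ (k div q')) *
      (B $$ (i mod p', k mod q') * w $ (k mod q')))"
    using assms i by (intro sum.cong refl) auto
  also have "\<dots> = (\<Sum>x<q. \<Sum>y<q'. (A $$ (i div p', x) * v $ x) * (B $$ (i mod p', y) * w $ y))"
    by (rule sum_div_mod[of "\<lambda>x y. (A $$ (i div p', x) * v $ x) * (B $$ (i mod p', y) * w $ y)"])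
  also have "\<dots> = kronv (A *\<^sub>v v) (B *\<^sub>v w) $ i"
    using assms i i' by (simp add: mult_vec_entry sum_product del: index_mult_mat_vec)
  finally show "(kron A B *\<^sub>v kronv v w) $ i = kronv (A *\<^sub>v v) (B *\<^sub>v w) $ i" .
qed

lemma kronv_unit: "0 < p \<Longrightarrow> 0 < q \<Longrightarrow> kronv (unit_vec p 0) (unit_vec q 0) = unit_vec (p * q) 0"
proof (rule eq_vecI)
  fix i assume "i < dim_vec (unit_vec (p * q) 0 :: complex vec)"
  then have i: "i < p * q" by simp
  have "i = 0 \<longleftrightarrow> i div q = 0 \<and> i mod q = 0" using div_mod_eq_iff[of i q 0] by simp
  then show "kronv (unit_vec p 0) (unit_vec q 0) $ i = unit_vec (p * q) 0 $ i"
    using i div_mod_less[OF i] by (auto simp: unit_vec_def)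
qed auto

text \<open>The permutation that exchanges two tensor factors of dimensions \<open>p\<close> and
  \<open>q\<close>. The row index is read in the exchanged order, with \<open>i div p\<close> in the
  factor of dimension \<open>q\<close>; the column index is the same pair in the original
  order.\<close>

definition swap_mat :: "nat \<Rightarrow> nat \<Rightarrow> complex mat" where
  "swap_mat p q = mat (p * q) (p * q) (\<lambda>(i,j). if j = (i mod p) * q + i div p then 1 else 0)"

lemma swap_index_less: "i < p * q \<Longrightarrow> (i mod p) * q + i div p < p * (q::nat)"
proof -
  assume "i < p * q"
  then have i: "i < q * p" by (simp add: mult.commute)
  have "(i mod p) * q + i div p < Suc (i mod p) * q" using div_mod_less[OF i] by simp
  also have "\<dots> \<le> p * q" using div_mod_less[OF i] by (intro mult_le_mono1) auto
  finally show ?thesis .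
qed

lemma swap_mat_carrier [simp]: "swap_mat p q \<in> carrier_mat (p * q) (p * q)"
  by (simp add: swap_mat_def)

lemma swap_mat_unitary: "is_unitary (p * q) (swap_mat p q)"
proof -
  let ?g = "\<lambda>i. (i mod p) * q + i div p"
  have row: "(\<Sum>k<p*q. swap_mat p q $$ (i,k) * cnj (swap_mat p q $$ (j,k))) = (if i = j then 1 else 0)"
    if ij: "i < p * q" "j < p * q" for i j
  proof -
    have inj: "?g i = ?g j \<longleftrightarrow> i = j"
    proof
      assume g: "?g i = ?g j"
      have ij': "i < q * p" "j < q * p" using ij by (auto simp: mult.commute)
      have "?g k div q = k mod p \<and> ?g k mod q = k div p" if "k < q * p" for k
        using div_mod_less[OF that] by simp
      then have "i mod p = j mod p" "i div p = j div p" using g ij' by metis+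
      then show "i = j" using div_mod_eq_iff by blast
    qed simp
    have "(\<Sum>k<p*q. swap_mat p q $$ (i,k) * cnj (swap_mat p q $$ (j,k))) =
      (\<Sum>k<p*q. if k = ?g i then (if ?g i = ?g j then 1 else 0) else 0)"
      using ij by (intro sum.cong refl) (auto simp: swap_mat_def)
    also have "\<dots> = (if i = j then 1 else 0)" using swap_index_less[OF ij(1)] by (simp add: inj)
    finally show ?thesis .
  qed
  \<comment> \<open>Orthonormality is checked on rows, where it is injectivity of the index map.
    This makes the adjoint unitary, and taking adjoints again gives the claim.\<close>
  have "swap_mat p q * adj (swap_mat p q) = 1\<^sub>m (p * q)"
  proof (rule eq_matI)
    fix i j assume "i < dim_row (1\<^sub>m (p * q) :: complex mat)" "j < dim_col (1\<^sub>m (p * q) :: complex mat)"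
    then show "(swap_mat p q * adj (swap_mat p q)) $$ (i, j) = 1\<^sub>m (p * q) $$ (i, j)"
      using row[of i j] carrier_matD[OF swap_mat_carrier[of p q]]
      by (simp add: mult_entry del: index_mult_mat(1))
  qed (use carrier_matD[OF swap_mat_carrier[of p q]] in auto)
  then have "is_unitary (p * q) (adj (swap_mat p q))" by (simp add: is_unitary_def)
  then show ?thesis using is_unitary_adj by fastforce
qed

lemma swap_mat_kronv:
  assumes "v \<in> carrier_vec p" "w \<in> carrier_vec q"
  shows "swap_mat p q *\<^sub>v kronv v w = kronv w v"
proof (rule eq_vecI)
  show "dim_vec (swap_mat p q *\<^sub>v kronv v w) = dim_vec (kronv w v)"
    using assms carrier_matD[OF swap_mat_carrier[of p q]] by simp
  fix i assume "i < dim_vec (kronv w v)"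
  then have i: "i < p * q" "i < q * p" using assms by (auto simp: mult.commute)
  let ?g = "(i mod p) * q + i div p"
  have "(swap_mat p q *\<^sub>v kronv v w) $ i = (\<Sum>k<p*q. swap_mat p q $$ (i,k) * kronv v w $ k)"
    using i assms carrier_matD[OF swap_mat_carrier[of p q]] by (subst mult_vec_entry) auto
  also have "\<dots> = (\<Sum>k<p*q. if k = ?g then kronv v w $ k else 0)"
    using i by (intro sum.cong refl) (auto simp: swap_mat_def)
  also have "\<dots> = kronv v w $ ?g" using swap_index_less[OF i(1)] by simp
  also have "\<dots> = kronv w v $ i"
    using assms i swap_index_less[OF i(1)] div_mod_less[OF i(2)] by simp
  finally show "(swap_mat p q *\<^sub>v kronv v w) $ i = kronv w v $ i" .
qed

section \<open>The time evolution operator\<close>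

definition kern :: "complex mat \<Rightarrow> nat \<Rightarrow> nat \<Rightarrow> complex" where
  "kern A i j = A $$ (i,j)"

lemma mult_vec_ap:
  "A \<in> carrier_mat d d \<Longrightarrow> i < d \<Longrightarrow> (A *\<^sub>v vec d f) $ i = ap d (kern A) f i"
  by (simp add: mult_vec_entry ap_def kern_def del: index_mult_mat_vec)

lemma vnorm_mult_vec:
  "A \<in> carrier_mat d d \<Longrightarrow> vnorm (A *\<^sub>v vec d f) = nrm {..<d} (ap d (kern A) f)"
  by (auto simp: vnorm_nrm nrm_def mult_vec_ap simp del: index_mult_mat_vec intro!: L2_set_cong)

lemma vnorm_vec: "vnorm (vec d f) = nrm {..<d} f"
  by (auto simp: vnorm_nrm nrm_def intro!: L2_set_cong)

lemma nrm_unitary: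
  "is_unitary d U \<Longrightarrow> nrm {..<d} (ap d (kern U) f) = nrm {..<d} f"
  using vnorm_unitary[of d U "vec d f"] is_unitary_carrier[of d U]
  by (simp add: vnorm_mult_vec vnorm_vec)

lemma ap_kern_mult:
  assumes "A \<in> carrier_mat d d" "B \<in> carrier_mat d d" "i < d"
  shows "ap d (kern (A * B)) f i = ap d (kern A) (ap d (kern B) f) i"
proof -
  have "ap d (kern (A * B)) f i = ((A * B) *\<^sub>v vec d f) $ i"
    using assms by (intro mult_vec_ap[symmetric]) auto
  also have "(A * B) *\<^sub>v vec d f = A *\<^sub>v (B *\<^sub>v vec d f)"
    using assms by (intro assoc_mult_mat_vec) auto
  also have "B *\<^sub>v vec d f = vec d (ap d (kern B) f)"
    using assms by (intro eq_vecI) (auto simp: mult_vec_ap simp del: index_mult_mat_vec)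
  also have "(A *\<^sub>v vec d (ap d (kern B) f)) $ i = ap d (kern A) (ap d (kern B) f) i"
    using assms by (intro mult_vec_ap)
  finally show ?thesis .
qed

text \<open>A supremum of reals is an upper bound only if the set is bounded above. The sum of the
  moduli of all entries serves as a crude bound on the unit ball.\<close>

lemma spec_norm_bound:
  assumes A: "A \<in> carrier_mat d d" and v: "v \<in> carrier_vec d" "vnorm v \<le> 1"
  shows "vnorm (A *\<^sub>v v) \<le> spec_norm A"
  unfolding spec_norm_def
proof (rule cSup_upper)
  show "vnorm (A *\<^sub>v v) \<in> {vnorm (A *\<^sub>v v) |v. v \<in> carrier_vec (dim_col A) \<and> vnorm v \<le> 1}"
    using A v by auto
  show "bdd_above {vnorm (A *\<^sub>v v) |v. v \<in> carrier_vec (dim_col A) \<and> vnorm v \<le> 1}"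
  proof (rule bdd_aboveI)
    fix x assume "x \<in> {vnorm (A *\<^sub>v v) |v. v \<in> carrier_vec (dim_col A) \<and> vnorm v \<le> 1}"
    then obtain w where w: "x = vnorm (A *\<^sub>v w)" "w \<in> carrier_vec d" "vnorm w \<le> 1" using A by auto
    have wk: "cmod (w $ k) \<le> 1" if "k < d" for k
      using cmod_le_nrm[of "{..<d}" k "\<lambda>i. w $ i"] w that by (auto simp: vnorm_nrm)
    have "x \<le> (\<Sum>i<d. cmod ((A *\<^sub>v w) $ i))"
      unfolding w vnorm_nrm nrm_def using A by (auto intro: L2_set_le_sum simp del: index_mult_mat_vec)
    also have "\<dots> \<le> (\<Sum>i<d. \<Sum>k<d. cmod (A $$ (i,k)))"
    proof (rule sum_mono)
      fix i assume "i \<in> {..<d}"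
      then have "cmod ((A *\<^sub>v w) $ i) = cmod (\<Sum>k<d. A $$ (i,k) * w $ k)"
        using A w by (simp add: mult_vec_entry del: index_mult_mat_vec)
      also have "\<dots> \<le> (\<Sum>k<d. cmod (A $$ (i,k) * w $ k))" by (rule norm_sum)
      also have "\<dots> \<le> (\<Sum>k<d. cmod (A $$ (i,k)))"
        using wk by (intro sum_mono) (auto simp: norm_mult intro: mult_left_le)
      finally show "cmod ((A *\<^sub>v w) $ i) \<le> (\<Sum>k<d. cmod (A $$ (i,k)))" .
    qed
    finally show "x \<le> (\<Sum>i<d. \<Sum>k<d. cmod (A $$ (i,k)))" .
  qed
qed

lemma spec_norm_contraction:
  assumes A: "A \<in> carrier_mat d d" and "spec_norm A \<le> 1"
  shows "nrm {..<d} (ap d (kern A) f) \<le> nrm {..<d} f"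
proof (cases "nrm {..<d} f = 0")
  case True
  then have "\<forall>i<d. f i = 0" by (auto simp: nrm_def L2_set_eq_0_iff)
  then have "ap d (kern A) f i = 0" for i by (simp add: ap_def)
  then show ?thesis by (simp add: True[symmetric] nrm_def L2_set_0')
next
  case False
  let ?c = "complex_of_real (1 / nrm {..<d} f)"
  have c: "cmod ?c * nrm {..<d} f = 1" using False by (simp add: norm_divide)
  have "vnorm (A *\<^sub>v vec d (\<lambda>i. ?c * f i)) \<le> spec_norm A"
    by (rule spec_norm_bound[OF A]) (use c in \<open>simp_all only: vnorm_vec nrm_scale, auto\<close>)
  then have "cmod ?c * nrm {..<d} (ap d (kern A) f) \<le> 1"
    using A assms(2) unfolding vnorm_mult_vec[OF A] ap_scale nrm_scale by linarith
  then have "cmod ?c * nrm {..<d} (ap d (kern A) f) \<le> cmod ?c * nrm {..<d} f" using c by simp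
  moreover have "0 < cmod ?c" using False by simp
  ultimately show ?thesis by (simp only: mult_le_cancel_left_pos)
qed

lemma pow_mat_carrier [simp]: "A \<in> carrier_mat d d \<Longrightarrow> A ^\<^sub>m m \<in> carrier_mat d d"
  by (induction m) auto

lemma pow_mat_add:
  assumes "A \<in> carrier_mat d d"
  shows "A ^\<^sub>m (m + k) = A ^\<^sub>m m * A ^\<^sub>m k"
proof (induction k)
  case 0 then show ?case using assms by simp
next
  case (Suc k)
  then show ?case using assms by (simp add: assoc_mult_mat[of _ d d _ d _ d])
qed

lemma pow_mat_smult:
  fixes A :: "complex mat"
  assumes "A \<in> carrier_mat d d" "i < d" "j < d"
  shows "((c \<cdot>\<^sub>m A) ^\<^sub>m m) $$ (i,j) = c ^ m * (A ^\<^sub>m m) $$ (i,j)"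
proof -
  have "(c \<cdot>\<^sub>m A) ^\<^sub>m m = c ^ m \<cdot>\<^sub>m (A ^\<^sub>m m)"
  proof (induction m)
    case 0 then show ?case using assms by (intro eq_matI) auto
  next
    case (Suc m)
    have P: "A ^\<^sub>m m \<in> carrier_mat d d" using assms by simp
    have "(c \<cdot>\<^sub>m A) ^\<^sub>m Suc m = (c ^ m \<cdot>\<^sub>m A ^\<^sub>m m) * (c \<cdot>\<^sub>m A)" by (simp add: Suc)
    also have "\<dots> = c ^ Suc m \<cdot>\<^sub>m (A ^\<^sub>m m * A)"
      using P assms(1) by (intro eq_matI) (auto simp: mult_entry sum_distrib_left algebra_simps simp del: index_mult_mat(1))
    finally show ?case by simp
  qed
  moreover have "A ^\<^sub>m m \<in> carrier_mat d d" using assms by simp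
  ultimately show ?thesis using assms(2,3) by (metis carrier_matD index_smult_mat(1))
qed

lemma adj_pow:
  assumes "is_hermitian d H"
  shows "adj (H ^\<^sub>m m) = H ^\<^sub>m m"
proof (induction m)
  case 0 then show ?case using assms by (simp add: is_hermitian_def)
next
  case (Suc m)
  have H: "H \<in> carrier_mat d d" "adj H = H" using assms by (auto simp: is_hermitian_def)
  have "adj (H ^\<^sub>m Suc m) = H * H ^\<^sub>m m"
    using H Suc by (simp add: adj_mult[of _ d d _ d])
  also have "\<dots> = H ^\<^sub>m (1 + m)" using H pow_mat_add[OF H(1), of 1 m] by simp
  finally show ?case by simp
qed

lemma nrm_le_limit:
  assumes "finite I" "\<And>i. i \<in> I \<Longrightarrow> (\<lambda>m. F m i) \<longlonglongrightarrow> g i" "\<And>m. nrm I (F m) \<le> b"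
  shows "nrm I g \<le> b"
proof (rule LIMSEQ_le_const2)
  show "(\<lambda>m. nrm I (F m)) \<longlonglongrightarrow> nrm I g"
    unfolding nrm_def L2_set_def using assms(2) by (intro tendsto_intros) auto
qed (use assms(3) in auto)

lemma nrm_sum_le: "nrm I (\<lambda>i. \<Sum>m<M. F m i) \<le> (\<Sum>m<(M::nat). nrm I (F m))"
proof (induction M)
  case 0 then show ?case by (simp add: nrm_def L2_set_0')
next
  case (Suc M)
  then show ?case using nrm_add[of I "\<lambda>i. \<Sum>m<M. F m i" "F M"] by simp
qed

section \<open>The exponential series of a bounded Hermitian matrix\<close>

locale bounded_hermitian =
  fixes d :: nat and H :: "complex mat"
  assumes herm: "is_hermitian d H"
    and contr: "\<And>f. nrm {..<d} (ap d (kern H) f) \<le> nrm {..<d} f"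
begin

lemma Hc [simp]: "H \<in> carrier_mat d d" using herm by (simp add: is_hermitian_def)

definition P :: "nat \<Rightarrow> nat \<Rightarrow> nat \<Rightarrow> complex" where "P m = kern (H ^\<^sub>m m)"

lemma P_mult: "i < d \<Longrightarrow> j < d \<Longrightarrow> (\<Sum>k<d. P a i k * P b k j) = P (a + b) i j"
  using carrier_matD[OF pow_mat_carrier[OF Hc]]
  by (simp add: P_def kern_def pow_mat_add[OF Hc] mult_entry del: index_mult_mat(1))

lemma P_0: "i < d \<Longrightarrow> j < d \<Longrightarrow> P 0 i j = (if i = j then 1 else 0)"
  using Hc by (auto simp: P_def kern_def simp del: Hc)

lemma ap_P_0: "i < d \<Longrightarrow> ap d (P 0) f i = f i"
  unfolding ap_def by (subst sum.cong[OF refl, of _ _ "\<lambda>j. if j = i then f j else 0"]) (auto simp: P_0)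

lemma P_1: "P (Suc 0) = kern H"
  by (simp add: P_def)

lemma P_cnj: "i < d \<Longrightarrow> j < d \<Longrightarrow> cnj (P m j i) = P m i j"
proof -
  assume ij: "i < d" "j < d"
  have "adj (H ^\<^sub>m m) $$ (i,j) = cnj ((H ^\<^sub>m m) $$ (j,i))"
    using ij carrier_matD[OF pow_mat_carrier[OF Hc]] by (intro adj_index) auto
  then show ?thesis by (simp add: adj_pow[OF herm] P_def kern_def)
qed

lemma nrm_P: "nrm {..<d} (ap d (P m) f) \<le> nrm {..<d} f"
proof (induction m arbitrary: f)
  case 0
  have "nrm {..<d} (ap d (P 0) f) = nrm {..<d} f" by (rule nrm_cong) (simp add: ap_P_0)
  then show ?case by simp
next
  case (Suc m)
  have "nrm {..<d} (ap d (P (Suc m)) f) = nrm {..<d} (ap d (P m) (ap d (kern H) f))"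
    unfolding P_def pow_mat.simps by (intro nrm_cong) (simp add: ap_kern_mult)
  also have "\<dots> \<le> nrm {..<d} f" using Suc[of "ap d (kern H) f"] contr[of f] by linarith
  finally show ?case .
qed

text \<open>An entry is a coordinate of the image of a basis vector under a contraction. This
  dominates each entry of the exponential series by the scalar one.\<close>

lemma P_le_1: "i < d \<Longrightarrow> j < d \<Longrightarrow> cmod (P m i j) \<le> 1"
proof -
  assume ij: "i < d" "j < d"
  let ?e = "\<lambda>k. if k = j then 1 else 0 :: complex"
  have "nrm {..<d} ?e = 1" using ij by (simp add: nrm_def L2_set_def if_distrib[of cmod] if_distrib[of "\<lambda>x. x\<^sup>2"] cong: if_cong)
  moreover have "ap d (P m) ?e i = P m i j" using ij by (simp add: ap_def if_distrib cong: if_cong)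
  moreover have "cmod (ap d (P m) ?e i) \<le> nrm {..<d} (ap d (P m) ?e)" using ij by (intro cmod_le_nrm) auto
  ultimately show ?thesis using nrm_P[of m ?e] by simp
qed

definition coef :: "complex \<Rightarrow> nat \<Rightarrow> complex" where "coef c m = c ^ m / fact m"

lemma norm_coef: "cmod (coef c m) = cmod c ^ m / fact m"
  by (simp add: coef_def norm_divide norm_power)

lemma summable_coef:
  assumes "i < d" "j < d"
  shows "summable (\<lambda>m. norm (coef c m * P m i j))"
proof (rule summable_comparison_test')
  show "summable (\<lambda>m. norm (coef c m))"
    using summable_exp[of "cmod c"] by (simp add: norm_coef divide_inverse mult.commute)
  show "norm (norm (coef c m * P m i j)) \<le> norm (coef c m)" if "m \<ge> 0" for m
    using P_le_1[OF assms, of m] by (simp add: norm_mult mult_left_le)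
qed

lemma mexp_entry:
  assumes "i < d" "j < d"
  shows "kern (mexp (c \<cdot>\<^sub>m H)) i j = (\<Sum>m. coef c m * P m i j)"
proof -
  have "kern (mexp (c \<cdot>\<^sub>m H)) i j = (\<Sum>m. ((c \<cdot>\<^sub>m H) ^\<^sub>m m) $$ (i,j) / of_nat (fact m))"
    using assms carrier_matD[OF Hc] by (simp add: kern_def mexp_def)
  also have "\<dots> = (\<Sum>m. coef c m * P m i j)"
    using assms by (simp add: pow_mat_smult[OF Hc] coef_def P_def kern_def)
  finally show ?thesis .
qed

lemma mexp_carrier [simp]: "mexp (c \<cdot>\<^sub>m H) \<in> carrier_mat d d"
  using carrier_matD[OF Hc] by (intro carrier_matI) (simp_all add: mexp_def)

lemma coef_cauchy: "(\<Sum>a\<le>p. coef (- c) a * coef c (p - a)) = (if p = 0 then 1 else 0)"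
proof -
  have "(\<Sum>a\<le>p. coef (- c) a * coef c (p - a)) =
      (\<Sum>a\<le>p. of_nat (p choose a) * (- c) ^ a * c ^ (p - a) / fact p)"
    by (intro sum.cong refl) (simp add: coef_def binomial_fact)
  also have "\<dots> = (- c + c) ^ p / fact p"
    by (simp only: binomial_ring sum_divide_distrib)
  finally show ?thesis by simp
qed

text \<open>The entrywise Cauchy product of the two series collects the factor
  \<open>(- c + c) ^ p / fact p\<close> in front of the \<open>p\<close>-th power of
  \<open>H\<close>, so only \<open>p = 0\<close> survives.\<close>

lemma mexp_inverse:
  assumes ij: "i < d" "j < d"
  shows "(\<Sum>k<d. kern (mexp ((- c) \<cdot>\<^sub>m H)) i k * kern (mexp (c \<cdot>\<^sub>m H)) k j) = (if i = j then 1 else 0)"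
proof -
  have "(\<lambda>p. \<Sum>a\<le>p. (coef (- c) a * P a i k) * (coef c (p - a) * P (p - a) k j)) sums
      (kern (mexp ((- c) \<cdot>\<^sub>m H)) i k * kern (mexp (c \<cdot>\<^sub>m H)) k j)" if "k < d" for k
    unfolding mexp_entry[OF ij(1) that] mexp_entry[OF that ij(2)]
    by (rule Cauchy_product_sums) (rule summable_coef; use ij that in simp)+
  then have S: "(\<lambda>p. \<Sum>k<d. \<Sum>a\<le>p. (coef (- c) a * P a i k) * (coef c (p - a) * P (p - a) k j)) sums
      (\<Sum>k<d. kern (mexp ((- c) \<cdot>\<^sub>m H)) i k * kern (mexp (c \<cdot>\<^sub>m H)) k j)"
    by (intro sums_sum) auto
  have "(\<Sum>k<d. \<Sum>a\<le>p. (coef (- c) a * P a i k) * (coef c (p - a) * P (p - a) k j)) =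
      (if p = 0 then (if i = j then 1 else 0) else 0)" for p
  proof -
    have "(\<Sum>k<d. \<Sum>a\<le>p. (coef (- c) a * P a i k) * (coef c (p - a) * P (p - a) k j)) =
      (\<Sum>a\<le>p. (coef (- c) a * coef c (p - a)) * (\<Sum>k<d. P a i k * P (p - a) k j))"
      by (subst sum.swap) (simp add: sum_distrib_left mult_ac)
    also have "\<dots> = (\<Sum>a\<le>p. (coef (- c) a * coef c (p - a)) * P p i j)"
      using ij by (intro sum.cong refl) (simp add: P_mult)
    also have "\<dots> = (if p = 0 then P 0 i j else 0)"
      by (simp add: coef_cauchy flip: sum_distrib_right)
    finally show ?thesis by (simp add: P_0 ij)
  qed
  with S have "(\<lambda>p. if p = 0 then (if i = j then 1 else 0) else 0 :: complex) sums
      (\<Sum>k<d. kern (mexp ((- c) \<cdot>\<^sub>m H)) i k * kern (mexp (c \<cdot>\<^sub>m H)) k j)" by simp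
  moreover have "(\<lambda>p. if p = 0 then (if i = j then 1 else 0) else 0 :: complex) sums (if i = j then 1 else 0)"
    using sums_single[of 0 "\<lambda>_. if i = j then 1 else 0 :: complex"] by simp
  ultimately show ?thesis by (rule sums_unique2)
qed

lemma time_evol_carrier [simp]: "time_evol H t \<in> carrier_mat d d"
  by (simp add: time_evol_def)

text \<open>Powers of \<open>H\<close> are Hermitian and the scalar is purely imaginary, so the
  adjoint of the exponential is the exponential of the negated exponent, which
  \<open>mexp_inverse\<close> shows to be the inverse.\<close>

lemma time_evol_unitary: "is_unitary d (time_evol H t)"
proof -
  define c where "c = - \<i> * complex_of_real t"
  have cc: "cnj c = - c" by (simp add: c_def)
  have U: "time_evol H t = mexp (c \<cdot>\<^sub>m H)" by (simp add: time_evol_def c_def)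
  have adjU: "cnj (kern (mexp (c \<cdot>\<^sub>m H)) k i) = kern (mexp ((- c) \<cdot>\<^sub>m H)) i k" if "i < d" "k < d" for i k
  proof -
    have "(\<lambda>m. coef c m * P m k i) sums kern (mexp (c \<cdot>\<^sub>m H)) k i"
      unfolding mexp_entry[OF that(2,1)] by (rule summable_sums) (rule summable_norm_cancel[OF summable_coef[OF that(2,1)]])
    then have "(\<lambda>m. cnj (coef c m * P m k i)) sums cnj (kern (mexp (c \<cdot>\<^sub>m H)) k i)"
      by (simp only: sums_cnj)
    moreover have "cnj (coef c m * P m k i) = coef (- c) m * P m i k" for m
      using that by (simp add: coef_def P_cnj cc)
    ultimately show ?thesis unfolding mexp_entry[OF that] by (simp add: sums_iff)
  qed
  have "adj (mexp (c \<cdot>\<^sub>m H)) * mexp (c \<cdot>\<^sub>m H) = 1\<^sub>m d"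
  proof (rule eq_matI)
    fix i j assume "i < dim_row (1\<^sub>m d :: complex mat)" "j < dim_col (1\<^sub>m d :: complex mat)"
    then have ij: "i < d" "j < d" by auto
    have "(adj (mexp (c \<cdot>\<^sub>m H)) * mexp (c \<cdot>\<^sub>m H)) $$ (i,j) =
      (\<Sum>k<d. cnj (kern (mexp (c \<cdot>\<^sub>m H)) k i) * kern (mexp (c \<cdot>\<^sub>m H)) k j)"
      using ij carrier_matD[OF mexp_carrier[of c]] by (subst mult_entry) (auto simp: kern_def)
    also have "\<dots> = (if i = j then 1 else 0)"
      using mexp_inverse[OF ij, of c] ij by (simp add: adjU)
    finally show "(adj (mexp (c \<cdot>\<^sub>m H)) * mexp (c \<cdot>\<^sub>m H)) $$ (i,j) = 1\<^sub>m d $$ (i,j)" using ij by simp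
  qed (use carrier_matD[OF mexp_carrier[of c]] in auto)
  then show ?thesis by (simp add: is_unitary_def U)
qed

lemma ap_time_evol_sums:
  assumes "i < d"
  shows "(\<lambda>m. coef (- \<i> * t) m * ap d (P m) f i) sums ap d (kern (time_evol H t)) f i"
proof -
  have "(\<lambda>m. coef (- \<i> * t) m * P m i j * f j) sums (kern (time_evol H t) i j * f j)" if "j < d" for j
    unfolding time_evol_def mexp_entry[OF assms that]
    by (intro sums_mult2 summable_sums summable_norm_cancel[OF summable_coef[OF assms that]])
  then have "(\<lambda>m. \<Sum>j<d. coef (- \<i> * t) m * P m i j * f j) sums (\<Sum>j<d. kern (time_evol H t) i j * f j)"
    by (intro sums_sum) auto
  then show ?thesis by (simp add: ap_def sum_distrib_left mult.assoc)
qed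

text \<open>For \<open>t\<close> at most 1 the tail from order two on is at most \<open>t^2\<close>
  times the sum of \<open>1 / fact (m + 2)\<close>, and \<open>fact (m + 2)\<close> is at least
  \<open>2 ^ (m + 1)\<close>. The geometric series then sums to 1. The bound holds for all partial
  sums and passes to the limit.\<close>

lemma time_evol_taylor:
  fixes t :: real
  assumes t: "0 \<le> t" "t \<le> 1"
  shows "nrm {..<d} (\<lambda>i. ap d (kern (time_evol H t)) f i - (f i - \<i> * t * ap d (kern H) f i)) \<le> t\<^sup>2 * nrm {..<d} f"
proof (rule nrm_le_limit)
  let ?c = "- \<i> * complex_of_real t"
  let ?F = "\<lambda>M i. \<Sum>m<M. coef ?c (m + 2) * ap d (P (m + 2)) f i"
  show "(\<lambda>M. ?F M i) \<longlonglongrightarrow> ap d (kern (time_evol H t)) f i - (f i - \<i> * t * ap d (kern H) f i)"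
    if "i \<in> {..<d}" for i
  proof -
    have i: "i < d" using that by simp
    have "(\<lambda>m. coef ?c (m + 2) * ap d (P (m + 2)) f i) sums
       (ap d (kern (time_evol H t)) f i - (\<Sum>m<2. coef ?c m * ap d (P m) f i))"
      using ap_time_evol_sums[OF i, of t f] by (rule sums_split_initial_segment)
    moreover have "(\<Sum>m<2. coef ?c m * ap d (P m) f i) = f i - \<i> * t * ap d (kern H) f i"
      using i by (simp add: numeral_2_eq_2 coef_def ap_P_0 P_1)
    ultimately show ?thesis by (simp add: sums_def)
  qed
  fix M :: nat
  have "nrm {..<d} (?F M) \<le> (\<Sum>m<M. nrm {..<d} (\<lambda>i. coef ?c (m + 2) * ap d (P (m + 2)) f i))"
    by (rule nrm_sum_le)
  also have "\<dots> \<le> (\<Sum>m<M. t\<^sup>2 * (1/2) ^ (m + 1) * nrm {..<d} f)"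
  proof (rule sum_mono)
    fix m :: nat
    have "t ^ (m + 2) \<le> t\<^sup>2" using t by (intro power_decreasing) auto
    moreover have "(2::real) ^ (m + 1) \<le> fact (m + 2)"
    proof (induction m)
      case (Suc m)
      have "(2::real) ^ (Suc m + 1) = 2 * 2 ^ (m + 1)" by simp
      also have "\<dots> \<le> (3 + real m) * fact (m + 2)" using Suc by (intro mult_mono) auto
      also have "\<dots> = fact (Suc m + 2)" by (simp add: algebra_simps)
      finally show ?case .
    qed simp
    ultimately have "t ^ (m + 2) / fact (m + 2) \<le> t\<^sup>2 / 2 ^ (m + 1)"
      by (intro frac_le) auto
    moreover have "cmod (coef ?c (m + 2)) = t ^ (m + 2) / fact (m + 2)"
      unfolding norm_coef using t by (simp add: norm_mult)
    moreover have "t\<^sup>2 / 2 ^ (m + 1) = t\<^sup>2 * (1/2) ^ (m + 1)"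
      by (simp only: power_inverse divide_inverse mult_1)
    ultimately have "cmod (coef ?c (m + 2)) \<le> t\<^sup>2 * (1/2) ^ (m + 1)" by linarith
    then show "nrm {..<d} (\<lambda>i. coef ?c (m + 2) * ap d (P (m + 2)) f i) \<le> t\<^sup>2 * (1/2) ^ (m + 1) * nrm {..<d} f"
      unfolding nrm_scale by (intro mult_mono nrm_P) simp_all
  qed
  also have "\<dots> = (\<Sum>m<M. (1/2) ^ (m + 1)) * (t\<^sup>2 * nrm {..<d} f)"
    unfolding sum_distrib_right by (intro sum.cong refl) (simp only: mult_ac)
  also have "(\<Sum>m<M. (1/2 :: real) ^ (m + 1)) = 1 - (1/2) ^ M"
    by (induction M) auto
  also have "(1 - (1/2) ^ M) * (t\<^sup>2 * nrm {..<d} f) \<le> 1 * (t\<^sup>2 * nrm {..<d} f)"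
    by (intro mult_right_mono) auto
  finally show "nrm {..<d} (?F M) \<le> t\<^sup>2 * nrm {..<d} f" by simp
qed simp

end

lemma hamiltonian_bounded_hermitian: "hamiltonian n H \<Longrightarrow> bounded_hermitian (2^n) H"
  unfolding hamiltonian_def by unfold_locales (auto simp: is_hermitian_def intro: spec_norm_contraction)

section \<open>Operators acting on one tensor factor\<close>

lemma nrm_lift_square:
  "(nrm {..<p*q} f)\<^sup>2 = (\<Sum>y<q. (nrm {..<p} (\<lambda>x. f (x * q + y)))\<^sup>2)"
proof -
  have "(nrm {..<p*q} f)\<^sup>2 = (\<Sum>i<p*q. (cmod (f (i div q * q + i mod q)))\<^sup>2)"
    by (simp add: nrm_power2)
  also have "\<dots> = (\<Sum>x<p. \<Sum>y<q. (cmod (f (x * q + y)))\<^sup>2)"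
    by (rule sum_div_mod[of "\<lambda>x y. (cmod (f (x * q + y)))\<^sup>2"])
  also have "\<dots> = (\<Sum>y<q. (nrm {..<p} (\<lambda>x. f (x * q + y)))\<^sup>2)"
    unfolding nrm_power2 by (rule sum.swap)
  finally show ?thesis .
qed

text \<open>An operator tensored with the identity acts separately on each fibre with fixed second
  index, and squared norms add over the fibres. Hence operator bounds survive ancillas with the same
  constant.\<close>

lemma nrm_lift_le:
  assumes "0 \<le> c" "\<And>y. y < q \<Longrightarrow> nrm {..<p} (\<lambda>x. g (x * q + y)) \<le> c * nrm {..<p} (\<lambda>x. f (x * q + y))"
  shows "nrm {..<p*q} g \<le> c * nrm {..<p*q} f"
proof (rule power2_le_imp_le)
  show "(nrm {..<p*q} g)\<^sup>2 \<le> (c * nrm {..<p*q} f)\<^sup>2"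
    unfolding power_mult_distrib nrm_lift_square sum_distrib_left
    by (intro sum_mono) (use assms in \<open>auto simp flip: power_mult_distrib intro!: power_mono\<close>)
qed (use assms in simp)

lemma ap_kron_one:
  assumes "A \<in> carrier_mat p p" "x < p" "y < q"
  shows "ap (p * q) (kern (kron A (1\<^sub>m q))) f (x * q + y) = ap p (kern A) (\<lambda>k. f (k * q + y)) x"
proof -
  have "x * q + y < Suc x * q" using assms by simp
  also have "\<dots> \<le> p * q" using assms by (intro mult_le_mono1) auto
  finally have i: "x * q + y < p * q" .
  have "ap (p * q) (kern (kron A (1\<^sub>m q))) f (x * q + y) =
     (\<Sum>j<p*q. A $$ (x, j div q) * (if y = j mod q then 1 else 0) * f (j div q * q + j mod q))"
    unfolding ap_def using assms i div_mod_less by (intro sum.cong refl) (auto simp: kern_def)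
  also have "\<dots> = (\<Sum>k<p. \<Sum>z<q. A $$ (x, k) * (if y = z then 1 else 0) * f (k * q + z))"
    by (rule sum_div_mod[of "\<lambda>k z. A $$ (x, k) * (if y = z then 1 else 0) * f (k * q + z)"])
  also have "\<dots> = (\<Sum>k<p. \<Sum>z<q. if y = z then A $$ (x, k) * f (k * q + z) else 0)"
    by (intro sum.cong refl) auto
  also have "\<dots> = ap p (kern A) (\<lambda>k. f (k * q + y)) x"
    using assms by (simp add: ap_def kern_def)
  finally show ?thesis .
qed

section \<open>The Pauli basis\<close>

text \<open>The Hilbert-Schmidt inner product. It is multiplicative over \<open>kron\<close>, so
  orthogonality of Pauli strings reduces to the four matrices on one qubit.\<close>

definition ip :: "nat \<Rightarrow> complex mat \<Rightarrow> complex mat \<Rightarrow> complex" where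
  "ip d A B = (\<Sum>i<d. \<Sum>j<d. cnj (A $$ (i,j)) * B $$ (i,j))"

lemma ip_kron:
  assumes "A \<in> carrier_mat p p" "C \<in> carrier_mat p p" "B \<in> carrier_mat q q" "D \<in> carrier_mat q q"
  shows "ip (p * q) (kron A B) (kron C D) = ip p A C * ip q B D"
proof -
  let ?g = "\<lambda>x y x' y'. (cnj (A $$ (x,x')) * C $$ (x,x')) * (cnj (B $$ (y,y')) * D $$ (y,y'))"
  have "ip (p * q) (kron A B) (kron C D) =
     (\<Sum>i<p*q. \<Sum>j<p*q. ?g (i div q) (i mod q) (j div q) (j mod q))"
    unfolding ip_def using assms by (intro sum.cong refl) auto
  also have "\<dots> = (\<Sum>i<p*q. \<Sum>x'<p. \<Sum>y'<q. ?g (i div q) (i mod q) x' y')"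
  proof (rule sum.cong[OF refl])
    fix i
    show "(\<Sum>j<p*q. ?g (i div q) (i mod q) (j div q) (j mod q)) = (\<Sum>x'<p. \<Sum>y'<q. ?g (i div q) (i mod q) x' y')"
      by (rule sum_div_mod[of "\<lambda>x' y'. ?g (i div q) (i mod q) x' y'"])
  qed
  also have "\<dots> = (\<Sum>x<p. \<Sum>y<q. \<Sum>x'<p. \<Sum>y'<q. ?g x y x' y')"
    by (rule sum_div_mod[of "\<lambda>x y. \<Sum>x'<p. \<Sum>y'<q. ?g x y x' y'"])
  also have "\<dots> = (\<Sum>x<p. \<Sum>x'<p. \<Sum>y<q. \<Sum>y'<q. ?g x y x' y')"
    by (intro sum.cong refl sum.swap)
  also have "\<dots> = (\<Sum>x<p. \<Sum>x'<p. (cnj (A $$ (x,x')) * C $$ (x,x')) * ip q B D)"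
    by (simp only: ip_def sum_distrib_left)
  also have "\<dots> = ip p A C * ip q B D"
    by (simp only: ip_def sum_distrib_right)
  finally show ?thesis .
qed

lemma pauli1_carrier [simp]: "pauli1 c \<in> carrier_mat 2 2"
  by (intro carrier_matI) (auto simp: pauli1_def mat_of_rows_list_def)

lemma pauli1_entries:
  "c < 4 \<Longrightarrow> i < 2 \<Longrightarrow> j < 2 \<Longrightarrow> pauli1 c $$ (i,j) =
    (if c = 1 then (if i = j then 0 else 1)
     else if c = 2 then (if i = j then 0 else if i = 0 then - \<i> else \<i>)
     else if c = 3 then (if i \<noteq> j then 0 else if i = 0 then 1 else -1)
     else (if i = j then 1 else 0))"
  by (cases i; cases j) (auto simp: pauli1_def mat_of_rows_list_def less_Suc_eq numeral_2_eq_2)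

lemma ip_pauli1: "a < 4 \<Longrightarrow> b < 4 \<Longrightarrow> ip 2 (pauli1 a) (pauli1 b) = (if a = b then 2 else 0)"
proof -
  assume ab: "a < 4" "b < 4"
  have two: "(\<Sum>i<2. g i) = g 0 + g 1" for g :: "nat \<Rightarrow> complex"
    by (simp add: numeral_2_eq_2)
  have "a = 0 \<or> a = 1 \<or> a = 2 \<or> a = 3" "b = 0 \<or> b = 1 \<or> b = 2 \<or> b = 3" using ab by auto
  then show ?thesis
    by (elim disjE) (simp_all add: ip_def two pauli1_entries)
qed

lemma adj_pauli1: "c < 4 \<Longrightarrow> adj (pauli1 c) = pauli1 c"
  by (rule eq_matI) (auto simp: pauli1_entries carrier_matD[OF pauli1_carrier])

lemma pauli_mat_Cons: "pauli_mat (c # p) = kron (pauli1 c) (pauli_mat p)"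
  and pauli_mat_Nil: "pauli_mat [] = 1\<^sub>m 1"
  by (simp_all add: pauli_mat_def)

lemma pauli_mat_carrier: "pauli_mat p \<in> carrier_mat (2 ^ length p) (2 ^ length p)"
  by (induction p) (auto simp: pauli_mat_Cons pauli_mat_Nil intro!: kron_carrier)

lemma adj_pauli_mat: "set p \<subseteq> {0..<4} \<Longrightarrow> adj (pauli_mat p) = pauli_mat p"
  by (induction p) (auto simp: pauli_mat_Cons pauli_mat_Nil kron_adj adj_pauli1)

lemma ip_pauli_mat:
  "length p = length q \<Longrightarrow> set p \<subseteq> {0..<4} \<Longrightarrow> set q \<subseteq> {0..<4} \<Longrightarrow>
    ip (2 ^ length p) (pauli_mat p) (pauli_mat q) = (if p = q then 2 ^ length p else 0)"
proof (induction p q rule: list_induct2)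
  case Nil
  then show ?case by (simp add: pauli_mat_Nil ip_def)
next
  case (Cons a p b q)
  have "pauli_mat q \<in> carrier_mat (2 ^ length p) (2 ^ length p)"
    using pauli_mat_carrier[of q] Cons by simp
  then show ?case
    using Cons pauli_mat_carrier[of p]
    by (simp add: pauli_mat_Cons ip_kron ip_pauli1)
qed

lemma pauli_mat_identity: "pauli_mat (replicate n 0) = 1\<^sub>m (2 ^ n)"
proof (induction n)
  case 0 then show ?case by (simp add: pauli_mat_Nil)
next
  case (Suc n)
  have "pauli1 0 = 1\<^sub>m 2" by (simp add: pauli1_def)
  then show ?case using Suc by (simp add: pauli_mat_Cons)
qed

lemma card_pauli_strings: "finite (pauli_strings n)" "card (pauli_strings n) = 2 ^ n * 2 ^ n"
proof -
  have eq: "pauli_strings n = {p. set p \<subseteq> {0..<4} \<and> length p = n}" by (auto simp: pauli_strings_def)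
  show "finite (pauli_strings n)" unfolding eq by (rule finite_lists_length_eq) simp
  have "card (pauli_strings n) = 4 ^ n" unfolding eq by (subst card_lists_length_eq) auto
  also have "(4::nat) ^ n = 2 ^ n * 2 ^ n" by (simp flip: power_mult_distrib)
  finally show "card (pauli_strings n) = 2 ^ n * 2 ^ n" .
qed

text \<open>Composing any enumeration with a transposition. It lets the identity string have index
  0, the initial basis state of the algorithms.\<close>

lemma bij_betw_initial:
  fixes S :: "'a set"
  assumes "finite S" "x \<in> S"
  shows "\<exists>f. bij_betw f {..<card S} S \<and> f 0 = x"
proof -
  obtain g where g: "bij_betw g {..<card S} S"
    using assms ex_bij_betw_nat_finite by (auto simp: atLeast0LessThan)
  then obtain j where j: "j < card S" "g j = x" using assms by (metis bij_betw_imp_surj_on imageE lessThan_iff)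
  define t where "t i = (if i = 0 then j else if i = j then 0 else i)" for i
  have "bij_betw t {..<card S} {..<card S}"
    by (rule bij_betw_byWitness[where f' = t]) (use j in \<open>auto simp: t_def\<close>)
  then have "bij_betw (g \<circ> t) {..<card S} S" using g by (rule bij_betw_trans)
  then show ?thesis using j by (intro exI[of _ "g \<circ> t"]) (auto simp: t_def)
qed

locale pauli_basis =
  fixes n :: nat and f :: "nat \<Rightarrow> nat list"
  assumes bij: "bij_betw f {..<2^n * 2^n} (pauli_strings n)" and f0: "f 0 = replicate n 0"
begin

abbreviation D :: nat where "D \<equiv> 2 ^ n"

lemma f_string: "a < D * D \<Longrightarrow> f a \<in> pauli_strings n"
  using bij by (auto simp: bij_betw_def)

lemma pauli_carrier: "p \<in> pauli_strings n \<Longrightarrow> pauli_mat p \<in> carrier_mat D D"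
  using pauli_mat_carrier[of p] by (simp add: pauli_strings_def)

lemma ip_pauli: "p \<in> pauli_strings n \<Longrightarrow> q \<in> pauli_strings n \<Longrightarrow>
    ip D (pauli_mat p) (pauli_mat q) = (if p = q then of_nat D else 0)"
  using ip_pauli_mat[of p q] by (auto simp: pauli_strings_def)

lemma ip_flat: "ip D A B = (\<Sum>i<D*D. cnj (A $$ (i div D, i mod D)) * B $$ (i div D, i mod D))"
  unfolding ip_def by (rule sum_div_mod[symmetric])

text \<open>The change from the computational basis of two \<open>n\<close>-qubit registers to the
  normalised Pauli basis: row \<open>a\<close> is the conjugate of the flattened Pauli
  \<open>f a\<close>, divided by the square root of \<open>D\<close>.\<close>

definition W :: "complex mat" where
  "W = mat (D * D) (D * D) (\<lambda>(a,i). cnj (pauli_mat (f a) $$ (i div D, i mod D)) / sqrt D)"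

lemma W_carrier [simp]: "W \<in> carrier_mat (D * D) (D * D)"
  by (simp add: W_def)

lemma sqrtD: "complex_of_real (sqrt D) * complex_of_real (sqrt D) = of_nat D"
  by (metis of_real_mult of_real_of_nat_eq real_sqrt_mult_self abs_of_nat)

lemma W_rows: "W * adj W = 1\<^sub>m (D * D)"
proof (rule eq_matI)
  fix a b assume "a < dim_row (1\<^sub>m (D * D) :: complex mat)" "b < dim_col (1\<^sub>m (D * D) :: complex mat)"
  then have ab: "a < D * D" "b < D * D" by auto
  have "(W * adj W) $$ (a,b) = (\<Sum>i<D*D. W $$ (a,i) * cnj (W $$ (b,i)))"
    using ab carrier_matD[OF W_carrier] by (subst mult_entry) auto
  also have "\<dots> = ip D (pauli_mat (f a)) (pauli_mat (f b)) / of_nat D"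
    using ab by (simp add: ip_flat W_def sum_divide_distrib sqrtD del: of_nat_power)
  also have "\<dots> = (if a = b then 1 else 0)"
  proof -
    have "f a = f b \<longleftrightarrow> a = b" using bij ab unfolding bij_betw_def inj_on_def by auto
    then show ?thesis using ab f_string by (simp add: ip_pauli)
  qed
  finally show "(W * adj W) $$ (a,b) = 1\<^sub>m (D * D) $$ (a,b)" using ab by simp
qed (use carrier_matD[OF W_carrier] in auto)

lemma adj_W_unitary: "is_unitary (D * D) (adj W)"
  by (simp add: is_unitary_def W_rows)

lemma W_unitary: "is_unitary (D * D) W"
  using is_unitary_adj[OF adj_W_unitary] by simp

section \<open>Pauli coefficients and the distance to \<open>k\<close>-local\<close>

definition coeff :: "complex mat \<Rightarrow> nat list \<Rightarrow> complex" where
  "coeff A p = ip D (pauli_mat p) A / of_nat D"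

definition flat :: "complex mat \<Rightarrow> complex vec" where
  "flat A = vec (D * D) (\<lambda>i. A $$ (i div D, i mod D))"

lemma flat_carrier [simp]: "flat A \<in> carrier_vec (D * D)"
  by (simp add: flat_def)

lemma W_flat: "a < D * D \<Longrightarrow> (W *\<^sub>v flat A) $ a = of_real (sqrt D) * coeff A (f a)"
proof -
  assume a: "a < D * D"
  have "(W *\<^sub>v flat A) $ a = ip D (pauli_mat (f a)) A / of_real (sqrt D)"
    using a carrier_matD[OF W_carrier]
    by (subst mult_vec_entry) (simp_all add: W_def flat_def ip_flat sum_divide_distrib)
  also have "\<dots> = of_real (sqrt D) * coeff A (f a)"
    using sqrtD by (simp add: coeff_def field_simps del: of_nat_power)
  finally show ?thesis .
qed

lemma nfrob_coeff: "(nfrob n A)\<^sup>2 = (\<Sum>p\<in>pauli_strings n. (cmod (coeff A p))\<^sup>2)"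
proof -
  have "(vnorm (flat A))\<^sup>2 = (\<Sum>i<D. \<Sum>j<D. (cmod (A $$ (i,j)))\<^sup>2)"
    unfolding flat_def vnorm_vec nrm_power2
    by (rule sum_div_mod[of "\<lambda>i j. (cmod (A $$ (i,j)))\<^sup>2"])
  then have 1: "(nfrob n A)\<^sup>2 = (vnorm (flat A))\<^sup>2 / D"
    by (simp add: nfrob_def sum_nonneg)
  have "(vnorm (flat A))\<^sup>2 = (vnorm (W *\<^sub>v flat A))\<^sup>2"
    by (simp add: vnorm_unitary[OF W_unitary])
  also have "\<dots> = (\<Sum>a<D*D. D * (cmod (coeff A (f a)))\<^sup>2)"
    unfolding vnorm_nrm nrm_power2 using carrier_matD[OF W_carrier]
    by (intro sum.cong) (auto simp: W_flat norm_mult power_mult_distrib simp del: index_mult_mat_vec)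
  also have "\<dots> = D * (\<Sum>p\<in>pauli_strings n. (cmod (coeff A p))\<^sup>2)"
    by (simp only: sum_distrib_left[symmetric] sum.reindex_bij_betw[OF bij, of "\<lambda>p. (cmod (coeff A p))\<^sup>2"])
  finally show ?thesis unfolding 1 by simp
qed

text \<open>\<open>k_local\<close> only asserts that some expansion exists. Orthogonality shows that
  its coefficients are the ones given by \<open>coeff\<close>.\<close>

lemma coeff_expansion:
  assumes "q \<in> pauli_strings n"
    "\<And>i j. i < D \<Longrightarrow> j < D \<Longrightarrow> A $$ (i,j) = (\<Sum>p\<in>pauli_strings n. of_real (\<alpha> p) * pauli_mat p $$ (i,j))"
  shows "coeff A q = of_real (\<alpha> q)"
proof -
  have "ip D (pauli_mat q) A = (\<Sum>i<D. \<Sum>j<D. \<Sum>p\<in>pauli_strings n. of_real (\<alpha> p) * (cnj (pauli_mat q $$ (i,j)) * pauli_mat p $$ (i,j)))"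
    unfolding ip_def by (intro sum.cong refl) (simp add: assms(2) sum_distrib_left mult_ac)
  also have "\<dots> = (\<Sum>i<D. \<Sum>p\<in>pauli_strings n. \<Sum>j<D. of_real (\<alpha> p) * (cnj (pauli_mat q $$ (i,j)) * pauli_mat p $$ (i,j)))"
    by (intro sum.cong refl sum.swap)
  also have "\<dots> = (\<Sum>p\<in>pauli_strings n. \<Sum>i<D. \<Sum>j<D. of_real (\<alpha> p) * (cnj (pauli_mat q $$ (i,j)) * pauli_mat p $$ (i,j)))"
    by (rule sum.swap)
  also have "\<dots> = (\<Sum>p\<in>pauli_strings n. of_real (\<alpha> p) * ip D (pauli_mat q) (pauli_mat p))"
    by (simp only: ip_def sum_distrib_left)
  also have "\<dots> = (\<Sum>p\<in>pauli_strings n. if q = p then of_real (\<alpha> p) * of_nat D else 0)"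
    using assms(1) by (intro sum.cong refl) (simp add: ip_pauli)
  also have "\<dots> = of_real (\<alpha> q) * of_nat D" using assms(1) card_pauli_strings(1) by simp
  finally show ?thesis by (simp add: coeff_def)
qed

lemma coeff_diff:
  assumes "A \<in> carrier_mat D D" "B \<in> carrier_mat D D"
  shows "coeff (A - B) p = coeff A p - coeff B p"
  unfolding coeff_def ip_def using assms
  by (simp add: algebra_simps sum_subtractf diff_divide_distrib)

lemma coeff_real:
  assumes "is_hermitian D H" "p \<in> pauli_strings n"
  shows "coeff H p = of_real (Re (coeff H p))"
proof -
  have P: "adj (pauli_mat p) = pauli_mat p" using assms(2) by (auto simp: pauli_strings_def intro: adj_pauli_mat)
  have H: "H \<in> carrier_mat D D" "adj H = H" using assms by (auto simp: is_hermitian_def)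
  have e: "cnj (pauli_mat p $$ (i,j)) = pauli_mat p $$ (j,i)" "cnj (H $$ (i,j)) = H $$ (j,i)" if "i < D" "j < D" for i j
    using that H carrier_matD[OF pauli_carrier[OF assms(2)]] adj_index[of j "pauli_mat p" i] adj_index[of j H i] P by auto
  have "cnj (ip D (pauli_mat p) H) = (\<Sum>i<D. \<Sum>j<D. cnj (pauli_mat p $$ (j,i)) * H $$ (j,i))"
    unfolding ip_def cnj_sum by (intro sum.cong refl) (simp add: e)
  also have "\<dots> = ip D (pauli_mat p) H" unfolding ip_def by (rule sum.swap)
  finally have "cnj (coeff H p) = coeff H p" by (simp add: coeff_def)
  then show ?thesis by (metis Reals_cnj_iff of_real_Re)
qed

definition high :: "nat \<Rightarrow> nat set" where
  "high k = {a \<in> {..<D * D}. pauli_weight (f a) > k}"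

definition high_norm :: "nat \<Rightarrow> complex mat \<Rightarrow> real" where
  "high_norm k A = nrm (high k) (\<lambda>a. coeff A (f a))"

lemma high_norm_power2:
  "(high_norm k A)\<^sup>2 = (\<Sum>p\<in>{p\<in>pauli_strings n. pauli_weight p > k}. (cmod (coeff A p))\<^sup>2)"
proof -
  have "bij_betw f (high k) {p\<in>pauli_strings n. pauli_weight p > k}"
    using bij unfolding high_def bij_betw_def inj_on_def by auto
  from sum.reindex_bij_betw[OF this, of "\<lambda>p. (cmod (coeff A p))\<^sup>2"]
  show ?thesis by (simp add: high_norm_def nrm_power2)
qed

lemma high_zero: "0 \<notin> high k" "high k \<subseteq> {..<D * D}"
proof -
  have "pauli_weight (replicate n 0) = 0" by (simp add: pauli_weight_def)
  then show "0 \<notin> high k" by (simp add: high_def f0)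
qed (auto simp: high_def)

lemma pauli_strings_split:
  "(\<Sum>p\<in>pauli_strings n. g p) = (\<Sum>p\<in>{p\<in>pauli_strings n. pauli_weight p > k}. g p) +
     (\<Sum>p\<in>{p\<in>pauli_strings n. pauli_weight p \<le> k}. (g p :: real))"
proof -
  have "pauli_strings n = {p\<in>pauli_strings n. pauli_weight p > k} \<union> {p\<in>pauli_strings n. pauli_weight p \<le> k}" by auto
  then show ?thesis using card_pauli_strings(1)[of n]
    by (subst sum.union_disjoint[symmetric]) (auto simp: Un_def intro!: sum.cong)
qed

lemma high_norm_le_nfrob:
  assumes H: "is_hermitian D H" and K: "k_local n k K"
  shows "high_norm k H \<le> nfrob n (H - K)"
proof (rule power2_le_imp_le)
  have c: "H \<in> carrier_mat D D" "K \<in> carrier_mat D D"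
    using H K by (auto simp: is_hermitian_def k_local_def)
  obtain \<alpha> where \<alpha>: "\<And>i j. i < D \<Longrightarrow> j < D \<Longrightarrow> K $$ (i,j) = (\<Sum>p\<in>pauli_strings n. of_real (\<alpha> p) * pauli_mat p $$ (i,j))"
    "\<And>p. p \<in> pauli_strings n \<Longrightarrow> pauli_weight p > k \<Longrightarrow> \<alpha> p = 0"
    using K unfolding k_local_def by blast
  have "coeff K p = 0" if "p \<in> pauli_strings n" "pauli_weight p > k" for p
    using coeff_expansion[OF that(1) \<alpha>(1)] \<alpha>(2)[OF that] by simp
  then have "(high_norm k H)\<^sup>2 = (\<Sum>p\<in>{p\<in>pauli_strings n. pauli_weight p > k}. (cmod (coeff (H - K) p))\<^sup>2)"
    unfolding high_norm_power2 by (intro sum.cong refl) (simp add: coeff_diff c)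
  also have "\<dots> \<le> (nfrob n (H - K))\<^sup>2"
    unfolding nfrob_coeff using card_pauli_strings(1) by (intro sum_mono2) auto
  finally show "(high_norm k H)\<^sup>2 \<le> (nfrob n (H - K))\<^sup>2" .
qed (simp add: nfrob_def sum_nonneg)

text \<open>The minimiser deletes all high-weight terms of the expansion. Hermiticity of
  \<open>H\<close> makes the remaining coefficients real, as \<open>k_local\<close> demands.\<close>

lemma low_part:
  assumes H: "is_hermitian D H"
  obtains K where "k_local n k K" "nfrob n (H - K) = high_norm k H"
proof -
  define \<alpha> where "\<alpha> p = (if pauli_weight p > k then 0 else Re (coeff H p))" for p
  define K where "K = mat D D (\<lambda>(i,j). \<Sum>p\<in>pauli_strings n. complex_of_real (\<alpha> p) * pauli_mat p $$ (i,j))"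
  have Kc: "K \<in> carrier_mat D D" by (simp add: K_def)
  have Ke: "K $$ (i,j) = (\<Sum>p\<in>pauli_strings n. of_real (\<alpha> p) * pauli_mat p $$ (i,j))" if "i < D" "j < D" for i j
    using that by (simp add: K_def)
  have e: "cnj (pauli_mat p $$ (j,i)) = pauli_mat p $$ (i,j)" if "i < D" "j < D" "p \<in> pauli_strings n" for i j p
  proof -
    have "adj (pauli_mat p) = pauli_mat p" using that(3) by (auto simp: pauli_strings_def intro: adj_pauli_mat)
    then show ?thesis using adj_index[of i "pauli_mat p" j] that carrier_matD[OF pauli_carrier[OF that(3)]] by auto
  qed
  have "adj K = K"
  proof (rule eq_matI)
    fix i j assume "i < dim_row K" "j < dim_col K"
    then have ij: "i < D" "j < D" using Kc by auto
    then have "adj K $$ (i,j) = cnj (K $$ (j,i))" using Kc by (intro adj_index) auto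
    also have "\<dots> = K $$ (i,j)" using ij by (simp add: Ke e)
    finally show "adj K $$ (i,j) = K $$ (i,j)" .
  qed (use Kc in auto)
  then have "k_local n k K"
    unfolding k_local_def is_hermitian_def using Kc Ke by (intro conjI exI[of _ \<alpha>]) (auto simp: \<alpha>_def)
  moreover have "nfrob n (H - K) = high_norm k H"
  proof (rule power2_eq_imp_eq)
    have Hc: "H \<in> carrier_mat D D" using H by (simp add: is_hermitian_def)
    have cf: "coeff (H - K) p = (if pauli_weight p > k then coeff H p else 0)" if "p \<in> pauli_strings n" for p
      using coeff_expansion[OF that Ke] coeff_real[OF H that] by (simp add: coeff_diff Hc Kc \<alpha>_def)
    have "(nfrob n (H - K))\<^sup>2 = (\<Sum>p\<in>{p\<in>pauli_strings n. pauli_weight p > k}. (cmod (coeff (H - K) p))\<^sup>2) +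
       (\<Sum>p\<in>{p\<in>pauli_strings n. pauli_weight p \<le> k}. (cmod (coeff (H - K) p))\<^sup>2)"
      unfolding nfrob_coeff by (rule pauli_strings_split)
    also have "\<dots> = (high_norm k H)\<^sup>2" unfolding high_norm_power2 by (simp add: cf)
    finally show "(nfrob n (H - K))\<^sup>2 = (high_norm k H)\<^sup>2" .
  qed (simp_all add: nfrob_def high_norm_def sum_nonneg)
  ultimately show ?thesis by (rule that)
qed

text \<open>The infimum is attained: \<open>low_part\<close> provides a minimiser, and
  \<open>high_norm_le_nfrob\<close> is the matching lower bound by Parseval.\<close>

lemma dist_k_local_eq:
  assumes H: "is_hermitian D H"
  shows "dist_k_local n k H = high_norm k H"
proof -
  obtain K where K: "k_local n k K" "nfrob n (H - K) = high_norm k H" using low_part[OF H] .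
  show ?thesis unfolding dist_k_local_def
  proof (rule cInf_eq_minimum)
    show "high_norm k H \<in> (\<lambda>K. nfrob n (H - K)) ` {K. k_local n k K}" using K by (auto intro: rev_image_eqI)
  qed (use high_norm_le_nfrob[OF H] in auto)
qed

section \<open>The maximally entangled state and left multiplication in Pauli coordinates\<close>

text \<open>Index 0 belongs to the identity string, so the preimage of the first Pauli coordinate is
  the normalised flattened identity, which is the maximally entangled state.\<close>

lemma adj_W_zero: "adj W *\<^sub>v unit_vec (D * D) 0 = (1 / of_real (sqrt D)) \<cdot>\<^sub>v flat (1\<^sub>m D)"
proof (rule eq_vecI)
  fix i assume "i < dim_vec ((1 / complex_of_real (sqrt D)) \<cdot>\<^sub>v flat (1\<^sub>m D))"
  then have i: "i < D * D" by (simp add: flat_def)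
  have "(adj W *\<^sub>v unit_vec (D * D) 0) $ i = adj W $$ (i, 0)"
    using i carrier_matD[OF W_carrier] by (subst mult_vec_entry) (auto simp: if_distrib cong: if_cong)
  also have "\<dots> = 1\<^sub>m D $$ (i div D, i mod D) / of_real (sqrt D)"
    using i carrier_matD[OF W_carrier] div_mod_less[OF i] by (simp add: W_def f0 pauli_mat_identity)
  finally show "(adj W *\<^sub>v unit_vec (D * D) 0) $ i = ((1 / of_real (sqrt D)) \<cdot>\<^sub>v flat (1\<^sub>m D)) $ i"
    using i by (simp add: flat_def)
qed (use carrier_matD[OF W_carrier] in \<open>simp add: flat_def\<close>)

lemma kron_flat: "A \<in> carrier_mat D D \<Longrightarrow> kron A (1\<^sub>m D) *\<^sub>v flat (1\<^sub>m D) = flat A"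
proof (rule eq_vecI)
  assume A: "A \<in> carrier_mat D D"
  then show "dim_vec (kron A (1\<^sub>m D) *\<^sub>v flat (1\<^sub>m D)) = dim_vec (flat A)" by (simp add: flat_def)
  fix i assume "i < dim_vec (flat A)"
  then have i: "i < D * D" by (simp add: flat_def)
  note i' = div_mod_less[OF i]
  have "(kron A (1\<^sub>m D) *\<^sub>v flat (1\<^sub>m D)) $ i = ap (D * D) (kern (kron A (1\<^sub>m D))) (\<lambda>i. 1\<^sub>m D $$ (i div D, i mod D)) (i div D * D + i mod D)"
    unfolding flat_def div_mult_mod_eq by (rule mult_vec_ap) (use A i in auto)
  also have "\<dots> = ap D (kern A) (\<lambda>x. 1\<^sub>m D $$ ((x * D + i mod D) div D, (x * D + i mod D) mod D)) (i div D)"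
    by (rule ap_kron_one[OF A i'])
  also have "\<dots> = (\<Sum>x<D. if x = i mod D then A $$ (i div D, x) else 0)"
    unfolding ap_def using i' by (intro sum.cong refl) (auto simp: kern_def)
  also have "\<dots> = flat A $ i" using i i' by (simp add: flat_def)
  finally show "(kron A (1\<^sub>m D) *\<^sub>v flat (1\<^sub>m D)) $ i = flat A $ i" .
qed

text \<open>Left multiplication by \<open>A\<close>, expressed in Pauli coordinates.\<close>

definition rot :: "complex mat \<Rightarrow> complex mat" where
  "rot A = W * (kron A (1\<^sub>m D) * adj W)"

lemma rot_carrier [simp]: "A \<in> carrier_mat D D \<Longrightarrow> rot A \<in> carrier_mat (D * D) (D * D)"
  unfolding rot_def by (intro mult_carrier_mat[of _ _ "D * D"]) auto

lemma ap_rot: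
  assumes "A \<in> carrier_mat D D" "i < D * D"
  shows "ap (D * D) (kern (rot A)) g i = ap (D * D) (kern W) (ap (D * D) (kern (kron A (1\<^sub>m D))) (ap (D * D) (kern (adj W)) g)) i"
proof -
  have c: "kron A (1\<^sub>m D) \<in> carrier_mat (D * D) (D * D)" "adj W \<in> carrier_mat (D * D) (D * D)"
    using assms by auto
  show ?thesis unfolding rot_def
    apply (subst ap_kern_mult[OF W_carrier _ assms(2)])
     apply (use c in simp)
    apply (rule ap_cong)
    apply (rule ap_kern_mult[OF c])
    apply assumption
    done
qed

lemma nrm_rot:
  assumes "A \<in> carrier_mat D D"
  shows "nrm {..<D * D} (ap (D * D) (kern (rot A)) g) =
    nrm {..<D * D} (ap (D * D) (kern (kron A (1\<^sub>m D))) (ap (D * D) (kern (adj W)) g))"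
proof -
  have "nrm {..<D * D} (ap (D * D) (kern (rot A)) g) =
     nrm {..<D * D} (ap (D * D) (kern W) (ap (D * D) (kern (kron A (1\<^sub>m D))) (ap (D * D) (kern (adj W)) g)))"
    using assms by (intro nrm_cong ap_rot) auto
  then show ?thesis by (simp only: nrm_unitary[OF W_unitary])
qed

text \<open>Acting on one half of the maximally entangled state writes the operator itself into the
  state (\<open>kron_flat\<close>), and \<open>W\<close> then reads off its Pauli coefficients. This
  links \<open>h\<close> in the abstract analysis to the distance.\<close>

lemma rot_column: "A \<in> carrier_mat D D \<Longrightarrow> i < D * D \<Longrightarrow> kern (rot A) i 0 = coeff A (f i)"
proof -
  assume A: "A \<in> carrier_mat D D" and i: "i < D * D"
  have c: "kron A (1\<^sub>m D) \<in> carrier_mat (D * D) (D * D)" "adj W \<in> carrier_mat (D * D) (D * D)"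
    using A by auto
  let ?r = "1 / complex_of_real (sqrt D)"
  have "kern (rot A) i 0 = (rot A *\<^sub>v unit_vec (D * D) 0) $ i"
    using i carrier_matD[OF rot_carrier[OF A]]
    by (subst mult_vec_entry) (auto simp: kern_def if_distrib cong: if_cong)
  also have "rot A *\<^sub>v unit_vec (D * D) 0 = W *\<^sub>v (kron A (1\<^sub>m D) *\<^sub>v (adj W *\<^sub>v unit_vec (D * D) 0))"
    unfolding rot_def using c
    by (subst assoc_mult_mat_vec[OF W_carrier mult_carrier_mat[OF c]], simp)
       (subst assoc_mult_mat_vec[OF c], simp_all)
  also have "\<dots> = ?r \<cdot>\<^sub>v (W *\<^sub>v flat A)"
    unfolding adj_W_zero using c A
    by (simp add: mult_mat_vec[OF c(1) flat_carrier] kron_flat mult_mat_vec[OF W_carrier flat_carrier])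
  also have "\<dots> $ i = coeff A (f i)"
    using i W_flat[OF i, of A] carrier_matD[OF W_carrier] by (simp del: index_mult_mat_vec)
  finally show ?thesis .
qed

end

lemma pauli_basis_exists: "\<exists>f. pauli_basis n f"
proof -
  have "replicate n 0 \<in> pauli_strings n" by (auto simp: pauli_strings_def)
  from bij_betw_initial[OF card_pauli_strings(1) this]
  show ?thesis by (auto simp: pauli_basis_def card_pauli_strings)
qed

section \<open>Composing and repeating algorithms\<close>

abbreviation query_step :: "nat \<Rightarrow> complex mat \<Rightarrow> real \<times> complex mat \<Rightarrow> complex vec \<Rightarrow> complex vec" where
  "query_step a H \<equiv> (\<lambda>(t, V) \<psi>. V *\<^sub>v (kron (time_evol H t) (1\<^sub>m (2^a)) *\<^sub>v \<psi>))"

lemma time_evol_carrier: "H \<in> carrier_mat d d \<Longrightarrow> time_evol H t \<in> carrier_mat d d"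
  by (intro carrier_matI) (auto simp: time_evol_def mexp_def)

lemma fold_query_carrier:
  assumes "H \<in> carrier_mat (2^n) (2^n)" "\<forall>(t,V)\<in>set l. V \<in> carrier_mat (2^n * 2^a) (2^n * 2^a)"
    "v \<in> carrier_vec (2^n * 2^a)"
  shows "fold (query_step a H) l v \<in> carrier_vec (2^n * 2^a)"
  using assms(2,3)
proof (induction l arbitrary: v)
  case (Cons x l)
  obtain t V where x: "x = (t,V)" by (cases x)
  have "V \<in> carrier_mat (2^n * 2^a) (2^n * 2^a)" using Cons.prems x by auto
  then have "query_step a H x v \<in> carrier_vec (2^n * 2^a)"
    by (simp add: x carrier_vecI)
  then show ?case using Cons by simp
qed simp

text \<open>A second register \<open>w\<close> is a mere spectator if it is counted among the
  ancillas. A run can thus be embedded in a larger circuit.\<close>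

lemma fold_query_lift:
  assumes H: "H \<in> carrier_mat (2^n) (2^n)"
    and "\<forall>(t,V)\<in>set l. V \<in> carrier_mat (2^n * 2^a) (2^n * 2^a)"
    "v \<in> carrier_vec (2^n * 2^a)" and w: "w \<in> carrier_vec (2^e)"
  shows "fold (query_step (a + e) H) (map (\<lambda>(t,V). (t, kron V (1\<^sub>m (2^e)))) l) (kronv v w) =
    kronv (fold (query_step a H) l v) w"
  using assms(2,3)
proof (induction l arbitrary: v)
  case (Cons x l)
  obtain t V where x: "x = (t,V)" by (cases x)
  have V: "V \<in> carrier_mat (2^n * 2^a) (2^n * 2^a)" using Cons.prems x by auto
  have K: "kron (time_evol H t) (1\<^sub>m (2^a)) \<in> carrier_mat (2^n * 2^a) (2^n * 2^a)"
    using H by (simp add: time_evol_carrier)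
  let ?u = "kron (time_evol H t) (1\<^sub>m (2^a)) *\<^sub>v v"
  have u: "?u \<in> carrier_vec (2^n * 2^a)" using K Cons.prems by simp
  have 1: "kron (time_evol H t) (1\<^sub>m (2^(a + e))) *\<^sub>v kronv v w = kronv ?u w"
    unfolding power_add kron_kron_one using K Cons.prems w
    by (subst kron_mult_kronv) auto
  have "query_step (a + e) H (t, kron V (1\<^sub>m (2^e))) (kronv v w) = kronv (query_step a H x v) w"
    unfolding x prod.case 1 using V u w by (subst kron_mult_kronv) auto
  moreover have "query_step a H x v \<in> carrier_vec (2^n * 2^a)" using V u by (simp add: x carrier_vecI)
  ultimately show ?case using Cons by (simp add: x)
qed simp

text \<open>Queries and unitaries must alternate, so at the junction of two circuits an extra
  unitary \<open>X\<close> cannot be a separate list entry; it is merged into the last unitary of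
  the first circuit.\<close>

lemma fold_last_mult:
  assumes "length Vs = Suc (length ts)" "\<forall>V\<in>set Vs. V \<in> carrier_mat d d" "d = 2^n * 2^a"
    "X \<in> carrier_mat d d" "H \<in> carrier_mat (2^n) (2^n)" "v \<in> carrier_vec d"
  shows "fold (query_step a H) (zip ts (tl (butlast Vs @ [X * last Vs]))) (hd (butlast Vs @ [X * last Vs]) *\<^sub>v v) =
    X *\<^sub>v fold (query_step a H) (zip ts (tl Vs)) (hd Vs *\<^sub>v v)"
proof (cases ts rule: rev_exhaust)
  case Nil
  then obtain V where "Vs = [V]" using assms(1) by (cases Vs) auto
  then show ?thesis using Nil assms by simp
next
  case (snoc ts' t)
  then obtain V0 Ws where Vs: "Vs = V0 # Ws" "length Ws = Suc (length ts')" using assms(1) by (cases Vs) auto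
  then obtain Us V where Ws: "Ws = Us @ [V]" "length Us = length ts'" by (cases Ws rule: rev_exhaust) auto
  let ?\<psi> = "fold (query_step a H) (zip ts' Us) (V0 *\<^sub>v v)"
  have V: "V \<in> carrier_mat d d" "V0 \<in> carrier_mat d d" using assms Vs Ws by auto
  have "?\<psi> \<in> carrier_vec d"
    unfolding assms(3) using assms Vs Ws
    by (intro fold_query_carrier) (auto dest!: set_zip_rightD intro!: mult_mat_vec_carrier)
  then have "kron (time_evol H t) (1\<^sub>m (2^a)) *\<^sub>v ?\<psi> \<in> carrier_vec d"
    using assms by (intro mult_mat_vec_carrier[of _ d d]) (auto intro!: kron_carrier time_evol_carrier)
  then show ?thesis using V assms by (simp add: snoc Vs Ws assoc_mult_mat_vec[of X d d V d])
qed

text \<open>Queries always act on the leading \<open>n\<close> qubits, so the registers are swapped between the two runs.\<close>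

lemma compose_algs:
  assumes A: "valid_qalg n A" and B: "valid_qalg n B"
  shows "\<exists>C. valid_qalg n C \<and> anc C = anc A + (n + anc B) \<and> times C = times A @ times B \<and>
    (\<forall>H\<in>carrier_mat (2^n) (2^n). final_state n C H = kronv (final_state n B H) (final_state n A H))"
proof -
  define a b p q where "a = anc A" and "b = anc B" and "p = (2::nat)^(n + a)" and "q = (2::nat)^(n + b)"
  have pq: "2^(n + (a + (n + b))) = p * q" by (simp add: p_def q_def power_add mult_ac)
  have p: "p = 2^n * 2^a" and q: "q = 2^n * 2^b" by (simp_all add: p_def q_def power_add)
  have uA: "\<And>V. V \<in> set (unis A) \<Longrightarrow> is_unitary p V" and lA: "length (unis A) = Suc (length (times A))"
    using A by (auto simp: valid_qalg_def p_def a_def)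
  have uB: "\<And>V. V \<in> set (unis B) \<Longrightarrow> is_unitary q V" and lB: "length (unis B) = Suc (length (times B))"
    using B by (auto simp: valid_qalg_def q_def b_def)
  define L where "L = map (\<lambda>V. kron V (1\<^sub>m q)) (unis A)"
  \<comment> \<open>The junction: exchange the registers so that the fresh one comes to the front,
    then apply the initial unitary of \<open>B\<close> to it.\<close>
  define X where "X = kron (hd (unis B)) (1\<^sub>m p) * swap_mat p q"
  define M where "M = map (\<lambda>V. kron V (1\<^sub>m p)) (tl (unis B))"
  define L' where "L' = butlast L @ [X * last L]"
  define C where "C = \<lparr>anc = a + (n + b), times = times A @ times B, unis = L' @ M, acc = {}\<rparr>"
  have ne: "unis A \<noteq> []" "unis B \<noteq> []" "L \<noteq> []" "L' \<noteq> []" using lA lB by (auto simp: L_def L'_def)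
  have hB: "is_unitary q (hd (unis B))" using uB ne by simp
  have uX: "is_unitary (p * q) X" unfolding X_def
    using is_unitary_kron[OF hB is_unitary_one[of p]] swap_mat_unitary[of p q]
    by (intro is_unitary_mult) (simp_all add: mult.commute)
  have uL: "\<forall>V\<in>set L. is_unitary (p * q) V" unfolding L_def using uA by (auto intro: is_unitary_kron)
  have uBp: "is_unitary (p * q) (kron V (1\<^sub>m p))" if "V \<in> set (unis B)" for V
    using is_unitary_kron[OF uB[OF that] is_unitary_one[of p]] by (simp add: mult.commute)
  have uM: "\<forall>V\<in>set M. is_unitary (p * q) V" unfolding M_def
    using ne uBp by (auto dest: list.set_sel(2))
  have uL': "\<forall>V\<in>set L'. is_unitary (p * q) V" unfolding L'_def
    using uL uX ne by (auto dest: in_set_butlastD intro: is_unitary_mult)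
  have lL': "length L' = Suc (length (times A))" using lA ne by (simp add: L'_def L_def)
  have "valid_qalg n C"
    using A B uM uL' lL' lB pq by (auto simp: valid_qalg_def C_def M_def)
  moreover have "final_state n C H = kronv (final_state n B H) (final_state n A H)"
    if H: "H \<in> carrier_mat (2^n) (2^n)" for H
  proof -
    define \<psi>A where "\<psi>A = final_state n A H"
    let ?zA = "zip (times A) (tl (unis A))" and ?zB = "zip (times B) (tl (unis B))"
    have cA: "\<forall>(t,V)\<in>set ?zA. V \<in> carrier_mat (2^n * 2^a) (2^n * 2^a)"
      using uA ne by (auto dest!: set_zip_rightD list.set_sel(2) simp: p[symmetric] is_unitary_def)
    have cB: "\<forall>(t,V)\<in>set ?zB. V \<in> carrier_mat (2^n * 2^b) (2^n * 2^b)"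
      using uB ne by (auto dest!: set_zip_rightD list.set_sel(2) simp: q[symmetric] is_unitary_def)
    have hA: "hd (unis A) \<in> carrier_mat p p" using uA ne by (auto intro: is_unitary_carrier)
    have hB': "hd (unis B) \<in> carrier_mat q q" using hB by (rule is_unitary_carrier)
    have iA: "hd (unis A) *\<^sub>v unit_vec p 0 \<in> carrier_vec (2^n * 2^a)" using hA p by auto
    have iB: "hd (unis B) *\<^sub>v unit_vec q 0 \<in> carrier_vec (2^n * 2^b)" using hB' q by auto
    have \<psi>Ac: "\<psi>A \<in> carrier_vec p"
      using fold_query_carrier[OF H cA iA] by (simp add: \<psi>A_def final_state_def a_def p_def power_add)
    have zL: "zip (times A) (tl L) = map (\<lambda>(t,V). (t, kron V (1\<^sub>m (2^(n + b))))) ?zA"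
      by (simp add: L_def q_def zip_map2 map_tl[symmetric])
    have zM: "zip (times B) M = map (\<lambda>(t,V). (t, kron V (1\<^sub>m (2^(n + a))))) ?zB"
      by (simp add: M_def p_def zip_map2)
    have hL: "hd L *\<^sub>v unit_vec (p * q) 0 = kronv (hd (unis A) *\<^sub>v unit_vec p 0) (unit_vec q 0)"
    proof -
      have "unit_vec (p * q) 0 = kronv (unit_vec p 0) (unit_vec q 0)"
        by (rule kronv_unit[symmetric]) (simp_all add: p_def q_def)
      then show ?thesis using ne by (simp add: L_def hd_map
          kron_mult_kronv[OF hA unit_vec_carrier one_carrier_mat unit_vec_carrier])
    qed
    have "final_state n C H = fold (query_step (a + (n + b)) H)
       (zip (times A) (tl L') @ zip (times B) M) (hd L' *\<^sub>v unit_vec (p * q) 0)"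
      using ne lL' by (simp add: final_state_def C_def pq zip_append1[symmetric] zip_append)
    also have "\<dots> = fold (query_step (a + (n + b)) H) (zip (times B) M)
       (X *\<^sub>v fold (query_step (a + (n + b)) H) (zip (times A) (tl L)) (hd L *\<^sub>v unit_vec (p * q) 0))"
      unfolding fold_append o_apply L'_def
    proof (subst fold_last_mult[where d = "p * q" and n = n])
      show "p * q = 2 ^ n * 2 ^ (a + (n + b))" using pq by (simp add: power_add)
      show "length L = Suc (length (times A))" using lA by (simp add: L_def)
      show "\<forall>V\<in>set L. V \<in> carrier_mat (p * q) (p * q)" "X \<in> carrier_mat (p * q) (p * q)"
        using uL uX by (auto intro: is_unitary_carrier)
    qed (use H in auto)
    also have "fold (query_step (a + (n + b)) H) (zip (times A) (tl L)) (hd L *\<^sub>v unit_vec (p * q) 0)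
       = kronv \<psi>A (unit_vec q 0)"
      unfolding zL hL by (subst fold_query_lift[OF H cA iA]) (simp_all add: \<psi>A_def final_state_def a_def p_def q_def)
    also have "X *\<^sub>v kronv \<psi>A (unit_vec q 0) = kronv (hd (unis B) *\<^sub>v unit_vec q 0) \<psi>A"
    proof -
      have "X *\<^sub>v kronv \<psi>A (unit_vec q 0) = kron (hd (unis B)) (1\<^sub>m p) *\<^sub>v (swap_mat p q *\<^sub>v kronv \<psi>A (unit_vec q 0))"
        unfolding X_def using \<psi>Ac kron_carrier[OF hB', of "1\<^sub>m p" p p]
        by (intro assoc_mult_mat_vec[of _ "p * q" "p * q" _ "p * q"]) (auto simp: mult.commute)
      then show ?thesis using \<psi>Ac
        by (simp add: swap_mat_kronv kron_mult_kronv[OF hB' unit_vec_carrier one_carrier_mat \<psi>Ac])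
    qed
    also have "fold (query_step (a + (n + b)) H) (zip (times B) M) (kronv (hd (unis B) *\<^sub>v unit_vec q 0) \<psi>A)
       = kronv (final_state n B H) \<psi>A"
    proof -
      \<comment> \<open>For the second run the spectators are the \<open>n + a\<close> qubits of the
        first run.\<close>
      have ab: "a + (n + b) = b + (n + a)" by simp
      show ?thesis unfolding zM ab
        by (subst fold_query_lift[OF H cB iB]) (use \<psi>Ac in \<open>simp_all add: final_state_def b_def q_def p_def\<close>)
    qed
    finally show ?thesis by (simp add: \<psi>A_def)
  qed
  ultimately show ?thesis by (intro exI[of _ C]) (simp add: C_def a_def b_def)
qed

section \<open>Tensor powers and a Chernoff bound for the number of hits\<close>

primrec kpow :: "complex vec \<Rightarrow> nat \<Rightarrow> complex vec" where
  "kpow v 0 = vec 1 (\<lambda>_. 1)"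
| "kpow v (Suc N) = kronv v (kpow v N)"

lemma kpow_dim [simp]: "dim_vec (kpow v N) = dim_vec v ^ N"
  by (induction N) auto

text \<open>Measurement happens only at the end, so each run keeps its own register. The induction
  starts at \<open>N = 1\<close>, since \<open>N = 0\<close> would require a register of dimension
  1, impossible for positive \<open>n\<close>. Each new run stands in front in the product state, as
  in \<open>kpow\<close>.\<close>

lemma repeat_alg:
  assumes A: "valid_qalg n A" and N: "0 < N"
  shows "\<exists>C. valid_qalg n C \<and> num_queries C = N * num_queries A \<and> total_time C = N * total_time A \<and>
    2^(n + anc C) = (2^(n + anc A) :: nat) ^ N \<and>
    (\<forall>H\<in>carrier_mat (2^n) (2^n). final_state n C H = kpow (final_state n A H) N)"
  using N
proof (induction N rule: nat_induct_non_zero)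
  case 1
  have "kronv v (vec 1 (\<lambda>_. 1)) = v" for v by (rule eq_vecI) auto
  then show ?case using A by (intro exI[of _ A]) auto
next
  case (Suc N)
  then obtain C where C: "valid_qalg n C" "num_queries C = N * num_queries A" "total_time C = N * total_time A"
    "2^(n + anc C) = (2^(n + anc A) :: nat) ^ N"
    "\<And>H. H \<in> carrier_mat (2^n) (2^n) \<Longrightarrow> final_state n C H = kpow (final_state n A H) N" by auto
  obtain E where E: "valid_qalg n E" "anc E = anc C + (n + anc A)" "times E = times C @ times A"
    "\<And>H. H \<in> carrier_mat (2^n) (2^n) \<Longrightarrow> final_state n E H = kronv (final_state n A H) (final_state n C H)"
    using compose_algs[OF C(1) A] by auto
  have "2 ^ (n + anc E) = (2^(n + anc C) :: nat) * 2^(n + anc A)" by (simp add: E power_add)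
  then show ?case using C E
    by (intro exI[of _ E]) (auto simp: num_queries_def total_time_def algebra_simps)
qed

text \<open>The outcome \<open>i\<close> of \<open>N\<close> registers is a number with
  \<open>N\<close> digits in base \<open>d\<close>. What is counted is the digits in
  \<open>I\<close>, that is, the runs with outcome in \<open>I\<close>.\<close>

primrec cnt :: "nat \<Rightarrow> nat set \<Rightarrow> nat \<Rightarrow> nat \<Rightarrow> nat" where
  "cnt d I 0 i = 0"
| "cnt d I (Suc N) i = (if i div d ^ N \<in> I then 1 else 0) + cnt d I N (i mod d ^ N)"

text \<open>Outcome probabilities of a tensor power are products, so the generating function of the
  count is the \<open>N\<close>-th power of that of one run.\<close>

lemma cnt_generating:
  assumes "dim_vec v = d"
  shows "(\<Sum>i<d ^ N. z ^ cnt d I N i * (cmod (kpow v N $ i))\<^sup>2) =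
    (\<Sum>x<d. (if x \<in> I then z else 1) * (cmod (v $ x))\<^sup>2) ^ N"
proof (induction N)
  case (Suc N)
  let ?q = "d ^ N"
  have "(\<Sum>i<d ^ Suc N. z ^ cnt d I (Suc N) i * (cmod (kpow v (Suc N) $ i))\<^sup>2) =
     (\<Sum>i<d * ?q. ((if i div ?q \<in> I then z else 1) * (cmod (v $ (i div ?q)))\<^sup>2) *
        (z ^ cnt d I N (i mod ?q) * (cmod (kpow v N $ (i mod ?q)))\<^sup>2))"
    using assms by (intro sum.cong) (auto simp: norm_mult power_mult_distrib)
  also have "\<dots> = (\<Sum>x<d. \<Sum>y<?q. ((if x \<in> I then z else 1) * (cmod (v $ x))\<^sup>2) *
        (z ^ cnt d I N y * (cmod (kpow v N $ y))\<^sup>2))"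
    by (rule sum_div_mod[of "\<lambda>x y. ((if x \<in> I then z else 1) * (cmod (v $ x))\<^sup>2) *
        (z ^ cnt d I N y * (cmod (kpow v N $ y))\<^sup>2)"])
  also have "\<dots> = (\<Sum>x<d. (if x \<in> I then z else 1) * (cmod (v $ x))\<^sup>2) *
      (\<Sum>y<?q. z ^ cnt d I N y * (cmod (kpow v N $ y))\<^sup>2)"
    by (rule sum_product[symmetric])
  finally show ?case by (simp add: Suc)
qed simp

text \<open>The Chernoff argument for both tails at once: the sign condition on \<open>J\<close>
  means counts above the threshold if \<open>z > 1\<close> and below it if \<open>z < 1\<close>. The
  only other estimate is that \<open>1 + y\<close> is at most \<open>exp y\<close>.\<close>

lemma cnt_exponential_markov:
  fixes z \<theta> :: real
  assumes v: "dim_vec v = d" "nrm {..<d} (($) v) = 1" and I: "I \<subseteq> {..<d}" and z: "0 < z"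
    and J: "J \<subseteq> {..<d ^ N}" "\<And>i. i \<in> J \<Longrightarrow> 0 \<le> (real (cnt d I N i) - N * \<theta>) * ln z"
  shows "(\<Sum>i\<in>J. (cmod (kpow v N $ i))\<^sup>2) \<le> exp (N * ((z - 1) * (nrm I (($) v))\<^sup>2 - \<theta> * ln z))"
proof -
  let ?p = "(nrm I (($) v))\<^sup>2"
  have zc: "z ^ c * exp (- (N * \<theta>) * ln z) = exp ((real c - N * \<theta>) * ln z)" for c
  proof -
    have "z ^ c = exp (real c * ln z)" using z by (simp add: exp_of_nat_mult)
    then show ?thesis by (simp add: exp_add[symmetric] algebra_simps)
  qed
  have S: "(\<Sum>x<d. (if x \<in> I then z else 1) * (cmod (v $ x))\<^sup>2) = 1 + (z - 1) * ?p"
  proof -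
    have "(\<Sum>x<d. (if x \<in> I then z else 1) * (cmod (v $ x))\<^sup>2) =
      (\<Sum>x<d. (cmod (v $ x))\<^sup>2 + (z - 1) * (cmod (if x \<in> I then v $ x else 0))\<^sup>2)"
      by (intro sum.cong) (auto simp: algebra_simps)
    also have "\<dots> = (nrm {..<d} (($) v))\<^sup>2 + (z - 1) * (nrm {..<d} (\<lambda>x. if x \<in> I then v $ x else 0))\<^sup>2"
      by (simp add: nrm_power2 sum.distrib sum_distrib_left)
    finally show ?thesis using v I by (simp add: nrm_restrict)
  qed
  have "(\<Sum>i\<in>J. (cmod (kpow v N $ i))\<^sup>2) \<le> (\<Sum>i\<in>J. exp (- (N * \<theta>) * ln z) * (z ^ cnt d I N i * (cmod (kpow v N $ i))\<^sup>2))"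
  proof (rule sum_mono)
    fix i assume "i \<in> J"
    then have "1 \<le> z ^ cnt d I N i * exp (- (N * \<theta>) * ln z)" unfolding zc using J(2) by simp
    then have "1 * (cmod (kpow v N $ i))\<^sup>2 \<le> (z ^ cnt d I N i * exp (- (N * \<theta>) * ln z)) * (cmod (kpow v N $ i))\<^sup>2"
      by (intro mult_right_mono) auto
    then show "(cmod (kpow v N $ i))\<^sup>2 \<le> exp (- (N * \<theta>) * ln z) * (z ^ cnt d I N i * (cmod (kpow v N $ i))\<^sup>2)"
      by (simp add: mult_ac)
  qed
  also have "\<dots> \<le> (\<Sum>i<d ^ N. exp (- (N * \<theta>) * ln z) * (z ^ cnt d I N i * (cmod (kpow v N $ i))\<^sup>2))"
    using J(1) z by (intro sum_mono2) auto
  also have "\<dots> = exp (- (N * \<theta>) * ln z) * (1 + (z - 1) * ?p) ^ N"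
    by (simp only: sum_distrib_left[symmetric] cnt_generating[OF v(1)] S)
  also have "(1 + (z - 1) * ?p) ^ N \<le> exp ((z - 1) * ?p) ^ N"
  proof (rule power_mono)
    have "0 \<le> (\<Sum>x<d. (if x \<in> I then z else 1) * (cmod (v $ x))\<^sup>2)" using z by (intro sum_nonneg) auto
    then show "0 \<le> 1 + (z - 1) * ?p" by (simp only: S)
  qed (rule exp_ge_add_one_self)
  also have "exp (- (N * \<theta>) * ln z) * exp ((z - 1) * ?p) ^ N = exp (N * ((z - 1) * ?p - \<theta> * ln z))"
    by (simp add: exp_of_nat_mult[symmetric] exp_add[symmetric] algebra_simps)
  finally show ?thesis by simp
qed

lemma cnt_total:
  assumes "dim_vec v = d" "nrm {..<d} (($) v) = 1"
  shows "(\<Sum>i<d ^ N. (cmod (kpow v N $ i))\<^sup>2) = 1"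
  using cnt_generating[OF assms(1), of 1 "{}" N] assms(2) nrm_power2[of "{..<d}" "($) v"] by simp

section \<open>The interleaved circuit and its amplitude\<close>

context pauli_basis
begin

definition refl_mat :: "nat \<Rightarrow> complex mat" where
  "refl_mat k = mat (D * D) (D * D) (\<lambda>(i,j). if i = j then (if i = 0 \<or> i \<in> high k then 1 else -1) else 0)"

lemma refl_carrier [simp]: "refl_mat k \<in> carrier_mat (D * D) (D * D)"
  by (simp add: refl_mat_def)

lemma refl_vec: "i < D * D \<Longrightarrow> v \<in> carrier_vec (D * D) \<Longrightarrow>
  (refl_mat k *\<^sub>v v) $ i = (if i = 0 \<or> i \<in> high k then 1 else -1) * v $ i"
  using carrier_matD[OF refl_carrier]
  by (subst mult_vec_entry) (auto simp: refl_mat_def if_distrib[of "\<lambda>x. x * _"] cong: if_cong)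

lemma refl_unitary: "is_unitary (D * D) (refl_mat k)"
proof -
  have "adj (refl_mat k) * refl_mat k = 1\<^sub>m (D * D)"
  proof (rule eq_matI)
    fix i j assume "i < dim_row (1\<^sub>m (D * D) :: complex mat)" "j < dim_col (1\<^sub>m (D * D) :: complex mat)"
    then have ij: "i < D * D" "j < D * D" by auto
    have "(adj (refl_mat k) * refl_mat k) $$ (i,j) = (\<Sum>l<D*D. cnj (refl_mat k $$ (l,i)) * refl_mat k $$ (l,j))"
      using ij carrier_matD[OF refl_carrier] by (subst mult_entry) auto
    also have "\<dots> = (\<Sum>l<D*D. if l = i then (if i = j then 1 else 0) else 0)"
      using ij by (intro sum.cong refl) (auto simp: refl_mat_def)
    also have "\<dots> = 1\<^sub>m (D * D) $$ (i,j)" using ij by simp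
    finally show "(adj (refl_mat k) * refl_mat k) $$ (i,j) = 1\<^sub>m (D * D) $$ (i,j)" .
  qed (use carrier_matD[OF refl_carrier] in auto)
  then show ?thesis by (simp add: is_unitary_def)
qed

text \<open>One run has \<open>m + 1\<close> queries. The last unitary omits the return by
  \<open>adj W\<close>, so the final measurement is in Pauli coordinates. The accepting set is a
  placeholder, as the decision is made only on the repeated circuit.\<close>

definition run_alg :: "nat \<Rightarrow> real \<Rightarrow> nat \<Rightarrow> qalg" where
  "run_alg k \<tau> m = \<lparr>anc = n, times = replicate m \<tau> @ [\<tau>],
     unis = adj W # replicate m (adj W * (refl_mat k * W)) @ [refl_mat k * W], acc = {}\<rparr>"

lemma run_alg_valid: "0 \<le> \<tau> \<Longrightarrow> valid_qalg n (run_alg k \<tau> m)"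
  using adj_W_unitary W_unitary refl_unitary[of k]
  by (auto simp: valid_qalg_def run_alg_def power_add intro!: is_unitary_mult)

text \<open>Conjugation by the unitary \<open>W\<close> preserves norms, and
  \<open>nrm_lift_le\<close> removes the reference register. What remains are the bounds for
  \<open>H\<close> and its evolution on \<open>n\<close> qubits.\<close>

lemma zeno_hamiltonian:
  assumes H: "hamiltonian n H" and \<tau>: "0 \<le> \<tau>" "\<tau> \<le> 1"
  shows "zeno (D * D) (high k) (kern (rot H)) (kern (rot (time_evol H \<tau>))) \<tau>"
proof -
  interpret bounded_hermitian D H by (rule hamiltonian_bounded_hermitian[OF H])
  let ?d = "D * D" and ?U = "time_evol H \<tau>"
  have Wn: "nrm {..<?d} (ap ?d (kern (adj W)) g) = nrm {..<?d} g" for g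
    by (rule nrm_unitary[OF adj_W_unitary])
  show ?thesis
  proof
    show "0 < ?d" by simp
    show "high k \<subseteq> {..<?d}" "0 \<notin> high k" by (rule high_zero)+
    show "0 \<le> \<tau>" "\<tau> \<le> 1" using \<tau> .
    fix i j assume ij: "i < ?d" "j < ?d"
    have "adj (rot H) = rot H"
    proof -
      have K: "kron H (1\<^sub>m D) \<in> carrier_mat ?d ?d" by simp
      have "adj (rot H) = adj (kron H (1\<^sub>m D) * adj W) * adj W"
        unfolding rot_def by (simp add: adj_mult[OF W_carrier mult_carrier_mat[OF K adj_carrier[OF W_carrier]]])
      also have "adj (kron H (1\<^sub>m D) * adj W) = W * kron H (1\<^sub>m D)"
        using adj_mult[OF K adj_carrier[OF W_carrier]] herm by (simp add: kron_adj is_hermitian_def)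
      also have "W * kron H (1\<^sub>m D) * adj W = rot H"
        unfolding rot_def by (rule assoc_mult_mat[OF W_carrier K adj_carrier[OF W_carrier]])
      finally show ?thesis .
    qed
    then show "kern (rot H) j i = cnj (kern (rot H) i j)"
      using ij carrier_matD[OF rot_carrier[OF Hc]] adj_index[of j "rot H" i] by (simp add: kern_def)
  next
    fix f
    have "nrm {..<?d} (ap ?d (kern (kron H (1\<^sub>m D))) g) \<le> 1 * nrm {..<?d} g" for g
    proof (rule nrm_lift_le)
      fix y :: nat assume y: "y < D"
      have "nrm {..<D} (\<lambda>x. ap ?d (kern (kron H (1\<^sub>m D))) g (x * D + y)) = nrm {..<D} (ap D (kern H) (\<lambda>x. g (x * D + y)))"
        using y by (intro nrm_cong) (simp add: ap_kron_one)
      then show "nrm {..<D} (\<lambda>x. ap ?d (kern (kron H (1\<^sub>m D))) g (x * D + y)) \<le> 1 * nrm {..<D} (\<lambda>x. g (x * D + y))"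
        using contr by simp
    qed simp
    then show "nrm {..<?d} (ap ?d (kern (rot H)) f) \<le> nrm {..<?d} f"
      unfolding nrm_rot[OF Hc] using Wn[of f] by (metis mult_1)
  next
    fix f
    have "is_unitary ?d (rot ?U)" unfolding rot_def
      using is_unitary_kron[OF time_evol_unitary is_unitary_one] W_unitary adj_W_unitary
      by (intro is_unitary_mult) auto
    then show "nrm {..<?d} (ap ?d (kern (rot ?U)) f) = nrm {..<?d} f" by (rule nrm_unitary)
  next
    fix f
    let ?g = "ap ?d (kern (adj W)) f"
    let ?KU = "ap ?d (kern (kron ?U (1\<^sub>m D)))" and ?KH = "ap ?d (kern (kron H (1\<^sub>m D)))"
    let ?r = "\<lambda>i. ?KU ?g i - (?g i - \<i> * \<tau> * ?KH ?g i)"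
    have "f i = ap ?d (kern W) ?g i" if i: "i < ?d" for i
    proof -
      have "ap ?d (kern W) ?g i = ap ?d (kern (W * adj W)) f i"
        using i by (intro ap_kern_mult[symmetric]) auto
      also have "\<dots> = (\<Sum>j<?d. if j = i then f j else 0)"
        unfolding W_rows ap_def using i by (intro sum.cong refl) (auto simp: kern_def)
      finally show ?thesis using i by simp
    qed
    then have "nrm {..<?d} (\<lambda>i. ap ?d (kern (rot ?U)) f i - (f i - \<i> * \<tau> * ap ?d (kern (rot H)) f i)) =
       nrm {..<?d} (ap ?d (kern W) ?r)"
      by (intro nrm_cong) (simp add: ap_diff ap_scale ap_rot)
    also have "\<dots> = nrm {..<?d} ?r" by (rule nrm_unitary[OF W_unitary])
    also have "\<dots> \<le> \<tau>\<^sup>2 * nrm {..<?d} ?g"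
    proof (rule nrm_lift_le)
      fix y :: nat assume y: "y < D"
      let ?gy = "\<lambda>x. ?g (x * D + y)"
      have "nrm {..<D} (\<lambda>x. ?r (x * D + y)) =
        nrm {..<D} (\<lambda>x. ap D (kern ?U) ?gy x - (?gy x - \<i> * \<tau> * ap D (kern H) ?gy x))"
        using y by (intro nrm_cong) (simp add: ap_kron_one)
      also have "\<dots> \<le> \<tau>\<^sup>2 * nrm {..<D} ?gy" by (rule time_evol_taylor[OF \<tau>])
      finally show "nrm {..<D} (\<lambda>x. ?r (x * D + y)) \<le> \<tau>\<^sup>2 * nrm {..<D} ?gy" .
    qed simp
    finally show "nrm {..<?d} (\<lambda>i. ap ?d (kern (rot ?U)) f i - (f i - \<i> * \<tau> * ap ?d (kern (rot H)) f i))
      \<le> \<tau>\<^sup>2 * nrm {..<?d} f" by (simp only: Wn)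
  qed
qed

lemma run_alg_state:
  assumes H: "hamiltonian n H" and \<tau>: "0 \<le> \<tau>" "\<tau> \<le> 1"
  shows "final_state n (run_alg k \<tau> m) H =
    vec (D * D) ((zeno.step (D * D) (high k) (kern (rot (time_evol H \<tau>))) ^^ Suc m) e0)"
proof -
  interpret zeno "D * D" "high k" "kern (rot H)" "kern (rot (time_evol H \<tau>))" \<tau>
    by (rule zeno_hamiltonian[OF assms])
  have Hc: "H \<in> carrier_mat D D" using H by (simp add: hamiltonian_def is_hermitian_def)
  let ?d = "D * D" and ?K = "kron (time_evol H \<tau>) (1\<^sub>m D)" and ?S = "refl_mat k"
  have U: "time_evol H \<tau> \<in> carrier_mat D D" using Hc by (rule time_evol_carrier)
  have K: "?K \<in> carrier_mat ?d ?d" using U by simp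
  \<comment> \<open>In Pauli coordinates one query followed by the reflection is exactly
    \<open>step\<close>. The intermediate unitaries append \<open>adj W\<close> to this, the last
    one does not.\<close>
  have one: "(?S * W) *\<^sub>v (?K *\<^sub>v (adj W *\<^sub>v vec ?d g)) = vec ?d (step g)" for g
  proof -
    have aW: "adj W \<in> carrier_mat ?d ?d" by simp
    have "(?S * W) *\<^sub>v (?K *\<^sub>v (adj W *\<^sub>v vec ?d g)) = ?S *\<^sub>v (W *\<^sub>v (?K *\<^sub>v (adj W *\<^sub>v vec ?d g)))"
      using K by (intro assoc_mult_mat_vec[of _ ?d ?d _ ?d]) (auto intro!: mult_mat_vec_carrier[of _ ?d ?d])
    also have "W *\<^sub>v (?K *\<^sub>v (adj W *\<^sub>v vec ?d g)) = rot (time_evol H \<tau>) *\<^sub>v vec ?d g"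
      unfolding rot_def
      by (subst assoc_mult_mat_vec[OF W_carrier mult_carrier_mat[OF K aW]], simp)
         (subst assoc_mult_mat_vec[OF K aW], simp_all)
    also have "?S *\<^sub>v (rot (time_evol H \<tau>) *\<^sub>v vec ?d g) = vec ?d (step g)"
    proof (rule eq_vecI)
      fix i assume "i < dim_vec (vec ?d (step g))"
      then have i: "i < ?d" by simp
      have "rot (time_evol H \<tau>) *\<^sub>v vec ?d g \<in> carrier_vec ?d"
        using rot_carrier[OF U] by (intro mult_mat_vec_carrier[of _ ?d ?d]) auto
      then show "(?S *\<^sub>v (rot (time_evol H \<tau>) *\<^sub>v vec ?d g)) $ i = vec ?d (step g) $ i"
        using i by (simp add: refl_vec mult_vec_ap[OF rot_carrier[OF U]] step_def \<sigma>_def del: index_mult_mat_vec)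
    qed (use carrier_matD[OF refl_carrier] in simp)
    finally show ?thesis .
  qed
  have init: "adj W *\<^sub>v unit_vec ?d 0 = adj W *\<^sub>v vec ?d e0"
    by (rule arg_cong[of _ _ "\<lambda>x. adj W *\<^sub>v x"]) (auto simp: e0_def unit_vec_def)
  have iter: "fold (query_step n H) (replicate j (\<tau>, adj W * (?S * W))) (adj W *\<^sub>v vec ?d g) =
      adj W *\<^sub>v vec ?d ((step ^^ j) g)" for j g
  proof (induction j arbitrary: g)
    case (Suc j)
    have "(adj W * (?S * W)) *\<^sub>v (?K *\<^sub>v (adj W *\<^sub>v vec ?d g)) = adj W *\<^sub>v ((?S * W) *\<^sub>v (?K *\<^sub>v (adj W *\<^sub>v vec ?d g)))"
      using K by (intro assoc_mult_mat_vec[of _ ?d ?d _ ?d])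
        (auto intro!: mult_mat_vec_carrier[of _ ?d ?d] mult_carrier_mat[of _ _ ?d])
    then show ?case using Suc[of "step g"] by (simp add: one funpow_swap1)
  qed simp
  have "final_state n (run_alg k \<tau> m) H = fold (query_step n H)
      (replicate m (\<tau>, adj W * (?S * W)) @ [(\<tau>, ?S * W)]) (adj W *\<^sub>v unit_vec ?d 0)"
    by (simp add: final_state_def run_alg_def power_add zip_append)
  also have "\<dots> = vec ?d ((step ^^ Suc m) e0)"
    unfolding init by (simp only: fold_append o_apply iter fold.simps id_apply prod.case one funpow.simps(2))
  finally show ?thesis .
qed

text \<open>The parameter \<open>2 * m - 1\<close> gives \<open>2 * m\<close> queries. Their number
  must be even because the reflections act in pairs, and each pair covers the time
  \<open>2 * \<tau>\<close>.\<close>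

theorem run_alg_amplitude:
  assumes H: "hamiltonian n H" and \<tau>: "0 \<le> \<tau>" "\<tau> \<le> 1" and m: "0 < m" and t: "t = m * (2 * \<tau>)" "t \<le> 1/2"
  shows "dim_vec (final_state n (run_alg k \<tau> (2 * m - 1)) H) = D * D"
    and "nrm {..<D * D} (($) (final_state n (run_alg k \<tau> (2 * m - 1)) H)) = 1"
    and "\<bar>nrm (high k) (($) (final_state n (run_alg k \<tau> (2 * m - 1)) H)) - t * dist_k_local n k H\<bar>
      \<le> 5 * t ^ 3 * dist_k_local n k H + 2 * t * (2 * \<tau>)"
proof -
  interpret zeno "D * D" "high k" "kern (rot H)" "kern (rot (time_evol H \<tau>))" \<tau>
    by (rule zeno_hamiltonian[OF assms(1-3)])
  have Hh: "is_hermitian D H" "H \<in> carrier_mat D D" using H by (simp_all add: hamiltonian_def is_hermitian_def)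
  have st: "final_state n (run_alg k \<tau> (2 * m - 1)) H = vec (D * D) ((step ^^ (2 * m)) e0)"
    using run_alg_state[OF assms(1-3), of k "2 * m - 1"] m by simp
  show "dim_vec (final_state n (run_alg k \<tau> (2 * m - 1)) H) = D * D" unfolding st by simp
  have "n2 ((step ^^ j) e0) = 1" for j by (induction j) (auto simp: nrm_e0 d)
  moreover have "n2 (($) (vec (D * D) f)) = n2 f" for f by (rule nrm_cong) simp
  ultimately show "nrm {..<D * D} (($) (final_state n (run_alg k \<tau> (2 * m - 1)) H)) = 1" unfolding st by simp
  have "\<eta> = dist_k_local n k H"
    unfolding dist_k_local_eq[OF Hh(1)] high_norm_def \<eta>_def
  proof (rule nrm_cong)
    fix i assume "i \<in> high k"
    then have "i < D * D" using high_zero(2) by blast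
    then show "h i = coeff H (f i)" by (simp only: h_def rot_column[OF Hh(2)])
  qed
  moreover have "nrm (high k) (($) (vec (D * D) f)) = nrm (high k) f" for f
  proof (rule nrm_cong)
    fix i assume "i \<in> high k"
    then have "i < D * D" using high_zero(2) by blast
    then show "vec (D * D) f $ i = f i" by (rule index_vec)
  qed
  ultimately show "\<bar>nrm (high k) (($) (final_state n (run_alg k \<tau> (2 * m - 1)) H)) - t * dist_k_local n k H\<bar>
      \<le> 5 * t ^ 3 * dist_k_local n k H + 2 * t * (2 * \<tau>)"
    using amplitude[of t m] t unfolding st by (simp add: s_def)
qed

end

section \<open>The tolerant test\<close>

text \<open>The tilt is \<open>1 + x = \<mu> / u\<close>. With \<open>ln (1 + x)\<close> at least
  \<open>x / (1 + x)\<close> the exponent collapses to \<open>- (t * u * x)^2\<close>, and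
  \<open>u * x = \<Delta> / 4\<close>. The result is independent of \<open>u\<close>, so small
  distances do not require more runs.\<close>

lemma close_exponent:
  fixes u \<Delta> t p \<mu> :: real
  assumes "0 < u" "0 < \<Delta>" "\<mu> = u + \<Delta> / 4" "p \<le> t\<^sup>2 * u\<^sup>2" and x: "x = \<Delta> / (4 * u)"
  shows "x * p - (t\<^sup>2 * \<mu>\<^sup>2) * ln (1 + x) \<le> - (t\<^sup>2 * \<Delta>\<^sup>2 / 16)"
proof -
  have xp: "0 < x" and ux: "u * x = \<Delta> / 4" using assms by (simp_all add: x)
  have mu: "\<mu> = u * (1 + x)" using ux assms by (simp add: algebra_simps)
  have "1 - 1 / (1 + x) \<le> ln (1 + x)" using ln_le_minus_one[of "inverse (1 + x)"] xp
    by (simp add: ln_inverse divide_inverse)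
  then have l: "x / (1 + x) \<le> ln (1 + x)" using xp by (simp add: field_simps)
  have "x * p \<le> x * (t\<^sup>2 * u\<^sup>2)" using assms xp by (intro mult_left_mono) auto
  moreover have "(t\<^sup>2 * \<mu>\<^sup>2) * (x / (1 + x)) \<le> (t\<^sup>2 * \<mu>\<^sup>2) * ln (1 + x)"
    using l by (intro mult_left_mono) auto
  moreover have "(t\<^sup>2 * \<mu>\<^sup>2) * (x / (1 + x)) = t\<^sup>2 * u\<^sup>2 * (1 + x) * x"
    using xp unfolding mu by (simp add: power_mult_distrib power2_eq_square)
  ultimately have "x * p - (t\<^sup>2 * \<mu>\<^sup>2) * ln (1 + x) \<le> x * (t\<^sup>2 * u\<^sup>2) - t\<^sup>2 * u\<^sup>2 * (1 + x) * x" by linarith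
  also have "\<dots> = - (t\<^sup>2 * (u * x)\<^sup>2)" by (simp add: power2_eq_square algebra_simps)
  finally show ?thesis unfolding ux by (simp add: power_divide)
qed

text \<open>The mirror image of \<open>close_exponent\<close> for the lower tail, with tilt
  \<open>1 - x = \<mu> / w\<close> below 1. The assumption on \<Delta> keeps this tilt
  positive.\<close>

lemma far_exponent:
  fixes w \<Delta> t p \<mu> :: real
  assumes "\<Delta> < 4 * w" "0 < \<Delta>" "\<mu> = w - \<Delta> / 4" "t\<^sup>2 * w\<^sup>2 \<le> p" and x: "x = \<Delta> / (4 * w)"
  shows "- x * p - (t\<^sup>2 * \<mu>\<^sup>2) * ln (1 - x) \<le> - (t\<^sup>2 * \<Delta>\<^sup>2 / 16)"
proof -
  have w: "0 < w" using assms by linarith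
  have xp: "0 < x" "x < 1" and wx: "w * x = \<Delta> / 4" using assms w by (simp_all add: x)
  have mu: "\<mu> = w * (1 - x)" using wx assms by (simp add: algebra_simps)
  have "1 - 1 / (1 - x) \<le> ln (1 - x)" using ln_le_minus_one[of "inverse (1 - x)"] xp
    by (simp add: ln_inverse divide_inverse)
  then have l: "- ln (1 - x) \<le> x / (1 - x)" using xp by (simp add: field_simps)
  have "x * (t\<^sup>2 * w\<^sup>2) \<le> x * p" using assms xp by (intro mult_left_mono) auto
  moreover have "(t\<^sup>2 * \<mu>\<^sup>2) * (- ln (1 - x)) \<le> (t\<^sup>2 * \<mu>\<^sup>2) * (x / (1 - x))"
    using l by (intro mult_left_mono) auto
  moreover have "(t\<^sup>2 * \<mu>\<^sup>2) * (x / (1 - x)) = t\<^sup>2 * w\<^sup>2 * (1 - x) * x"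
    using xp unfolding mu by (simp add: power_mult_distrib power2_eq_square)
  ultimately have "- x * p - (t\<^sup>2 * \<mu>\<^sup>2) * ln (1 - x) \<le> t\<^sup>2 * w\<^sup>2 * (1 - x) * x - x * (t\<^sup>2 * w\<^sup>2)" by simp
  also have "\<dots> = - (t\<^sup>2 * (w * x)\<^sup>2)" by (simp add: power2_eq_square algebra_simps)
  finally show ?thesis unfolding wx by (simp add: power_divide)
qed

text \<open>The amplitude is compared with \<open>t * \<mu>\<close>, so the fraction of hits is
  compared with the square of this; few hits mean acceptance. A margin of
  \<open>t * \<Delta> / 4\<close> on either side gives the exponent
  \<open>- N * t^2 * \<Delta>^2 / 16\<close>, which explains the 16 in the bound on
  \<open>N\<close>.\<close>

lemma threshold_test:
  fixes v :: "complex vec" and \<mu> \<Delta> t \<delta> :: real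
  assumes v: "dim_vec v = d" "nrm {..<d} (($) v) = 1" and I: "I \<subseteq> {..<d}"
    and \<Delta>: "0 < \<Delta>" "\<Delta> < 4 * \<mu>" and t: "0 < t" and \<delta>: "0 < \<delta>"
    and N: "16 * ln (1 / \<delta>) \<le> N * (t\<^sup>2 * \<Delta>\<^sup>2)"
    and S: "S = {i\<in>{..<d ^ N}. real (cnt d I N i) < N * (t\<^sup>2 * \<mu>\<^sup>2)}"
  shows "nrm I (($) v) \<le> t * (\<mu> - \<Delta> / 4) \<Longrightarrow> 1 - \<delta> \<le> (\<Sum>i\<in>S. (cmod (kpow v N $ i))\<^sup>2)"
    and "t * (\<mu> + \<Delta> / 4) \<le> nrm I (($) v) \<Longrightarrow> (\<Sum>i\<in>S. (cmod (kpow v N $ i))\<^sup>2) \<le> \<delta>"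
proof -
  let ?\<theta> = "t\<^sup>2 * \<mu>\<^sup>2" and ?p = "(nrm I (($) v))\<^sup>2"
  have fin: "exp (N * e) \<le> \<delta>" if "e \<le> - (t\<^sup>2 * \<Delta>\<^sup>2 / 16)" for e :: real
  proof -
    have "N * e \<le> N * (- (t\<^sup>2 * \<Delta>\<^sup>2 / 16))" using that by (intro mult_left_mono) auto
    also have "\<dots> \<le> ln \<delta>" using N \<delta> by (simp add: ln_div)
    finally have "exp (N * e) \<le> exp (ln \<delta>)" by (simp only: exp_le_cancel_iff)
    then show ?thesis using \<delta> by simp
  qed
  {
    assume a: "nrm I (($) v) \<le> t * (\<mu> - \<Delta> / 4)"
    define u where "u = \<mu> - \<Delta> / 4"
    define x where "x = \<Delta> / (4 * u)"
    have u: "0 < u" using \<Delta> by (simp add: u_def)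
    have x: "0 < x" using u \<Delta> by (simp add: x_def)
    \<comment> \<open>Rejection is the upper tail, bounded with a tilt above 1. Total probability 1
      turns this into a bound on acceptance.\<close>
    let ?J = "{..<d ^ N} - S"
    have "?p \<le> (t * u)\<^sup>2" using a unfolding u_def by (intro power_mono) auto
    then have e: "(1 + x - 1) * ?p - ?\<theta> * ln (1 + x) \<le> - (t\<^sup>2 * \<Delta>\<^sup>2 / 16)"
      using close_exponent[OF u \<Delta>(1), of \<mu> ?p t x] by (simp add: u_def x_def power_mult_distrib)
    have "(\<Sum>i\<in>?J. (cmod (kpow v N $ i))\<^sup>2) \<le> exp (N * ((1 + x - 1) * ?p - ?\<theta> * ln (1 + x)))"
      by (rule cnt_exponential_markov[OF v I]) (use x in \<open>auto simp: S intro!: mult_nonneg_nonneg\<close>)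
    also have "\<dots> \<le> \<delta>" by (rule fin[OF e])
    finally have "(\<Sum>i\<in>?J. (cmod (kpow v N $ i))\<^sup>2) \<le> \<delta>" .
    moreover have "(\<Sum>i\<in>?J. (cmod (kpow v N $ i))\<^sup>2) + (\<Sum>i\<in>S. (cmod (kpow v N $ i))\<^sup>2) = 1"
    proof -
      have "S \<subseteq> {..<d ^ N}" by (auto simp: S)
      from sum.subset_diff[OF this finite_lessThan, of "\<lambda>i. (cmod (kpow v N $ i))\<^sup>2"]
      show ?thesis using cnt_total[OF v, of N] by linarith
    qed
    ultimately show "1 - \<delta> \<le> (\<Sum>i\<in>S. (cmod (kpow v N $ i))\<^sup>2)" by linarith
  }
  {
    assume a: "t * (\<mu> + \<Delta> / 4) \<le> nrm I (($) v)"
    define w where "w = \<mu> + \<Delta> / 4"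
    define x where "x = \<Delta> / (4 * w)"
    have w: "\<Delta> < 4 * w" "0 < w" using \<Delta> by (simp_all add: w_def)
    have x: "0 < x" "x < 1" using w \<Delta> by (simp_all add: x_def)
    have "(t * w)\<^sup>2 \<le> ?p" using a t w unfolding w_def by (intro power_mono) auto
    then have e: "(1 - x - 1) * ?p - ?\<theta> * ln (1 - x) \<le> - (t\<^sup>2 * \<Delta>\<^sup>2 / 16)"
      using far_exponent[OF w(1) \<Delta>(1), of \<mu> t ?p x] by (simp add: w_def x_def power_mult_distrib)
    have "(\<Sum>i\<in>S. (cmod (kpow v N $ i))\<^sup>2) \<le> exp (N * ((1 - x - 1) * ?p - ?\<theta> * ln (1 - x)))"
      by (rule cnt_exponential_markov[OF v I]) (use x in \<open>auto simp: S ln_le_zero_iff intro!: mult_nonpos_nonpos\<close>)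
    also have "\<dots> \<le> \<delta>" by (rule fin[OF e])
    finally show "(\<Sum>i\<in>S. (cmod (kpow v N $ i))\<^sup>2) \<le> \<delta>" .
  }
qed

text \<open>As \<delta> tends to 1 the permitted number of queries can fall below one, so a circuit
  without queries is needed there: a Hadamard gate on a single ancilla.\<close>

lemma accept_prob_coin:
  "\<exists>A. valid_qalg n A \<and> times A = [] \<and> (\<forall>H. accept_prob n A H = 1 / 2)"
proof -
  define h where "h = complex_of_real (1 / sqrt 2)"
  have h: "cnj h * h = 1 / 2" "cmod h ^ 2 = 1 / 2"
  proof -
    show ch: "cmod h ^ 2 = 1 / 2" by (simp add: h_def norm_divide power_divide)
    have "cnj h * h = complex_of_real (cmod h ^ 2)" by (simp only: complex_norm_square mult.commute)
    then show "cnj h * h = 1 / 2" by (simp only: ch) simp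
  qed
  define V where "V = mat 2 2 (\<lambda>(i,j). if i = 1 \<and> j = 1 then - h else h)"
  have "adj V * V = 1\<^sub>m 2"
  proof (rule eq_matI)
    fix i j assume "i < dim_row (1\<^sub>m 2 :: complex mat)" "j < dim_col (1\<^sub>m 2 :: complex mat)"
    then have "i = 0 \<or> i = 1" "j = 0 \<or> j = 1" by auto
    then show "(adj V * V) $$ (i, j) = 1\<^sub>m 2 $$ (i, j)"
      by (elim disjE) (simp_all add: mult_entry V_def h numeral_2_eq_2 del: index_mult_mat(1))
  qed (auto simp: V_def)
  then have V: "is_unitary 2 V" by (simp add: is_unitary_def V_def)
  let ?U = "kron (1\<^sub>m (2^n)) V"
  have U: "is_unitary (2 ^ (n + 1)) ?U" using is_unitary_kron[OF is_unitary_one V, of "2^n"] by (simp add: mult.commute)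
  have ent: "(?U *\<^sub>v unit_vec (2 * 2 ^ n) 0) $ 0 = h"
  proof -
    have "(?U *\<^sub>v unit_vec (2 * 2 ^ n) 0) $ 0 = ?U $$ (0,0)"
      by (subst mult_vec_entry) (auto simp: V_def if_distrib cong: if_cong)
    then show ?thesis by (simp add: V_def)
  qed
  let ?A = "\<lparr>anc = 1, times = [], unis = [?U], acc = {0}\<rparr>"
  have "valid_qalg n ?A" using U by (simp add: valid_qalg_def)
  moreover have "accept_prob n ?A H = 1 / 2" for H
    using ent h by (simp add: accept_prob_def final_state_def)
  ultimately show ?thesis by (intro exI[of _ ?A]) simp
qed

lemma nat_ceiling_le:
  fixes y :: real
  assumes "0 < y"
  shows "0 < nat \<lceil>y\<rceil>" "y \<le> nat \<lceil>y\<rceil>" "nat \<lceil>y\<rceil> \<le> y + 1"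
  using assms by linarith+

text \<open>A positive lower bound is what allows the 1 lost by rounding up the number of runs to be
  absorbed into the logarithm.\<close>

lemma ln_inverse_ge_half:
  fixes \<delta> :: real
  assumes "0 < \<delta>" "\<delta> < 1/2"
  shows "1/2 \<le> ln (1 / \<delta>)"
proof -
  have "2 \<le> 1 / \<delta>" using assms by (simp add: field_simps)
  then have "ln 2 \<le> ln (1 / \<delta>)" using assms by (intro ln_mono) auto
  moreover have "1 / 2 \<le> ln (2::real)" using ln_le_minus_one[of "1 / 2::real"] by (simp add: ln_div)
  ultimately show ?thesis by linarith
qed

text \<open>The 40 makes \<open>5 * t^2 * \<epsilon>2\<close> equal to \<open>\<Delta> / 8\<close>,
  half of the permitted margin. The 7 bounds the square root of 40, and \<Delta> at most
  \<open>7 * t\<close> later absorbs the rounding of the number of steps.\<close>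

lemma evolution_time:
  fixes \<epsilon>2 \<Delta> :: real
  assumes \<Delta>: "0 < \<Delta>" "\<Delta> \<le> \<epsilon>2" "\<epsilon>2 \<le> 1" and t: "t = sqrt (\<Delta> / (40 * \<epsilon>2))"
  shows "0 < t" "t \<le> 1/2" "40 * t\<^sup>2 * \<epsilon>2 = \<Delta>" "\<Delta> \<le> 7 * t"
    "1 / (t * \<Delta>\<^sup>2) \<le> 7 * sqrt (\<epsilon>2 / \<Delta> ^ 5)" "1 / (t * \<Delta> ^ 3) \<le> 7 * sqrt (\<epsilon>2 / \<Delta> ^ 7)"
proof -
  have e: "0 < \<epsilon>2" using \<Delta> by linarith
  have q: "0 < \<Delta> / (40 * \<epsilon>2)" using \<Delta> e by simp
  show t0: "0 < t" using q by (simp add: t)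
  have t2: "t\<^sup>2 = \<Delta> / (40 * \<epsilon>2)" using q by (simp add: t)
  show "40 * t\<^sup>2 * \<epsilon>2 = \<Delta>" using e by (simp add: t2)
  have "t\<^sup>2 \<le> (1/2)\<^sup>2" unfolding t2 using \<Delta> e by (simp add: field_simps power2_eq_square)
  then show "t \<le> 1/2" by (rule power2_le_imp_le) simp
  have "\<Delta>\<^sup>2 \<le> (7 * t)\<^sup>2"
  proof -
    have "\<Delta> * \<epsilon>2 \<le> 1 * 1" using \<Delta> e by (intro mult_mono) auto
    then have "\<Delta> * (\<Delta> * \<epsilon>2) \<le> \<Delta> * 1" using \<Delta> by (intro mult_left_mono) auto
    then have "\<Delta>\<^sup>2 * (40 * \<epsilon>2) \<le> 49 * \<Delta>" using \<Delta> by (simp add: power2_eq_square algebra_simps)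
    then show ?thesis unfolding power_mult_distrib t2 using e by (simp add: field_simps)
  qed
  then show "\<Delta> \<le> 7 * t" using t0 by (intro power2_le_imp_le[of \<Delta> "7 * t"]) auto
  have sq: "1 / (t * \<Delta> ^ j) \<le> 7 * sqrt (\<epsilon>2 / \<Delta> ^ (2 * j + 1))" for j
  proof (rule power2_le_imp_le)
    have "(1 / (t * \<Delta> ^ j))\<^sup>2 = 1 / (t\<^sup>2 * \<Delta> ^ (2 * j))"
      by (simp add: power_divide power_mult_distrib power_mult[symmetric] mult.commute)
    also have "\<dots> = 40 * (\<epsilon>2 / \<Delta> ^ (2 * j + 1))" unfolding t2 using e \<Delta> by (simp add: field_simps)
    also have "\<dots> \<le> 49 * (\<epsilon>2 / \<Delta> ^ (2 * j + 1))" using e \<Delta> by (intro mult_right_mono) auto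
    also have "\<dots> = (7 * sqrt (\<epsilon>2 / \<Delta> ^ (2 * j + 1)))\<^sup>2" unfolding power_mult_distrib using e \<Delta> by simp
    finally show "(1 / (t * \<Delta> ^ j))\<^sup>2 \<le> (7 * sqrt (\<epsilon>2 / \<Delta> ^ (2 * j + 1)))\<^sup>2" .
  qed (use e \<Delta> in simp)
  show "1 / (t * \<Delta>\<^sup>2) \<le> 7 * sqrt (\<epsilon>2 / \<Delta> ^ 5)" using sq[of 2] by simp
  show "1 / (t * \<Delta> ^ 3) \<le> 7 * sqrt (\<epsilon>2 / \<Delta> ^ 7)" using sq[of 3] by simp
qed

lemma locality_test:
  fixes \<epsilon>1 \<epsilon>2 \<delta> :: real
  assumes e: "0 \<le> \<epsilon>1" "\<epsilon>1 < \<epsilon>2" "\<epsilon>2 \<le> 1" and \<delta>: "0 < \<delta>" "\<delta> < 1/2"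
  shows "\<exists>A. valid_qalg n A \<and>
     num_queries A \<le> 10000 * sqrt (\<epsilon>2 / (\<epsilon>2 - \<epsilon>1) ^ 7) * ln (1 / \<delta>) \<and>
     total_time A \<le> 10000 * sqrt (\<epsilon>2 / (\<epsilon>2 - \<epsilon>1) ^ 5) * ln (1 / \<delta>) \<and>
     (\<forall>H. hamiltonian n H \<longrightarrow>
        (dist_k_local n k H \<le> \<epsilon>1 \<longrightarrow> accept_prob n A H \<ge> 1 - \<delta>) \<and>
        (dist_k_local n k H \<ge> \<epsilon>2 \<longrightarrow> accept_prob n A H \<le> \<delta>))"
proof -
  define \<Delta> where "\<Delta> = \<epsilon>2 - \<epsilon>1"
  define t where "t = sqrt (\<Delta> / (40 * \<epsilon>2))"
  have \<Delta>: "0 < \<Delta>" "\<Delta> \<le> \<epsilon>2" "\<Delta> \<le> 1" using e by (simp_all add: \<Delta>_def)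
  note t = evolution_time[OF \<Delta>(1,2) e(3) t_def]
  \<comment> \<open>The 16 gives \<open>2 * \<tau>\<close> at most \<open>\<Delta> / 16\<close>,
    hence a decoupling error of at most \<open>t * \<Delta> / 8\<close>. With the cubic error this
    fills the margin \<open>t * \<Delta> / 4\<close>.\<close>
  define m where "m = nat \<lceil>16 * t / \<Delta>\<rceil>"
  have m: "0 < m" "16 * t / \<Delta> \<le> m" "m \<le> 16 * t / \<Delta> + 1"
    using nat_ceiling_le[of "16 * t / \<Delta>"] t(1) \<Delta>(1) by (simp_all add: m_def)
  define \<tau> where "\<tau> = t / (2 * m)"
  have tm: "t = m * (2 * \<tau>)" using m by (simp add: \<tau>_def)
  have s: "2 * \<tau> \<le> \<Delta> / 16" "0 \<le> \<tau>"
  proof -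
    have "16 * t \<le> m * \<Delta>" using m \<Delta> by (simp add: field_simps)
    then show "2 * \<tau> \<le> \<Delta> / 16" using m by (simp add: \<tau>_def field_simps)
  qed (use t m in \<open>simp add: \<tau>_def\<close>)
  have \<tau>: "\<tau> \<le> 1" using s \<Delta> by linarith
  define L where "L = ln (1 / \<delta>)"
  have L: "1/2 \<le> L" using ln_inverse_ge_half[OF \<delta>] by (simp add: L_def)
  define N where "N = nat \<lceil>16 * L / (t\<^sup>2 * \<Delta>\<^sup>2)\<rceil>"
  have tD: "0 < t\<^sup>2 * \<Delta>\<^sup>2" using t \<Delta> by simp
  have N: "0 < N" "16 * L / (t\<^sup>2 * \<Delta>\<^sup>2) \<le> N" "N \<le> 16 * L / (t\<^sup>2 * \<Delta>\<^sup>2) + 1"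
    using nat_ceiling_le[of "16 * L / (t\<^sup>2 * \<Delta>\<^sup>2)"] tD L by (simp_all add: N_def)
  have N16: "16 * L \<le> N * (t\<^sup>2 * \<Delta>\<^sup>2)" using N tD by (simp add: field_simps)
  \<comment> \<open>Rounding up adds at most 1, which is bounded by
    \<open>2 * L / (t^2 * \<Delta>^2)\<close> because \<open>L\<close> is at least 1/2.\<close>
  have N18: "N \<le> 18 * L / (t\<^sup>2 * \<Delta>\<^sup>2)"
  proof -
    have "t\<^sup>2 * \<Delta>\<^sup>2 \<le> 1 * 1" using t \<Delta> by (intro mult_mono power_le_one) auto
    then have "t\<^sup>2 * \<Delta>\<^sup>2 \<le> 2 * L" using L by linarith
    then have "1 \<le> 2 * L / (t\<^sup>2 * \<Delta>\<^sup>2)" using tD by (simp add: field_simps)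
    then show ?thesis using N(3) by (simp add: add_divide_distrib[symmetric])
  qed
  obtain f where "pauli_basis n f" using pauli_basis_exists by blast
  then interpret pauli_basis n f .
  let ?R = "run_alg k \<tau> (2 * m - 1)"
  have R: "valid_qalg n ?R" "num_queries ?R = 2 * m" "total_time ?R = t" "2^(n + anc ?R) = D * D"
    using run_alg_valid[OF s(2)] m tm
    by (simp_all add: run_alg_def num_queries_def total_time_def power_add sum_list_replicate of_nat_diff algebra_simps)
  obtain C where C: "valid_qalg n C" "num_queries C = N * (2 * m)" "total_time C = N * t"
    "2^(n + anc C) = (D * D) ^ N"
    "\<And>H. H \<in> carrier_mat D D \<Longrightarrow> final_state n C H = kpow (final_state n ?R H) N"
    using repeat_alg[OF R(1) N(1)] unfolding R(2,3,4) by blast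
  define \<mu> where "\<mu> = (\<epsilon>1 + \<epsilon>2) / 2"
  define S where "S = {i\<in>{..<(D * D) ^ N}. real (cnt (D * D) (high k) N i) < N * (t\<^sup>2 * \<mu>\<^sup>2)}"
  \<comment> \<open>The final state does not depend on the accepting set, so the latter can be
    chosen after composing the runs.\<close>
  let ?A = "C\<lparr>acc := S\<rparr>"
  have "valid_qalg n ?A" using C(1,4) by (auto simp: valid_qalg_def S_def)
  moreover have "num_queries ?A \<le> 10000 * sqrt (\<epsilon>2 / (\<epsilon>2 - \<epsilon>1) ^ 7) * ln (1 / \<delta>)"
  proof -
    \<comment> \<open>Rounding again: 16 becomes 23. The product is
      \<open>18 * 2 * 23 = 828\<close>, and 7 times this is below 10000.\<close>
    have "1 \<le> 7 * t / \<Delta>" using t(4) \<Delta> by (simp add: field_simps)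
    then have "m \<le> 23 * t / \<Delta>" using m(3) by (simp add: add_divide_distrib[symmetric])
    then have "real N * (2 * m) \<le> (18 * L / (t\<^sup>2 * \<Delta>\<^sup>2)) * (2 * (23 * t / \<Delta>))"
      using N18 by (intro mult_mono) auto
    also have "\<dots> = 828 * L * (1 / (t * \<Delta> ^ 3))" using t(1) \<Delta>(1) by (simp add: field_simps power2_eq_square power3_eq_cube)
    also have "\<dots> \<le> 828 * L * (7 * sqrt (\<epsilon>2 / \<Delta> ^ 7))" using t(6) L by (intro mult_left_mono) auto
    also have "\<dots> = 5796 * (L * sqrt (\<epsilon>2 / \<Delta> ^ 7))" by simp
    also have "\<dots> \<le> 10000 * (L * sqrt (\<epsilon>2 / \<Delta> ^ 7))" using L e \<Delta> by (intro mult_right_mono) auto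
    finally show ?thesis using C(2) by (simp add: num_queries_def L_def \<Delta>_def mult_ac)
  qed
  moreover have "total_time ?A \<le> 10000 * sqrt (\<epsilon>2 / (\<epsilon>2 - \<epsilon>1) ^ 5) * ln (1 / \<delta>)"
  proof -
    have "N * t \<le> (18 * L / (t\<^sup>2 * \<Delta>\<^sup>2)) * t" using N18 t by (intro mult_right_mono) auto
    also have "\<dots> = 18 * L * (1 / (t * \<Delta>\<^sup>2))" using t(1) \<Delta>(1) by (simp add: field_simps power2_eq_square)
    also have "\<dots> \<le> 18 * L * (7 * sqrt (\<epsilon>2 / \<Delta> ^ 5))" using t(5) L by (intro mult_left_mono) auto
    also have "\<dots> = 126 * (L * sqrt (\<epsilon>2 / \<Delta> ^ 5))" by simp
    also have "\<dots> \<le> 10000 * (L * sqrt (\<epsilon>2 / \<Delta> ^ 5))" using L e \<Delta> by (intro mult_right_mono) auto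
    finally show ?thesis using C(3) by (simp add: total_time_def L_def \<Delta>_def mult_ac)
  qed
  moreover have "(dist_k_local n k H \<le> \<epsilon>1 \<longrightarrow> accept_prob n ?A H \<ge> 1 - \<delta>) \<and>
        (dist_k_local n k H \<ge> \<epsilon>2 \<longrightarrow> accept_prob n ?A H \<le> \<delta>)" if H: "hamiltonian n H" for H
  proof -
    define v \<eta> where "v = final_state n ?R H" and "\<eta> = dist_k_local n k H"
    have Hc: "H \<in> carrier_mat D D" using H by (simp add: hamiltonian_def is_hermitian_def)
    have ap: "accept_prob n ?A H = (\<Sum>i\<in>S. (cmod (kpow v N $ i))\<^sup>2)"
      using C(5)[OF Hc] by (simp add: accept_prob_def final_state_def v_def)
    note amp = run_alg_amplitude[OF H s(2) \<tau> m(1) tm t(2), of k, folded v_def \<eta>_def]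
    have \<mu>: "\<Delta> < 4 * \<mu>" "\<mu> - \<Delta> / 4 = \<epsilon>1 + \<Delta> / 4" "\<mu> + \<Delta> / 4 = \<epsilon>2 - \<Delta> / 4"
      using e by (simp_all add: \<mu>_def \<Delta>_def field_simps)
    note test = threshold_test[OF amp(1,2) high_zero(2) \<Delta>(1) \<mu>(1) t(1) \<delta>(1) N16[unfolded L_def] S_def]
    have t5: "5 * t\<^sup>2 * \<epsilon>2 = \<Delta> / 8" using t(3) by simp
    have ts: "2 * t * (2 * \<tau>) \<le> t * (\<Delta> / 8)" using mult_left_mono[OF s(1), of "2 * t"] t(1) by simp
    have \<eta>0: "0 \<le> \<eta>"
    proof -
      have "is_hermitian D H" using H by (simp add: hamiltonian_def)
      then show ?thesis by (simp add: \<eta>_def dist_k_local_eq high_norm_def)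
    qed
    have close: "nrm (high k) (($) v) \<le> t * (\<mu> - \<Delta> / 4)" if "\<eta> \<le> \<epsilon>1"
    proof -
      have "nrm (high k) (($) v) \<le> t * \<eta> + t * (5 * t\<^sup>2 * \<eta>) + t * (\<Delta> / 8)"
        using amp(3) ts by (simp add: power2_eq_square power3_eq_cube abs_le_iff)
      also have "\<dots> \<le> t * \<epsilon>1 + t * (5 * t\<^sup>2 * \<epsilon>2) + t * (\<Delta> / 8)"
        using that e t(1) by (intro add_mono mult_left_mono) auto
      finally show ?thesis unfolding \<mu>(2) t5 by (simp add: algebra_simps)
    qed
    have far: "t * (\<mu> + \<Delta> / 4) \<le> nrm (high k) (($) v)" if "\<epsilon>2 \<le> \<eta>"
    proof -
      \<comment> \<open>The cubic error grows with \<eta>, which may exceed \<epsilon>2. As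
        \<open>1 - 5 * t^2\<close> is nonnegative, signal minus error is monotone in \<eta>, and
        \<eta> = \<epsilon>2 is the worst case.\<close>
      have "5 * t\<^sup>2 \<le> 1"
      proof -
        have "40 * t\<^sup>2 * \<epsilon>2 \<le> 1 * \<epsilon>2" using t(3) \<Delta>(2) by simp
        then have "40 * t\<^sup>2 \<le> 1" using e by (simp only: mult_le_cancel_right_pos)
        then show ?thesis by simp
      qed
      then have "\<epsilon>2 * (1 - 5 * t\<^sup>2) \<le> \<eta> * (1 - 5 * t\<^sup>2)" using that by (intro mult_right_mono) auto
      then have "t * (\<epsilon>2 * (1 - 5 * t\<^sup>2)) \<le> t * (\<eta> * (1 - 5 * t\<^sup>2))" using t(1) by (intro mult_left_mono) auto
      moreover have "t * (\<eta> * (1 - 5 * t\<^sup>2)) - t * (\<Delta> / 8) \<le> nrm (high k) (($) v)"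
        using amp(3) ts by (simp add: power2_eq_square power3_eq_cube abs_le_iff algebra_simps)
      moreover have "t * (\<epsilon>2 * (1 - 5 * t\<^sup>2)) - t * (\<Delta> / 8) = t * (\<epsilon>2 - 5 * t\<^sup>2 * \<epsilon>2 - \<Delta> / 8)"
        by (simp add: algebra_simps)
      ultimately show ?thesis unfolding \<mu>(3) t5 by simp
    qed
    show ?thesis unfolding ap \<eta>_def[symmetric] using test close far by blast
  qed
  ultimately show ?thesis by blast
qed

theorem theorem1p1:
  "\<exists>C>0. \<forall>(\<epsilon>1::real) (\<epsilon>2::real) (\<delta>::real) (k::nat) (n::nat).
     0 \<le> \<epsilon>1 \<and> \<epsilon>1 < \<epsilon>2 \<and> \<epsilon>2 \<le> 1 \<and> 0 < \<delta> \<and> \<delta> < 1 \<longrightarrow>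
     (\<exists>A. valid_qalg n A \<and>
          real (num_queries A) \<le> C * sqrt (\<epsilon>2 / (\<epsilon>2 - \<epsilon>1) ^ 7) * ln (1 / \<delta>) \<and>
          total_time A \<le> C * sqrt (\<epsilon>2 / (\<epsilon>2 - \<epsilon>1) ^ 5) * ln (1 / \<delta>) \<and>
          (\<forall>H. hamiltonian n H \<longrightarrow>
             (dist_k_local n k H \<le> \<epsilon>1 \<longrightarrow> accept_prob n A H \<ge> 1 - \<delta>) \<and>
             (dist_k_local n k H \<ge> \<epsilon>2 \<longrightarrow> accept_prob n A H \<le> \<delta>)))"
proof (intro exI[of _ 10000] conjI allI impI)
  fix \<epsilon>1 \<epsilon>2 \<delta> :: real and k n :: nat
  assume a: "0 \<le> \<epsilon>1 \<and> \<epsilon>1 < \<epsilon>2 \<and> \<epsilon>2 \<le> 1 \<and> 0 < \<delta> \<and> \<delta> < 1"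
  show "\<exists>A. valid_qalg n A \<and>
          real (num_queries A) \<le> 10000 * sqrt (\<epsilon>2 / (\<epsilon>2 - \<epsilon>1) ^ 7) * ln (1 / \<delta>) \<and>
          total_time A \<le> 10000 * sqrt (\<epsilon>2 / (\<epsilon>2 - \<epsilon>1) ^ 5) * ln (1 / \<delta>) \<and>
          (\<forall>H. hamiltonian n H \<longrightarrow>
             (dist_k_local n k H \<le> \<epsilon>1 \<longrightarrow> accept_prob n A H \<ge> 1 - \<delta>) \<and>
             (dist_k_local n k H \<ge> \<epsilon>2 \<longrightarrow> accept_prob n A H \<le> \<delta>))"
  proof (cases "\<delta> < 1/2")
    case True
    then show ?thesis using locality_test[of \<epsilon>1 \<epsilon>2 \<delta> n k] a by simp
  next
    case False
    obtain A where A: "valid_qalg n A" "times A = []" "\<And>H. accept_prob n A H = 1 / 2"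
      using accept_prob_coin[of n] by blast
    show ?thesis using a False A(1,2)
      by (intro exI[of _ A] conjI allI impI) (simp_all add: A(3) num_queries_def total_time_def)
  qed
qed simp

end
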